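(* Let $\mathcal{X},\mathcal{Y}$ be compact Polish spaces, $d_\mathcal{X}$ a compatible metric on $\mathcal{X}$, $c\in C(\mathcal{X}\times\mathcal{Y})$, and let $w\colon\mathbb{R}_+\to\mathbb{R}_+$ be a concave modulus of continuity with $w(\delta)>0$ for $\delta>0$ and $|c(x,y)-c(x',y)|\le w(d_\mathcal{X}(x,x'))$ for all $x,x'\in\mathcal{X},y\in\mathcal{Y}$. Let $\mu\in\mathcal{P}(\mathcal{X})$, $\nu\in\mathcal{P}(\mathcal{Y})$, let $X_1,\dots,X_n\sim\mu$ i.i.d. and independently $Y_1,\dots,Y_m\sim\nu$ i.i.d., with empirical measures $\mu_n,\nu_m$, and let $c_{n,m}\in C(\mathcal{X}\times\mathcal{Y})$ be random with $c_{n,m}(x,y)$ measurable for every $(x,y)$. Set $\mathcal{F}:=\mathcal{F}(2\|c\|_\infty+1,2w)$. Assume, as $n,m\to\infty$ with $m/(n+m)\to\lambda\in(0,1)$: (A3) $\sqrt{\tfrac{nm}{n+m}}\,(\mu_n-\mu,\ \nu_m-\nu,\ c_{n,m}-c)\rightsquigarrow(\sqrt\lambda\,\mathbb{G}^\mu,\sqrt{1-\lambda}\,\mathbb{G}^\nu,\mathbb{G}^c)$ in $\ell^\infty(\mathcal{F}^{cc})\times\ell^\infty(\mathcal{F}^c)\times C(\mathcal{X}\times\mathcal{Y})$, where $(\mathbb{G}^\mu,\mathbb{G}^\nu,\mathbb{G}^c)$ is tight and $\mathbb{G}^\mu,\mathbb{G}^\nu$ have the covariance structures of a $\mu$-, resp.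 $\nu$-Brownian bridge. Assume moreover either (B1) $\Pi^\star_c(\mu,\nu)$ consists of a single optimal transport plan; or (B2) $\sup_{f\in\mathcal{F}}\sqrt n(\mu_n-\mu)(f^{c_{n,m}c_{n,m}}-f^{cc})\to0$ and $\sup_{f\in\mathcal{F}}\sqrt m(\nu_m-\nu)(f^{c_{n,m}}-f^{c})\to0$ in outer probability. Then, as $n,m\to\infty$ with $m/(n+m)\to\lambda$, $$\sqrt{\tfrac{nm}{n+m}}\big(OT(\mu_n,\nu_m,c_{n,m})-OT(\mu,\nu,c)\big)\rightsquigarrow\inf_{\pi\in\Pi^\star_c(\mu,\nu)}\pi(\mathbb{G}^c)+\sup_{f\in S_c(\mu,\nu)}\sqrt\lambda\,\mathbb{G}^\mu(f^{cc})+\sqrt{1-\lambda}\,\mathbb{G}^\nu(f^c).$$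
   Context: $OT(\mu,\nu,c):=\inf_{\pi\in\Pi(\mu,\nu)}\int c\,d\pi$; $\Pi^\star_c(\mu,\nu)$ its set of minimizers; $\pi(h)=\int h\,d\pi$. $c$-transforms $f^c(y)=\inf_x c(x,y)-f(x)$, $f^{cc}(x)=\inf_y c(x,y)-f^c(y)$; $\mathcal{G}^c,\mathcal{G}^{cc}$ images of a class. $\mathcal{F}(B,w):=\{f\colon\mathcal{X}\to\mathbb{R}:\|f\|_\infty\le2B,\ |f(x)-f(x')|\le w(d_\mathcal{X}(x,x'))\}$. $S_c(\mu,\nu)$ is the (non-empty) set of $f\in\mathcal{F}$ maximizing $\mu(f^{cc})+\nu(f^c)$, whose maximum equals $OT(\mu,\nu,c)$. Measures act on $\ell^\infty(\mathcal{G})$ via $f\mapsto\int f\,d\mu$. Weak convergence $\rightsquigarrow$ is in the Hoffmann-Jørgensen sense; a $\mu$-Brownian bridge is a centered Gaussian process with $\mathrm{Cov}(\mathbb{G}^\mu(f),\mathbb{G}^\mu(g))=\mu(fg)-\mu(f)\mu(g)$. *)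

theory Defs
  imports "HOL-Probability.Probability"
begin

definition ctrans :: "('x \<times> 'y \<Rightarrow> real) \<Rightarrow> ('x \<Rightarrow> real) \<Rightarrow> 'y \<Rightarrow> real" where
  "ctrans c f y = (INF x. c (x, y) - f x)"

definition cctrans :: "('x \<times> 'y \<Rightarrow> real) \<Rightarrow> ('x \<Rightarrow> real) \<Rightarrow> 'x \<Rightarrow> real" where
  "cctrans c f x = (INF y. c (x, y) - ctrans c f y)"

definition Fclass :: "real \<Rightarrow> (real \<Rightarrow> real) \<Rightarrow> ('x::metric_space \<Rightarrow> real) set" where
  "Fclass B w = {f. (\<forall>x. \<bar>f x\<bar> \<le> 2 * B) \<and> (\<forall>x x'. \<bar>f x - f x'\<bar> \<le> w (dist x x'))}"

definition couplings :: "'x::topological_space measure \<Rightarrow> 'y::topological_space measure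
    \<Rightarrow> ('x \<times> 'y) measure set" where
  "couplings \<mu> \<nu> = {\<pi>. prob_space \<pi> \<and> sets \<pi> = sets borel \<and>
      distr \<pi> borel fst = \<mu> \<and> distr \<pi> borel snd = \<nu>}"

definition OT :: "'x::topological_space measure \<Rightarrow> 'y::topological_space measure
    \<Rightarrow> ('x \<times> 'y \<Rightarrow> real) \<Rightarrow> real" where
  "OT \<mu> \<nu> c = (INF \<pi>\<in>couplings \<mu> \<nu>. integral\<^sup>L \<pi> c)"

definition opt_plans :: "'x::topological_space measure \<Rightarrow> 'y::topological_space measure
    \<Rightarrow> ('x \<times> 'y \<Rightarrow> real) \<Rightarrow> ('x \<times> 'y) measure set" where
  "opt_plans \<mu> \<nu> c = {\<pi> \<in> couplings \<mu> \<nu>. integral\<^sup>L \<pi> c = OT \<mu> \<nu> c}"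

definition Sc :: "('x \<Rightarrow> real) set \<Rightarrow> 'x measure \<Rightarrow> 'y measure \<Rightarrow> ('x \<times> 'y \<Rightarrow> real)
    \<Rightarrow> ('x \<Rightarrow> real) set" where
  "Sc F \<mu> \<nu> c = {f \<in> F. \<forall>g \<in> F.
      integral\<^sup>L \<mu> (cctrans c g) + integral\<^sup>L \<nu> (ctrans c g)
        \<le> integral\<^sup>L \<mu> (cctrans c f) + integral\<^sup>L \<nu> (ctrans c f)}"

definition emp_meas :: "nat \<Rightarrow> (nat \<Rightarrow> 'a::topological_space) \<Rightarrow> 'a measure" where
  "emp_meas n x = measure_of UNIV (sets borel)
     (\<lambda>A. ennreal (real (card {i. i < n \<and> x i \<in> A}) / real n))"

definition concave_modulus :: "(real \<Rightarrow> real) \<Rightarrow> bool" where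
  "concave_modulus w \<longleftrightarrow> w 0 = 0 \<and> (\<forall>t\<ge>0. w t \<ge> 0) \<and> mono_on {0..} w \<and>
     concave_on {0..} w \<and> (w \<longlongrightarrow> 0) (at_right 0)"

definition outer_exp :: "'a measure \<Rightarrow> ('a \<Rightarrow> real) \<Rightarrow> real" where
  "outer_exp M f = Inf {integral\<^sup>L M U | U. U \<in> borel_measurable M \<and> integrable M U \<and>
      (\<forall>x\<in>space M. f x \<le> U x)}"

definition outer_prob :: "'a measure \<Rightarrow> 'a set \<Rightarrow> real" where
  "outer_prob M A = Inf {measure M B | B. B \<in> sets M \<and> A \<inter> space M \<subseteq> B}"

definition pm_open :: "('d \<Rightarrow> 'd \<Rightarrow> real) \<Rightarrow> 'd set \<Rightarrow> 'd set \<Rightarrow> bool" where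
  "pm_open dD D U \<longleftrightarrow> U \<subseteq> D \<and> (\<forall>x\<in>U. \<exists>e>0. \<forall>y\<in>D. dD x y < e \<longrightarrow> y \<in> U)"

definition pm_compact :: "('d \<Rightarrow> 'd \<Rightarrow> real) \<Rightarrow> 'd set \<Rightarrow> 'd set \<Rightarrow> bool" where
  "pm_compact dD D K \<longleftrightarrow> K \<subseteq> D \<and> (\<forall>s::nat \<Rightarrow> 'd. (\<forall>k. s k \<in> K) \<longrightarrow>
      (\<exists>r l. strict_mono r \<and> l \<in> K \<and> (\<lambda>k. dD (s (r k)) l) \<longlonglongrightarrow> 0))"

definition pm_cont :: "('d \<Rightarrow> 'd \<Rightarrow> real) \<Rightarrow> 'd set \<Rightarrow> ('d \<Rightarrow> real) \<Rightarrow> bool" where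
  "pm_cont dD D h \<longleftrightarrow> (\<forall>x\<in>D. \<forall>e>0. \<exists>d>0. \<forall>y\<in>D. dD x y < d \<longrightarrow> \<bar>h y - h x\<bar> < e)"

definition borel_into :: "'q measure \<Rightarrow> ('d \<Rightarrow> 'd \<Rightarrow> real) \<Rightarrow> 'd set \<Rightarrow> ('q \<Rightarrow> 'd) \<Rightarrow> bool" where
  "borel_into Q dD D L \<longleftrightarrow> (\<forall>q\<in>space Q. L q \<in> D) \<and>
      (\<forall>U. pm_open dD D U \<longrightarrow> {q \<in> space Q. L q \<in> U} \<in> sets Q)"

definition tight_into :: "'q measure \<Rightarrow> ('d \<Rightarrow> 'd \<Rightarrow> real) \<Rightarrow> 'd set \<Rightarrow> ('q \<Rightarrow> 'd) \<Rightarrow> bool" where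
  "tight_into Q dD D L \<longleftrightarrow> (\<forall>\<epsilon>>0. \<exists>K A. pm_compact dD D K \<and> A \<in> sets Q \<and>
      A \<subseteq> {q \<in> space Q. L q \<in> K} \<and> measure Q A \<ge> 1 - \<epsilon>)"

definition HJ_conv :: "'o measure \<Rightarrow> (nat \<Rightarrow> 'o \<Rightarrow> 'd) \<Rightarrow> ('d \<Rightarrow> 'd \<Rightarrow> real) \<Rightarrow> 'd set
    \<Rightarrow> 'q measure \<Rightarrow> ('q \<Rightarrow> 'd) \<Rightarrow> bool" where
  "HJ_conv P Xs dD D Q L \<longleftrightarrow> (\<forall>k. \<forall>\<omega>\<in>space P. Xs k \<omega> \<in> D) \<and> borel_into Q dD D L \<and>
     (\<forall>h. pm_cont dD D h \<and> (\<exists>B. \<forall>x\<in>D. \<bar>h x\<bar> \<le> B) \<longrightarrow>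
        (\<lambda>k. outer_exp P (\<lambda>\<omega>. h (Xs k \<omega>))) \<longlonglongrightarrow> integral\<^sup>L Q (\<lambda>q. h (L q)))"

definition D3 :: "('x \<Rightarrow> real) set \<Rightarrow> ('y \<Rightarrow> real) set \<Rightarrow>
    ((('x \<Rightarrow> real) \<Rightarrow> real) \<times> (('y \<Rightarrow> real) \<Rightarrow> real) \<times> ('x::topological_space \<times> 'y::topological_space \<Rightarrow> real)) set" where
  "D3 G1 G2 = {(a, b, k). bounded (a ` G1) \<and> bounded (b ` G2) \<and> continuous_on UNIV k}"

definition dist3 :: "('x \<Rightarrow> real) set \<Rightarrow> ('y \<Rightarrow> real) set \<Rightarrow>
    ((('x \<Rightarrow> real) \<Rightarrow> real) \<times> (('y \<Rightarrow> real) \<Rightarrow> real) \<times> ('x \<times> 'y \<Rightarrow> real)) \<Rightarrow>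
    ((('x \<Rightarrow> real) \<Rightarrow> real) \<times> (('y \<Rightarrow> real) \<Rightarrow> real) \<times> ('x \<times> 'y \<Rightarrow> real)) \<Rightarrow> real" where
  "dist3 G1 G2 u v = (case u of (a, b, k) \<Rightarrow> case v of (a', b', k') \<Rightarrow>
     max (SUP g\<in>G1. \<bar>a g - a' g\<bar>) (max (SUP g\<in>G2. \<bar>b g - b' g\<bar>) (SUP p. \<bar>k p - k' p\<bar>)))"

definition bb_cov :: "'q measure \<Rightarrow> ('q \<Rightarrow> ('x \<Rightarrow> real) \<Rightarrow> real) \<Rightarrow> 'x measure
    \<Rightarrow> ('x \<Rightarrow> real) set \<Rightarrow> bool" where
  "bb_cov Q G \<mu> C \<longleftrightarrow> (\<forall>g\<in>C. (\<lambda>q. G q g) \<in> borel_measurable Q \<and> integrable Q (\<lambda>q. (G q g)\<^sup>2)) \<and>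
     (\<forall>g1\<in>C. \<forall>g2\<in>C.
        integral\<^sup>L Q (\<lambda>q. (G q g1 - integral\<^sup>L Q (\<lambda>q'. G q' g1)) * (G q g2 - integral\<^sup>L Q (\<lambda>q'. G q' g2)))
        = integral\<^sup>L \<mu> (\<lambda>x. g1 x * g2 x) - integral\<^sup>L \<mu> g1 * integral\<^sup>L \<mu> g2)"

definition admissible :: "(nat \<Rightarrow> nat) \<Rightarrow> (nat \<Rightarrow> nat) \<Rightarrow> real \<Rightarrow> bool" where
  "admissible N M lam \<longleftrightarrow> filterlim N at_top sequentially \<and> filterlim M at_top sequentially \<and>
     (\<lambda>k. real (M k) / (real (N k) + real (M k))) \<longlonglongrightarrow> lam"

definition rate :: "nat \<Rightarrow> nat \<Rightarrow> real" where
  "rate n m = sqrt (real n * real m / (real n + real m))"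

end

theory Submission
  imports Defs "HOL-Complex_Analysis.Great_Picard" "HOL-Combinatorics.Cycles"
begin

text \<open>
  Write \<open>r\<close> for the rate, \<open>z = (a, b, h)\<close> for the scaled errors of the two measures and of the cost,
  and \<open>J f = \<mu>(f^cc) + \<nu>(f^c)\<close>. The scaled error of the optimal value is squeezed between functionals
  of \<open>z\<close> that are Lipschitz uniformly in the sample size, so that weak convergence only has to be
  tested on them.

  Lower bound: an optimal plan of the perturbed problem is nearly optimal for \<open>(\<mu>, \<nu>, c)\<close>, and weak
  duality with a potential in \<open>S_c\<close> gives \<open>sup_(S_c) (a + b)\<close> plus the infimum of \<open>h\<close> over nearly
  optimal plans; by weak compactness the latter tends to the infimum over optimal plans.
  Upper bound under uniqueness: test the perturbed cost with a plan between the perturbed measures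
  that is optimal for \<open>c\<close>; it is nearly optimal for \<open>(\<mu>, \<nu>, c)\<close>, and nearly optimal plans cluster at
  the only optimal one.
  Upper bound under the second condition: after an inf-convolution of the perturbed cost, which
  costs only the oscillation of \<open>h\<close>, its potentials lie in \<open>F\<close>. Replacing \<open>\<mu>_n, \<nu>_m\<close> by \<open>\<mu>, \<nu>\<close> in
  the dual objective leaves the negligible terms of the condition, and the remaining value is at
  most \<open>J f + 3 |h| / r\<close> and at most the optimal value plus \<open>inf_\<pi> \<pi>(h) / r\<close>.

  Both upper bounds contain a supremum over \<open>F\<close> penalised by \<open>r (OT - J f)\<close>. It converges to the
  supremum over \<open>S_c\<close> if the limit is continuous along uniformly convergent potentials. Empirical
  processes are Lipschitz in this sense, and continuity is a closed condition, so the weak limit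
  has it almost surely. Strong duality comes from optimal permutations of finite samples and
  passes to the limit along empirical measures.
\<close>

section \<open>Borel probability measures on compact metric spaces\<close>

lemma bounded_range_continuous:
  fixes h :: "'a::topological_space \<Rightarrow> 'b::metric_space"
  assumes "compact (UNIV :: 'a set)" "continuous_on UNIV h"
  shows "bounded (range h)"
  using assms by (intro compact_imp_bounded compact_continuous_image)

lemma bounded_rangeE:
  fixes f :: "'a \<Rightarrow> real"
  assumes "bounded (range f)"
  obtains K where "\<And>x. \<bar>f x\<bar> \<le> K"
  using assms by (auto simp: bounded_iff)

locale borel_prob_space = prob_space M for M :: "'a::topological_space measure" +
  assumes sets_eq_borel [simp, measurable_cong]: "sets M = sets borel"

lemma borel_prob_space_iff: "borel_prob_space M \<longleftrightarrow> prob_space M \<and> sets M = sets borel"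
  by (simp add: borel_prob_space_def borel_prob_space_axioms_def)

context borel_prob_space
begin

lemma measurable_borel: "h \<in> borel_measurable borel \<Longrightarrow> h \<in> borel_measurable M"
  using measurable_cong_sets[OF sets_eq_borel refl] by blast

lemma measurable_continuous:
  fixes h :: "'a \<Rightarrow> 'b::topological_space"
  assumes "continuous_on UNIV h"
  shows "h \<in> borel_measurable M"
  by (rule measurable_borel[OF borel_measurable_continuous_onI[OF assms]])

lemma borel_prob_space_distr:
  fixes h :: "'a \<Rightarrow> 'b::topological_space"
  assumes "h \<in> borel_measurable M"
  shows "borel_prob_space (distr M borel h)"
  using prob_space_distr[OF assms] by (simp add: borel_prob_space_iff)

lemma integrable_continuous:
  fixes h :: "'a \<Rightarrow> real"
  assumes "compact (UNIV :: 'a set)" "continuous_on UNIV h"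
  shows "integrable M h"
proof -
  obtain K where "norm (h x) \<le> K" for x
    using bounded_range_continuous[OF assms] by (auto simp: bounded_iff)
  then show ?thesis
    using measurable_continuous[OF assms(2)] by (intro integrable_const_bound[of h K]) auto
qed

lemma integral_le_add:
  fixes g h :: "'a \<Rightarrow> real"
  assumes cpt: "compact (UNIV :: 'a set)" and cont: "continuous_on UNIV g" "continuous_on UNIV h"
    and le: "\<And>x. g x \<le> h x + e"
  shows "integral\<^sup>L M g \<le> integral\<^sup>L M h + e"
proof -
  note int = integrable_continuous[OF cpt cont(1)] integrable_continuous[OF cpt cont(2)]
  have "integral\<^sup>L M g \<le> integral\<^sup>L M (\<lambda>x. h x + e)"
    using int le by (intro integral_mono) auto
  also have "\<dots> = integral\<^sup>L M h + e"
    using int by (simp add: prob_space)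
  finally show ?thesis .
qed

lemma abs_integral_diff_le:
  fixes g h :: "'a \<Rightarrow> real"
  assumes cpt: "compact (UNIV :: 'a set)" and cont: "continuous_on UNIV g" "continuous_on UNIV h"
    and le: "\<And>x. \<bar>g x - h x\<bar> \<le> e"
  shows "\<bar>integral\<^sup>L M g - integral\<^sup>L M h\<bar> \<le> e"
proof -
  have "g x \<le> h x + e" "h x \<le> g x + e" for x
    using le[of x] by linarith+
  then have "integral\<^sup>L M g \<le> integral\<^sup>L M h + e" "integral\<^sup>L M h \<le> integral\<^sup>L M g + e"
    using cpt cont by (auto intro!: integral_le_add)
  then show ?thesis
    by linarith
qed

lemma abs_integral_le:
  fixes h :: "'a \<Rightarrow> real"
  assumes "compact (UNIV :: 'a set)" "continuous_on UNIV h" "\<And>x. \<bar>h x\<bar> \<le> e"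
  shows "\<bar>integral\<^sup>L M h\<bar> \<le> e"
  using abs_integral_diff_le[of h "\<lambda>_. 0" e] assms by simp

end

text \<open>\<open>Fclass B w\<close> bounds its members by \<open>2 * B\<close>, whence the \<open>1/2\<close>.\<close>

definition unit_BL :: "('a::metric_space \<Rightarrow> real) set" where
  "unit_BL = Fclass (1/2) (\<lambda>t. t)"

definition BL_close :: "real \<Rightarrow> 'a::metric_space measure \<Rightarrow> 'a measure \<Rightarrow> bool" where
  "BL_close e M N \<longleftrightarrow> (\<forall>g\<in>unit_BL. \<bar>integral\<^sup>L M g - integral\<^sup>L N g\<bar> \<le> e)"

lemma BL_closeD: "BL_close e M N \<Longrightarrow> g \<in> unit_BL \<Longrightarrow> \<bar>integral\<^sup>L M g - integral\<^sup>L N g\<bar> \<le> e"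
  by (simp add: BL_close_def)

lemma BL_close_refl: "0 \<le> e \<Longrightarrow> BL_close e M M"
  by (simp add: BL_close_def)

lemma BL_close_mono: "BL_close e M N \<Longrightarrow> e \<le> e' \<Longrightarrow> BL_close e' M N"
  unfolding BL_close_def by force

definition infdist_cutoff :: "'a::metric_space set \<Rightarrow> nat \<Rightarrow> 'a \<Rightarrow> real" where
  "infdist_cutoff S n x = max 0 (1 - real (Suc n) * infdist x S)"

lemma infdist_cutoff_bounds: "0 \<le> infdist_cutoff S n x" "infdist_cutoff S n x \<le> 1"
  by (auto simp: infdist_cutoff_def infdist_nonneg)

lemma infdist_cutoff_in_unit_BL: "(\<lambda>x. infdist_cutoff S n x / real (Suc n)) \<in> unit_BL"
proof -
  have "\<bar>infdist_cutoff S n x / real (Suc n)\<bar> \<le> 1" for x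
  proof -
    have "\<bar>infdist_cutoff S n x / real (Suc n)\<bar> = infdist_cutoff S n x / real (Suc n)"
      using infdist_cutoff_bounds(1)[of S n x] by simp
    also have "\<dots> \<le> 1"
      using infdist_cutoff_bounds(2)[of S n x] by (simp add: divide_le_eq)
    finally show ?thesis .
  qed
  moreover have "\<bar>infdist_cutoff S n x / real (Suc n) - infdist_cutoff S n y / real (Suc n)\<bar> \<le> dist x y"
    for x y
  proof -
    have "\<bar>real (Suc n) * infdist x S - real (Suc n) * infdist y S\<bar> \<le> real (Suc n) * dist x y"
      using mult_left_mono[OF infdist_triangle_abs[of x S y], of "real (Suc n)"]
      by (simp add: abs_mult flip: right_diff_distrib)
    then have "\<bar>infdist_cutoff S n x - infdist_cutoff S n y\<bar> \<le> real (Suc n) * dist x y"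
      unfolding infdist_cutoff_def by linarith
    then show ?thesis
      by (simp add: divide_le_eq mult.commute flip: diff_divide_distrib)
  qed
  ultimately show ?thesis
    by (simp add: unit_BL_def Fclass_def)
qed

lemma infdist_cutoff_tendsto_indicator:
  assumes S: "closed S" "S \<noteq> {}"
  shows "(\<lambda>n. infdist_cutoff S n x) \<longlonglongrightarrow> indicator S x"
proof (cases "x \<in> S")
  case True
  then show ?thesis
    by (simp add: infdist_cutoff_def)
next
  case False
  then have pos: "0 < infdist x S"
    using in_closed_iff_infdist_zero[OF S] infdist_nonneg[of x S] by (metis less_eq_real_def)
  obtain n0 :: nat where n0: "1 / infdist x S < real n0"
    using reals_Archimedean2 by blast
  have "infdist_cutoff S n x = indicator S x" if "n0 \<le> n" for n
  proof -
    have "1 < real n0 * infdist x S"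
      using n0 pos by (simp add: divide_less_eq)
    also have "\<dots> \<le> real (Suc n) * infdist x S"
      using that pos by (intro mult_right_mono) auto
    finally show ?thesis
      using False by (simp add: infdist_cutoff_def)
  qed
  then show ?thesis
    by (intro tendsto_eventually) (auto simp: eventually_sequentially)
qed

lemma integral_infdist_cutoff_tendsto_measure:
  fixes S :: "'a::metric_space set"
  assumes M: "borel_prob_space M" and S: "closed S" "S \<noteq> {}"
  shows "(\<lambda>n. integral\<^sup>L M (infdist_cutoff S n)) \<longlonglongrightarrow> measure M S"
proof -
  interpret borel_prob_space M by (rule M)
  have "S \<in> sets M"
    using S by auto
  have "(\<lambda>n. integral\<^sup>L M (infdist_cutoff S n)) \<longlonglongrightarrow> integral\<^sup>L M (indicator S)"
  proof (rule integral_dominated_convergence[where w = "\<lambda>_. 1"])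
    show "infdist_cutoff S n \<in> borel_measurable M" for n
      unfolding infdist_cutoff_def[abs_def] by (intro measurable_continuous continuous_intros)
    show "AE x in M. (\<lambda>n. infdist_cutoff S n x) \<longlonglongrightarrow> indicator S x"
      using infdist_cutoff_tendsto_indicator[OF S] by simp
    show "AE x in M. norm (infdist_cutoff S n x) \<le> 1" for n
      using infdist_cutoff_bounds[of S n] by simp
  qed (use \<open>S \<in> sets M\<close> in auto)
  then show ?thesis
    using \<open>S \<in> sets M\<close> by simp
qed

lemma BL_close_0_imp_eq:
  fixes M N :: "'a::metric_space measure"
  assumes M: "borel_prob_space M" and N: "borel_prob_space N" and eq: "BL_close 0 M N"
  shows "M = N"
proof -
  interpret M: borel_prob_space M by (rule M)
  interpret N: borel_prob_space N by (rule N)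
  have "measure M S = measure N S" if S: "closed S" "S \<noteq> {}" for S
  proof -
    have "integral\<^sup>L M (infdist_cutoff S n) = integral\<^sup>L N (infdist_cutoff S n)" for n
      using BL_closeD[OF eq infdist_cutoff_in_unit_BL[of S n]] by simp
    then show ?thesis
      using LIMSEQ_unique[OF integral_infdist_cutoff_tendsto_measure[OF M S]]
        integral_infdist_cutoff_tendsto_measure[OF N S] by simp
  qed
  then have closed_eq: "emeasure M S = emeasure N S" if "closed S" for S
    using that by (cases "S = {}") (auto simp: M.emeasure_eq_measure N.emeasure_eq_measure)
  show ?thesis
    by (rule measure_eqI_generator_eq[where \<Omega> = UNIV and E = "Collect closed" and A = "\<lambda>_. UNIV"])
      (use closed_eq in \<open>auto simp: Int_stable_def borel_eq_closed\<close>)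
qed

section \<open>Weak compactness\<close>

definition weakly_converges :: "(nat \<Rightarrow> 'a::topological_space measure) \<Rightarrow> 'a measure \<Rightarrow> bool" where
  "weakly_converges \<rho> \<pi> \<longleftrightarrow> (\<forall>h::'a \<Rightarrow> real. continuous_on UNIV h \<longrightarrow>
     (\<lambda>n. integral\<^sup>L (\<rho> n) h) \<longlonglongrightarrow> integral\<^sup>L \<pi> h)"

lemma weakly_convergesD:
  fixes h :: "'a::topological_space \<Rightarrow> real"
  shows "weakly_converges \<rho> \<pi> \<Longrightarrow> continuous_on UNIV h \<Longrightarrow> (\<lambda>n. integral\<^sup>L (\<rho> n) h) \<longlonglongrightarrow> integral\<^sup>L \<pi> h"
  by (simp add: weakly_converges_def)

definition ternary_sum :: "(nat \<Rightarrow> bool) \<Rightarrow> real" where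
  "ternary_sum A = (\<Sum>j. of_bool (A j) * (1/3)^j)"

lemma summable_ternary: "summable (\<lambda>j. of_bool (A j) * (1/3::real)^j)"
  by (rule summable_comparison_test'[OF summable_geometric[of "1/3::real"]]) auto

lemma ternary_sum_Suc: "ternary_sum A = of_bool (A 0) + ternary_sum (\<lambda>j. A (Suc j)) / 3"
proof -
  have "(\<Sum>j. of_bool (A (Suc j)) * (1/3::real)^Suc j) = ternary_sum (\<lambda>j. A (Suc j)) / 3"
    using suminf_divide[OF summable_ternary[of "\<lambda>j. A (Suc j)"], of 3] by (simp add: ternary_sum_def)
  then show ?thesis
    using suminf_split_head[OF summable_ternary[of A]] by (simp add: ternary_sum_def)
qed

lemma ternary_sum_bounds: "0 \<le> ternary_sum A" "ternary_sum A \<le> 3/2"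
proof -
  show "0 \<le> ternary_sum A"
    unfolding ternary_sum_def by (rule suminf_nonneg[OF summable_ternary]) simp
  have "ternary_sum A \<le> (\<Sum>j. (1/3::real)^j)"
    unfolding ternary_sum_def by (rule suminf_le[OF _ summable_ternary summable_geometric]) auto
  then show "ternary_sum A \<le> 3/2"
    by (simp add: suminf_geometric)
qed

lemma ternary_sum_head_eq:
  assumes "\<bar>ternary_sum A - ternary_sum B\<bar> < 1/2"
  shows "A 0 = B 0"
  using assms ternary_sum_bounds[of "\<lambda>j. A (Suc j)"] ternary_sum_bounds[of "\<lambda>j. B (Suc j)"]
  unfolding ternary_sum_Suc[of A] ternary_sum_Suc[of B] by (auto simp: of_bool_def split: if_splits)

lemma ternary_sum_digit_eq:
  assumes "\<bar>ternary_sum A - ternary_sum B\<bar> < (1/3)^J / 2" "j \<le> J"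
  shows "A j = B j"
  using assms
proof (induction j arbitrary: A B J)
  case 0
  have "(1/3::real)^J \<le> 1"
    by (rule power_le_one) auto
  then have "\<bar>ternary_sum A - ternary_sum B\<bar> < 1/2"
    using "0.prems"(1) by linarith
  then show ?case
    by (rule ternary_sum_head_eq)
next
  case (Suc j)
  obtain J' where J': "J = Suc J'" "j \<le> J'"
    using Suc.prems(2) by (cases J) auto
  have "(1/3::real)^J \<le> 1"
    by (rule power_le_one) auto
  then have "A 0 = B 0"
    using Suc.prems(1) by (intro ternary_sum_head_eq) linarith
  then have "\<bar>ternary_sum (\<lambda>j. A (Suc j)) - ternary_sum (\<lambda>j. B (Suc j))\<bar> < (1/3)^J' / 2"
    using Suc.prems(1) unfolding ternary_sum_Suc[of A] ternary_sum_Suc[of B] J'(1)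
    by (simp flip: diff_divide_distrib)
  then show ?case
    using Suc.IH J'(2) by blast
qed

lemma compact_imp_finite_nets:
  assumes "compact (UNIV :: 'a::metric_space set)"
  obtains k :: "nat \<Rightarrow> 'a::metric_space set" where
    "\<And>n. finite (k n)" "\<And>n z. \<exists>x\<in>k n. dist x z < 1 / real (Suc n)"
proof -
  have "\<exists>k::'a set. finite k \<and> (\<forall>z. \<exists>x\<in>k. dist x z < 1 / real (Suc n))" for n
  proof -
    obtain k :: "'a set" where "finite k" "UNIV \<subseteq> (\<Union>x\<in>k. ball x (1 / real (Suc n)))"
      using seq_compact_imp_totally_bounded[OF compact_imp_seq_compact[OF assms], rule_format,
        of "1 / real (Suc n)"]
      by auto
    then show ?thesis
      by (intro exI[of _ k]) (auto simp: subset_iff)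
  qed
  then obtain k :: "nat \<Rightarrow> 'a set" where "finite (k n)" "\<forall>z. \<exists>x\<in>k n. dist x z < 1 / real (Suc n)" for n
    by metis
  then show thesis
    using that by blast
qed

lemma agree_on_balls_imp_dist_less:
  assumes k: "finite k" "\<exists>x\<in>k. dist x z < r" and U: "\<And>x. x \<in> k \<Longrightarrow> U (j x) = ball x r"
    and agree: "\<forall>i\<le>Max (j ` k). z \<in> U i \<longleftrightarrow> z' \<in> U i"
  shows "dist z z' < 2 * r"
proof -
  obtain x where x: "x \<in> k" "dist x z < r"
    using k(2) by blast
  then have "z \<in> U (j x)" "j x \<le> Max (j ` k)"
    using U k(1) by auto
  then have "dist x z' < r"
    using agree U[OF x(1)] by auto
  then show ?thesis
    using x(2) dist_triangle3[of z z' x] by linarith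
qed

lemma ex_separating_open_sequence:
  assumes cpt: "compact (UNIV :: 'a::metric_space set)"
  obtains U :: "nat \<Rightarrow> 'a::metric_space set" where "\<And>j. open (U j)"
    "\<And>e. 0 < e \<Longrightarrow> \<exists>J. \<forall>z z'. (\<forall>j\<le>J. z \<in> U j \<longleftrightarrow> z' \<in> U j) \<longrightarrow> dist z z' < e"
proof -
  obtain k :: "nat \<Rightarrow> 'a set" where k: "finite (k n)" "\<exists>x\<in>k n. dist x z < 1 / real (Suc n)" for n z
    using compact_imp_finite_nets[OF cpt] by blast
  define \<B> where "\<B> = (\<Union>n. (\<lambda>x. ball x (1 / real (Suc n))) ` k n)"
  define U where "U = from_nat_into \<B>"
  have "countable \<B>"
    unfolding \<B>_def using k(1) by (intro countable_UN countable_image) (auto intro: countable_finite)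
  moreover have "\<B> \<noteq> {}"
    using k(2)[of 0] unfolding \<B>_def by blast
  ultimately have range_U: "range U = \<B>"
    unfolding U_def by (intro range_from_nat_into)
  have "open (U j)" for j
  proof -
    have "U j \<in> \<B>"
      using range_U by auto
    then show ?thesis
      by (auto simp: \<B>_def)
  qed
  moreover have "\<exists>J. \<forall>z z'. (\<forall>j\<le>J. z \<in> U j \<longleftrightarrow> z' \<in> U j) \<longrightarrow> dist z z' < e" if "0 < e" for e
  proof -
    obtain n where n: "1 / real (Suc n) < e / 2"
      using nat_approx_posE[of "e/2"] \<open>0 < e\<close> half_gt_zero by blast
    have "\<forall>x\<in>k n. \<exists>j. U j = ball x (1 / real (Suc n))"
    proof
      fix x assume "x \<in> k n"
      then have "ball x (1 / real (Suc n)) \<in> range U"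
        unfolding range_U \<B>_def by blast
      then show "\<exists>j. U j = ball x (1 / real (Suc n))"
        by force
    qed
    then obtain j where j: "U (j x) = ball x (1 / real (Suc n))" if "x \<in> k n" for x
      by metis
    have "dist z z' < e" if agree: "\<forall>i\<le>Max (j ` k n). z \<in> U i \<longleftrightarrow> z' \<in> U i" for z z'
      using agree_on_balls_imp_dist_less[where j = j, OF k(1) k(2) j agree] n by simp
    then show ?thesis
      by blast
  qed
  ultimately show thesis
    by (rule that)
qed

lemma uniformly_continuous_on_extension_compact:
  fixes f :: "'a::metric_space \<Rightarrow> 'b::metric_space"
  assumes "uniformly_continuous_on S f" "compact (UNIV :: 'b set)"
  obtains g where "uniformly_continuous_on (closure S) g" "\<And>x. x \<in> S \<Longrightarrow> g x = f x"
proof -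
  have "mcomplete_of (euclidean_metric :: 'b metric)"
    using compact_imp_complete[OF assms(2)] by (simp add: mcomplete_of_def euclidean_metric_def)
  then show thesis
    using uniformly_continuous_map_extends_to_closure_of[of euclidean_metric euclidean_metric S f]
      assms(1) that
    by (auto simp: mtopology_of_def)
qed

lemma ex_code_with_continuous_inverse:
  assumes cpt: "compact (UNIV :: 'a::metric_space set)"
  obtains s :: "'a::metric_space \<Rightarrow> real" and q where "s \<in> borel_measurable borel" "\<And>z. s z \<in> {0..3/2}"
    "continuous_on (closure (range s)) q" "\<And>z. q (s z) = z"
proof -
  obtain U :: "nat \<Rightarrow> 'a set" where U: "\<And>j. open (U j)"
    and sep: "\<And>e. 0 < e \<Longrightarrow> \<exists>J. \<forall>z z'. (\<forall>j\<le>J. z \<in> U j \<longleftrightarrow> z' \<in> U j) \<longrightarrow> dist z z' < e"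
    using ex_separating_open_sequence[OF cpt] by blast
  define s where "s z = ternary_sum (\<lambda>j. z \<in> U j)" for z
  have close: "\<exists>\<delta>>0. \<forall>z z'. \<bar>s z - s z'\<bar> < \<delta> \<longrightarrow> dist z z' < e" if "0 < e" for e
  proof -
    obtain J where J: "\<forall>z z'. (\<forall>j\<le>J. z \<in> U j \<longleftrightarrow> z' \<in> U j) \<longrightarrow> dist z z' < e"
      using sep[OF \<open>0 < e\<close>] by meson
    have "dist z z' < e" if "\<bar>s z - s z'\<bar> < (1/3)^J / 2" for z z'
      using J ternary_sum_digit_eq[OF that[unfolded s_def]] by blast
    then show ?thesis
      by (intro exI[of _ "(1/3)^J / 2"]) simp
  qed
  have inj: "inj s"
  proof (rule injI, rule ccontr)
    fix z z' assume "s z = s z'" "z \<noteq> z'"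
    then show False
      using close[of "dist z z'"] by (metis abs_zero diff_self less_irrefl zero_less_dist_iff)
  qed
  have "uniformly_continuous_on (range s) (inv s)"
    unfolding uniformly_continuous_on_def
  proof (intro allI impI)
    fix e :: real assume "0 < e"
    from close[OF this] show "\<exists>d>0. \<forall>t\<in>range s. \<forall>t'\<in>range s. dist t' t < d \<longrightarrow> dist (inv s t') (inv s t) < e"
      using inj by (auto simp: dist_real_def)
  qed
  then obtain q where q: "uniformly_continuous_on (closure (range s)) q" "\<And>t. t \<in> range s \<Longrightarrow> q t = inv s t"
    using uniformly_continuous_on_extension_compact[OF _ cpt] by blast
  show thesis
  proof (rule that[of s q])
    have "s = (\<lambda>z. \<Sum>j. indicator (U j) z * (1/3)^j)"
      by (simp add: fun_eq_iff s_def ternary_sum_def indicator_def of_bool_def)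
    then show "s \<in> borel_measurable borel"
      using U by simp
    show "s z \<in> {0..3/2}" for z
      using ternary_sum_bounds by (simp add: s_def)
  qed (use q inj in \<open>auto simp: uniformly_continuous_imp_continuous\<close>)
qed

lemma real_distributions_convergent_subseq:
  fixes \<sigma> :: "nat \<Rightarrow> real measure"
  assumes \<sigma>: "\<And>n. borel_prob_space (\<sigma> n)" and ab: "a < b" "\<And>n. measure (\<sigma> n) {a<..b} = 1"
  obtains r M where "strict_mono (r :: nat \<Rightarrow> nat)" "borel_prob_space M"
    "\<And>g :: real \<Rightarrow> real. continuous_on UNIV g \<Longrightarrow> bounded (range g) \<Longrightarrow>
      (\<lambda>n. integral\<^sup>L (\<sigma> (r n)) g) \<longlonglongrightarrow> integral\<^sup>L M g"
proof -
  have real_distribution_iff: "real_distribution M \<longleftrightarrow> borel_prob_space M" for M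
    by (simp add: real_distribution_def real_distribution_axioms_def borel_prob_space_iff)
  have "tight \<sigma>"
    unfolding tight_def real_distribution_iff
  proof (intro conjI allI impI)
    fix e :: real assume "0 < e"
    then show "\<exists>a b. a < b \<and> (\<forall>n. 1 - e < measure (\<sigma> n) {a<..b})"
      using ab by (intro exI[of _ a] exI[of _ b]) simp
  qed (rule \<sigma>)
  then obtain r M where r: "strict_mono (r :: nat \<Rightarrow> nat)" and M: "real_distribution M"
    and conv: "weak_conv_m (\<sigma> \<circ> id \<circ> r) M"
    using tight_imp_convergent_subsubsequence[of \<sigma> id] strict_mono_id by blast
  have lim: "(\<lambda>n. integral\<^sup>L (\<sigma> (r n)) g) \<longlonglongrightarrow> integral\<^sup>L M g"
    if "continuous_on UNIV g" "bounded (range g)" for g :: "real \<Rightarrow> real"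
  proof -
    obtain K where "norm (g x) \<le> K" for x
      using \<open>bounded (range g)\<close> by (auto simp: bounded_iff)
    then have "(\<lambda>n. integral\<^sup>L ((\<sigma> \<circ> id \<circ> r) n) g) \<longlonglongrightarrow> integral\<^sup>L M g"
      using \<sigma> M conv that(1)
      by (intro weak_conv_imp_integral_bdd_continuous_conv[where B = K])
        (auto simp: real_distribution_iff continuous_on_eq_continuous_at o_def)
    then show ?thesis
      by simp
  qed
  show thesis
    by (rule that[OF r M[unfolded real_distribution_iff] lim])
qed

lemma AE_in_closed_limit:
  fixes \<sigma> :: "nat \<Rightarrow> 'a::metric_space measure"
  assumes M: "borel_prob_space M" and \<sigma>: "\<And>n. borel_prob_space (\<sigma> n)"
    and conv: "\<And>g :: 'a \<Rightarrow> real. continuous_on UNIV g \<Longrightarrow> bounded (range g) \<Longrightarrow>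
      (\<lambda>n. integral\<^sup>L (\<sigma> n) g) \<longlonglongrightarrow> integral\<^sup>L M g"
    and S: "closed S" "S \<noteq> {}" "\<And>n. AE x in \<sigma> n. x \<in> S"
  shows "AE x in M. x \<in> S"
proof -
  interpret M: borel_prob_space M by (rule M)
  have cont: "continuous_on UNIV (infdist_cutoff S k)" for k
    unfolding infdist_cutoff_def[abs_def] by (intro continuous_intros)
  have bounded: "bounded (range (infdist_cutoff S k))" for k
    using infdist_cutoff_bounds[of S k] by (auto simp: bounded_iff intro!: exI[of _ 1])
  have "integral\<^sup>L (\<sigma> n) (infdist_cutoff S k) = 1" for n k
  proof -
    interpret borel_prob_space "\<sigma> n" by (rule \<sigma>)
    have "integral\<^sup>L (\<sigma> n) (infdist_cutoff S k) = integral\<^sup>L (\<sigma> n) (\<lambda>_. 1)"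
      using S(3)[of n] measurable_continuous[OF cont]
      by (intro integral_cong_AE) (auto elim!: eventually_mono simp: infdist_cutoff_def)
    then show ?thesis
      by (simp add: prob_space)
  qed
  then have "integral\<^sup>L M (infdist_cutoff S k) = 1" for k
    using conv[OF cont bounded, of k] by (simp add: LIMSEQ_const_iff)
  then have "measure M S = 1"
    using integral_infdist_cutoff_tendsto_measure[OF M S(1,2)] by (simp add: LIMSEQ_const_iff)
  then show ?thesis
    by (rule M.AE_prob_1)
qed

lemma weakly_converges_if_coded:
  fixes \<rho> :: "nat \<Rightarrow> 'a::metric_space measure" and s :: "'a \<Rightarrow> real"
  assumes cpt: "compact (UNIV :: 'a set)" and \<rho>: "\<And>n. borel_prob_space (\<rho> n)"
    and s: "s \<in> borel_measurable borel"
    and q: "continuous_on (closure (range s)) q" "\<And>z. q (s z) = z"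
    and M: "borel_prob_space M"
    and conv: "\<And>g :: real \<Rightarrow> real. continuous_on UNIV g \<Longrightarrow> bounded (range g) \<Longrightarrow>
      (\<lambda>n. integral\<^sup>L (distr (\<rho> n) borel s) g) \<longlonglongrightarrow> integral\<^sup>L M g"
  obtains \<pi> where "borel_prob_space \<pi>" "weakly_converges \<rho> \<pi>"
proof -
  interpret M: borel_prob_space M by (rule M)
  define C where "C = closure (range s)"
  have C: "closed C" "C \<noteq> {}" and sC: "s z \<in> C" for z
    by (auto simp: C_def intro: subsetD[OF closure_subset])
  have s_meas: "s \<in> borel_measurable (\<rho> n)" for n
    by (rule borel_prob_space.measurable_borel[OF \<rho> s])
  have "AE t in distr (\<rho> n) borel s. t \<in> C" for n
    using C(1) sC s_meas by (subst AE_distr_iff) auto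
  then have AE_C: "AE t in M. t \<in> C"
    using AE_in_closed_limit[of M "\<lambda>n. distr (\<rho> n) borel s" C] M C conv
      borel_prob_space.borel_prob_space_distr[OF \<rho> s_meas] by blast
  define q' where "q' t = (if t \<in> C then q t else undefined)" for t
  have "q' \<in> borel_measurable borel"
    unfolding q'_def using C(1) q(1) by (intro borel_measurable_continuous_on_if) (auto simp: C_def)
  then have q'_meas: "q' \<in> borel_measurable M"
    by (rule M.measurable_borel)
  have "(\<lambda>n. integral\<^sup>L (\<rho> n) h) \<longlonglongrightarrow> integral\<^sup>L (distr M borel q') h"
    if h: "continuous_on UNIV h" for h :: "'a \<Rightarrow> real"
  proof -
    obtain K where K: "\<And>x. norm (h x) \<le> K" "0 \<le> K"
      using bounded_range_continuous[OF cpt h] unfolding bounded_pos by (auto dest: less_imp_le)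
    have "continuous_on C (\<lambda>t. h (q t))"
      using q(1) h by (auto simp: C_def intro: continuous_on_compose2)
    then obtain g where g: "continuous_on UNIV g" "\<And>t. t \<in> C \<Longrightarrow> g t = h (q t)" "\<And>t. norm (g t) \<le> K"
      using Tietze[of C "\<lambda>t. h (q t)" UNIV K] C(1) K by auto
    have "integral\<^sup>L (distr (\<rho> n) borel s) g = integral\<^sup>L (\<rho> n) h" for n
      using s_meas borel_measurable_continuous_onI[OF g(1)] g(2) sC q(2) by (simp add: integral_distr)
    moreover have "integral\<^sup>L M g = integral\<^sup>L M (\<lambda>t. h (q' t))"
      using AE_C M.measurable_continuous[OF g(1)] g(2)
        measurable_compose[OF q'_meas borel_measurable_continuous_onI[OF h]]
      by (intro integral_cong_AE) (auto elim!: eventually_mono simp: q'_def)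
    moreover have "bounded (range g)"
      using g(3) by (auto simp: bounded_iff)
    ultimately show ?thesis
      using conv[OF g(1)] q'_meas borel_measurable_continuous_onI[OF h] by (simp add: integral_distr)
  qed
  then show thesis
    using that[OF M.borel_prob_space_distr[OF q'_meas]] by (simp add: weakly_converges_def)
qed

text \<open>A compact metric space is coded into the reals by a measurable injection whose inverse extends
  continuously to the closure of its range; Helly's selection theorem is applied to the coded measures.\<close>

theorem borel_prob_space_weak_compactness:
  fixes \<rho> :: "nat \<Rightarrow> 'a::metric_space measure"
  assumes cpt: "compact (UNIV :: 'a set)" and \<rho>: "\<And>n. borel_prob_space (\<rho> n)"
  obtains r \<pi> where "strict_mono (r :: nat \<Rightarrow> nat)" "borel_prob_space \<pi>" "weakly_converges (\<lambda>n. \<rho> (r n)) \<pi>"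
proof -
  obtain s :: "'a \<Rightarrow> real" and q where s: "s \<in> borel_measurable borel" "\<And>z. s z \<in> {0..3/2}"
    and q: "continuous_on (closure (range s)) q" "\<And>z. q (s z) = z"
    using ex_code_with_continuous_inverse[OF cpt] by blast
  have s_meas: "s \<in> borel_measurable (\<rho> n)" for n
    by (rule borel_prob_space.measurable_borel[OF \<rho> s(1)])
  have mass: "measure (distr (\<rho> n) borel s) {-1<..2} = 1" for n
  proof -
    have "s z \<in> {-1<..2}" for z
      using s(2)[of z] by simp
    then have "s -` {-1<..2} \<inter> space (\<rho> n) = space (\<rho> n)"
      by auto
    then show ?thesis
      using prob_space.prob_space[OF borel_prob_space.axioms(1)[OF \<rho>], of n]
      by (simp add: measure_distr[OF s_meas])
  qed
  obtain r M where r: "strict_mono (r :: nat \<Rightarrow> nat)" and M: "borel_prob_space M"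
    and conv: "\<And>g :: real \<Rightarrow> real. continuous_on UNIV g \<Longrightarrow> bounded (range g) \<Longrightarrow>
      (\<lambda>n. integral\<^sup>L (distr (\<rho> (r n)) borel s) g) \<longlonglongrightarrow> integral\<^sup>L M g"
    by (rule real_distributions_convergent_subseq[of "\<lambda>n. distr (\<rho> n) borel s" "-1" 2])
      (use borel_prob_space.borel_prob_space_distr[OF \<rho> s_meas] mass in auto)
  obtain \<pi> where "borel_prob_space \<pi>" "weakly_converges (\<lambda>n. \<rho> (r n)) \<pi>"
    using weakly_converges_if_coded[OF cpt \<rho> s(1) q M conv] by blast
  then show thesis
    using that r by blast
qed

section \<open>Uniformly equicontinuous classes\<close>

lemma Fclass_abs_le: "f \<in> Fclass B w \<Longrightarrow> \<bar>f x\<bar> \<le> 2 * B"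
  by (simp add: Fclass_def)

lemma Fclass_bounded: "f \<in> Fclass B w \<Longrightarrow> bounded (range f)"
  using Fclass_abs_le by (force simp: bounded_iff)

lemma Fclass_mono:
  assumes "B \<le> B'" "\<And>t. 0 \<le> t \<Longrightarrow> w t \<le> w' t"
  shows "Fclass B w \<subseteq> (Fclass B' w' :: ('a::metric_space \<Rightarrow> real) set)"
proof
  fix f :: "'a \<Rightarrow> real" assume f: "f \<in> Fclass B w"
  have "\<bar>f x\<bar> \<le> 2 * B'" for x
    using Fclass_abs_le[OF f, of x] assms(1) by linarith
  moreover have "\<bar>f x - f x'\<bar> \<le> w' (dist x x')" for x x'
    using f assms(2)[OF zero_le_dist, of x x'] order_trans unfolding Fclass_def by blast
  ultimately show "f \<in> Fclass B' w'"
    by (simp add: Fclass_def)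
qed

lemma Fclass_equicontinuous:
  assumes "(w \<longlongrightarrow> 0) (at_right 0)" "0 < e"
  obtains d where "0 < d"
    "\<And>(f :: 'a::metric_space \<Rightarrow> real) x x' B. f \<in> Fclass B w \<Longrightarrow> dist x x' < d \<Longrightarrow> \<bar>f x - f x'\<bar> < e"
proof -
  obtain d where d: "0 < d" "\<And>t. 0 < t \<Longrightarrow> t < d \<Longrightarrow> dist (w t) 0 < e"
    using tendstoD[OF assms] unfolding eventually_at_right_field by auto
  have "\<bar>f x - f x'\<bar> < e" if "f \<in> Fclass B w" "dist x x' < d" for f :: "'a \<Rightarrow> real" and x x' B
  proof (cases "x = x'")
    case False
    then have "dist (w (dist x x')) 0 < e"
      using that(2) by (intro d(2)) auto
    moreover have "\<bar>f x - f x'\<bar> \<le> w (dist x x')"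
      using that(1) by (simp add: Fclass_def)
    ultimately show ?thesis
      by simp
  qed (use assms(2) in simp)
  then show thesis
    using that d(1) by blast
qed

lemma Fclass_continuous:
  assumes "(w \<longlongrightarrow> 0) (at_right 0)" "f \<in> Fclass B w"
  shows "continuous_on UNIV f"
  unfolding continuous_on_iff
proof (intro ballI allI impI)
  fix x :: 'a and e :: real assume "0 < e"
  obtain d where "0 < d" "\<And>x x'. dist x x' < d \<Longrightarrow> \<bar>f x - f x'\<bar> < e"
    by (rule Fclass_equicontinuous[OF assms(1) \<open>0 < e\<close>]) (use assms(2) in blast)
  then show "\<exists>d>0. \<forall>x'\<in>UNIV. dist x' x < d \<longrightarrow> dist (f x') (f x) < e"
    by (auto simp: dist_real_def)
qed

lemma unit_BL_continuous: "g \<in> unit_BL \<Longrightarrow> continuous_on UNIV g"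
  unfolding unit_BL_def by (rule Fclass_continuous[OF tendsto_ident_at])

lemma Fclass_pointwise_limit:
  assumes f: "\<And>n. f n \<in> Fclass B w" and lim: "\<And>x. (\<lambda>n. f n x) \<longlonglongrightarrow> g x"
  shows "g \<in> Fclass B w"
  unfolding Fclass_def
proof (intro CollectI conjI allI)
  fix x x'
  show "\<bar>g x\<bar> \<le> 2 * B"
    using Fclass_abs_le[OF f] by (intro LIMSEQ_le_const2[OF tendsto_rabs[OF lim]]) auto
  have "\<bar>f n x - f n x'\<bar> \<le> w (dist x x')" for n
    using f[of n] by (simp add: Fclass_def)
  then show "\<bar>g x - g x'\<bar> \<le> w (dist x x')"
    by (intro LIMSEQ_le_const2[OF tendsto_rabs[OF tendsto_diff[OF lim lim]]]) auto
qed

lemma equicontinuous_imp_uniformly_Cauchy: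
  fixes f :: "nat \<Rightarrow> 'a::metric_space \<Rightarrow> real"
  assumes equi: "\<And>e. 0 < e \<Longrightarrow> \<exists>d>0. \<forall>n x x'. dist x x' < d \<longrightarrow> \<bar>f n x - f n x'\<bar> < e"
    and net: "\<And>d. 0 < d \<Longrightarrow> \<exists>k\<subseteq>S. finite k \<and> (\<forall>x. \<exists>y\<in>k. dist y x < d)"
    and Cauchy: "\<And>y. y \<in> S \<Longrightarrow> Cauchy (\<lambda>n. f n y)"
  shows "uniformly_Cauchy_on UNIV f"
  unfolding uniformly_Cauchy_on_def
proof (intro allI impI)
  fix e :: real assume "0 < e"
  then obtain d where d: "0 < d" "\<And>n x x'. dist x x' < d \<Longrightarrow> \<bar>f n x - f n x'\<bar> < e / 3"
    using equi[of "e / 3"] by auto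
  obtain k where k: "k \<subseteq> S" "finite k" "\<And>x. \<exists>y\<in>k. dist y x < d"
    using net[OF d(1)] by blast
  have "\<exists>N. \<forall>p\<ge>N. \<forall>q\<ge>N. dist (f p y) (f q y) < e / 3" if "y \<in> k" for y
    using metric_CauchyD[OF Cauchy, of y "e / 3"] that k(1) \<open>0 < e\<close> by auto
  then obtain N where N: "\<And>y p q. y \<in> k \<Longrightarrow> N y \<le> p \<Longrightarrow> N y \<le> q \<Longrightarrow> dist (f p y) (f q y) < e / 3"
    by metis
  have "dist (f p x) (f q x) < e" if "Max (N ` k) \<le> p" "Max (N ` k) \<le> q" for p q x
  proof -
    obtain y where y: "y \<in> k" "dist y x < d"
      using k(3) by blast
    then have "N y \<le> Max (N ` k)"
      using k(2) by auto
    then have "dist (f p y) (f q y) < e / 3"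
      using N[OF y(1)] that by auto
    moreover have "\<bar>f p y - f p x\<bar> < e / 3" "\<bar>f q y - f q x\<bar> < e / 3"
      using d(2) y(2) by auto
    ultimately show ?thesis
      unfolding dist_real_def by linarith
  qed
  then show "\<exists>M. \<forall>x\<in>UNIV. \<forall>p\<ge>M. \<forall>q\<ge>M. dist (f p x) (f q x) < e"
    by blast
qed

theorem Fclass_convergent_subseq:
  fixes f :: "nat \<Rightarrow> 'a::metric_space \<Rightarrow> real"
  assumes cpt: "compact (UNIV :: 'a set)" and w: "(w \<longlongrightarrow> 0) (at_right 0)"
    and f: "\<And>n. f n \<in> Fclass B w"
  obtains r g where "strict_mono (r :: nat \<Rightarrow> nat)" "g \<in> Fclass B w"
    "uniform_limit UNIV (\<lambda>n. f (r n)) g sequentially"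
proof -
  obtain k :: "nat \<Rightarrow> 'a set" where k: "finite (k m)" "\<exists>x\<in>k m. dist x z < 1 / real (Suc m)" for m z
    using compact_imp_finite_nets[OF cpt] by blast
  define S where "S = (\<Union>m. k m)"
  have "countable S"
    unfolding S_def using k(1) by (intro countable_UN) (auto intro: countable_finite)
  then obtain r where r: "strict_mono (r :: nat \<Rightarrow> nat)"
    and conv: "\<And>y. y \<in> S \<Longrightarrow> \<exists>l. (\<lambda>n. f (r n) y) \<longlonglongrightarrow> l"
    using function_convergent_subsequence[of S f "2 * B"] Fclass_abs_le[OF f] by auto
  have "uniformly_Cauchy_on UNIV (\<lambda>n. f (r n))"
  proof (rule equicontinuous_imp_uniformly_Cauchy[of _ S])
    show "\<exists>d>0. \<forall>n x x'. dist x x' < d \<longrightarrow> \<bar>f (r n) x - f (r n) x'\<bar> < e" if "0 < e" for e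
    proof -
      obtain d where "0 < d" "\<And>(g :: 'a \<Rightarrow> real) x x'. g \<in> Fclass B w \<Longrightarrow> dist x x' < d \<Longrightarrow> \<bar>g x - g x'\<bar> < e"
        by (rule Fclass_equicontinuous[OF w \<open>0 < e\<close>]) blast
      then show ?thesis
        using f by blast
    qed
    show "\<exists>k\<subseteq>S. finite k \<and> (\<forall>x. \<exists>y\<in>k. dist y x < d)" if d: "0 < d" for d
    proof -
      obtain m where m: "1 / real (Suc m) < d"
        using nat_approx_posE[OF d] by blast
      have "\<exists>y\<in>k m. dist y x < d" for x
        using k(2)[of m x] m by force
      then show ?thesis
        using k(1) by (intro exI[of _ "k m"]) (auto simp: S_def)
    qed
    show "Cauchy (\<lambda>n. f (r n) y)" if "y \<in> S" for y
      using conv[OF that] by (auto intro: LIMSEQ_imp_Cauchy)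
  qed
  then obtain g where g: "uniform_limit UNIV (\<lambda>n. f (r n)) g sequentially"
    using Cauchy_uniformly_convergent unfolding uniformly_convergent_on_def by blast
  have "g \<in> Fclass B w"
    by (rule Fclass_pointwise_limit[OF f tendsto_uniform_limitI[OF g UNIV_I]])
  then show thesis
    using that r g by blast
qed

lemma Fclass_finite_net:
  assumes cpt: "compact (UNIV :: 'a::metric_space set)" and w: "(w \<longlongrightarrow> 0) (at_right 0)" and e: "0 < e"
  obtains T where "T \<subseteq> (Fclass B w :: ('a \<Rightarrow> real) set)" "finite T"
    "\<And>f. f \<in> Fclass B w \<Longrightarrow> \<exists>g\<in>T. \<forall>x. \<bar>f x - g x\<bar> < e"
proof -
  define \<F> :: "('a \<Rightarrow>\<^sub>C real) set" where "\<F> = {\<phi>. apply_bcontfun \<phi> \<in> Fclass B w}"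
  have "seq_compact \<F>"
    unfolding seq_compact_def
  proof (intro allI impI)
    fix \<phi> :: "nat \<Rightarrow> 'a \<Rightarrow>\<^sub>C real" assume "\<forall>n. \<phi> n \<in> \<F>"
    then obtain r g where r: "strict_mono (r :: nat \<Rightarrow> nat)" and g: "g \<in> Fclass B w"
      and lim: "uniform_limit UNIV (\<lambda>n. apply_bcontfun (\<phi> (r n))) g sequentially"
      using Fclass_convergent_subseq[OF cpt w, of "\<lambda>n. apply_bcontfun (\<phi> n)" B] by (auto simp: \<F>_def)
    obtain \<psi> where "g = apply_bcontfun \<psi>" "(\<lambda>n. \<phi> (r n)) \<longlonglongrightarrow> \<psi>"
      using uniform_limit_bcontfunE[OF lim] by auto
    then show "\<exists>\<psi>\<in>\<F>. \<exists>r. strict_mono r \<and> (\<phi> \<circ> r) \<longlonglongrightarrow> \<psi>"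
      using r g by (auto simp: \<F>_def o_def)
  qed
  then obtain T where T: "finite T" "T \<subseteq> \<F>" "\<F> \<subseteq> (\<Union>\<psi>\<in>T. ball \<psi> e)"
    using seq_compact_imp_totally_bounded[of \<F>] e by blast
  show thesis
  proof (rule that[of "apply_bcontfun ` T"])
    fix f :: "'a \<Rightarrow> real" assume f: "f \<in> Fclass B w"
    then have "f \<in> bcontfun"
      using Fclass_continuous[OF w f] Fclass_bounded[OF f] by (simp add: bcontfun_def)
    then obtain \<phi> where \<phi>: "f = apply_bcontfun \<phi>"
      by (metis apply_bcontfun_cases)
    then obtain \<psi> where "\<psi> \<in> T" "dist \<psi> \<phi> < e"
      using T(3) f by (auto simp: \<F>_def)
    then have "\<bar>f x - \<psi> x\<bar> < e" for x
      using dist_fun_lt_imp_dist_val_lt[of \<psi> \<phi> e x] \<phi>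
      by (simp add: dist_commute dist_real_def abs_minus_commute)
    then show "\<exists>g\<in>apply_bcontfun ` T. \<forall>x. \<bar>f x - g x\<bar> < e"
      using \<open>\<psi> \<in> T\<close> by blast
  qed (use T in \<open>auto simp: \<F>_def\<close>)
qed

section \<open>Cost transforms\<close>

lemma cSUP_le_cSUP_add:
  fixes u v :: "'i \<Rightarrow> real"
  assumes "A \<noteq> {}" "bdd_above (v ` A)" "\<And>i. i \<in> A \<Longrightarrow> u i \<le> v i + e"
  shows "(SUP i\<in>A. u i) \<le> (SUP i\<in>A. v i) + e"
proof (rule cSUP_least[OF assms(1)])
  fix i assume "i \<in> A"
  with assms(3)[OF this] cSUP_upper[OF this assms(2)] show "u i \<le> (SUP i\<in>A. v i) + e"
    by linarith
qed

lemma abs_cSUP_diff_le: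
  fixes u v :: "'i \<Rightarrow> real"
  assumes A: "A \<noteq> {}" and bdd: "bdd_above (u ` A)" "bdd_above (v ` A)" and le: "\<And>i. i \<in> A \<Longrightarrow> \<bar>u i - v i\<bar> \<le> e"
  shows "\<bar>(SUP i\<in>A. u i) - (SUP i\<in>A. v i)\<bar> \<le> e"
proof -
  have "u i \<le> v i + e" "v i \<le> u i + e" if "i \<in> A" for i
    using le[OF that] by linarith+
  then have "(SUP i\<in>A. u i) \<le> (SUP i\<in>A. v i) + e" "(SUP i\<in>A. v i) \<le> (SUP i\<in>A. u i) + e"
    using A bdd by (auto intro!: cSUP_le_cSUP_add)
  then show ?thesis
    by linarith
qed

lemma bdd_above_mult_left:
  fixes e :: "'i \<Rightarrow> real"
  assumes "bdd_above (e ` A)" "0 \<le> b"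
  shows "bdd_above ((\<lambda>i. b * e i) ` A)"
  using bdd_above_image_mono[OF _ assms(1), of "(*) b"] assms(2)
  by (simp add: image_image mono_def mult_left_mono)

lemma abs_cINF_diff_le:
  fixes u v :: "'i \<Rightarrow> real"
  assumes A: "A \<noteq> {}" and bdd: "bdd_below (u ` A)" "bdd_below (v ` A)" and le: "\<And>i. i \<in> A \<Longrightarrow> \<bar>u i - v i\<bar> \<le> e"
  shows "\<bar>(INF i\<in>A. u i) - (INF i\<in>A. v i)\<bar> \<le> e"
proof -
  have "\<bar>(SUP i\<in>A. - u i) - (SUP i\<in>A. - v i)\<bar> \<le> e"
  proof (rule abs_cSUP_diff_le[OF A])
    show "bdd_above ((\<lambda>i. - u i) ` A)" "bdd_above ((\<lambda>i. - v i) ` A)"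
      using bdd by (auto simp: bdd_above_uminus_image)
    show "\<bar>- u i - - v i\<bar> \<le> e" if "i \<in> A" for i
      using le[OF that] by linarith
  qed
  then show ?thesis
    using uminus_cSUP[of "\<lambda>i. - u i" A] uminus_cSUP[of "\<lambda>i. - v i" A] A bdd
    by (simp add: bdd_above_uminus_image abs_minus_commute)
qed

lemma bdd_below_ctrans:
  fixes c :: "'x \<times> 'y \<Rightarrow> real" and f :: "'x \<Rightarrow> real"
  assumes "bounded (range c)" "bounded (range f)"
  shows "bdd_below (range (\<lambda>x. c (x, y) - f x))"
proof -
  obtain C D where C: "\<And>p. \<bar>c p\<bar> \<le> C" and D: "\<And>x. \<bar>f x\<bar> \<le> D"
    using assms by (metis bounded_rangeE)
  have "- C - D \<le> c (x, y) - f x" for x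
    using C[of "(x, y)"] D[of x] by linarith
  then show ?thesis
    by (intro bdd_belowI2)
qed

lemma ctrans_le:
  assumes "bounded (range c)" "bounded (range f)"
  shows "ctrans c f y \<le> c (x, y) - f x"
  unfolding ctrans_def by (rule cINF_lower[OF bdd_below_ctrans[OF assms]]) simp

lemma ctrans_ge: "(\<And>x. k \<le> c (x, y) - f x) \<Longrightarrow> k \<le> ctrans c f y"
  unfolding ctrans_def by (rule cINF_greatest) auto

lemma bounded_ctrans:
  assumes "bounded (range c)" "bounded (range f)"
  shows "bounded (range (ctrans c f))"
proof -
  obtain C D where C: "\<And>p. \<bar>c p\<bar> \<le> C" and D: "\<And>x. \<bar>f x\<bar> \<le> D"
    using assms by (metis bounded_rangeE)
  have "\<bar>ctrans c f y\<bar> \<le> C + D" for y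
  proof -
    have "- C - D \<le> c (x, y) - f x" for x
      using C[of "(x, y)"] D[of x] by linarith
    then have "- C - D \<le> ctrans c f y"
      by (rule ctrans_ge)
    moreover have "ctrans c f y \<le> C + D"
      using ctrans_le[OF assms, of y undefined] C[of "(undefined, y)"] D[of undefined] by linarith
    ultimately show ?thesis
      by linarith
  qed
  then show ?thesis
    by (auto simp: bounded_iff)
qed

lemma ctrans_diff_le:
  assumes "bounded (range c)" "bounded (range f)" "bounded (range c')" "bounded (range f')"
    and c: "\<And>x. \<bar>c (x, y) - c' (x, y')\<bar> \<le> e" and f: "\<And>x. \<bar>f x - f' x\<bar> \<le> d"
  shows "\<bar>ctrans c f y - ctrans c' f' y'\<bar> \<le> e + d"
  unfolding ctrans_def
proof (rule abs_cINF_diff_le)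
  show "\<bar>c (x, y) - f x - (c' (x, y') - f' x)\<bar> \<le> e + d" for x
    using c[of x] f[of x] by linarith
qed (use assms bdd_below_ctrans in auto)

lemma cctrans_eq_ctrans: "cctrans c f = ctrans (c \<circ> prod.swap) (ctrans c f)"
  by (simp add: fun_eq_iff cctrans_def ctrans_def)

lemma bounded_range_swap: "bounded (range c) \<Longrightarrow> bounded (range (c \<circ> prod.swap))"
  by (rule bounded_subset) auto

lemma cctrans_le:
  assumes "bounded (range c)" "bounded (range f)"
  shows "cctrans c f x \<le> c (x, y) - ctrans c f y"
  using ctrans_le[OF bounded_range_swap[OF assms(1)] bounded_ctrans[OF assms], of x y]
  by (simp add: cctrans_eq_ctrans)

lemma le_cctrans:
  assumes "bounded (range c)" "bounded (range f)"
  shows "f x \<le> cctrans c f x"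
  unfolding cctrans_eq_ctrans
proof (rule ctrans_ge)
  show "f x \<le> (c \<circ> prod.swap) (y, x) - ctrans c f y" for y
    using ctrans_le[OF assms, of y x] by simp
qed

lemma bounded_cctrans:
  assumes "bounded (range c)" "bounded (range f)"
  shows "bounded (range (cctrans c f))"
  unfolding cctrans_eq_ctrans
  by (rule bounded_ctrans[OF bounded_range_swap[OF assms(1)] bounded_ctrans[OF assms]])

lemma cctrans_diff_le:
  assumes bdd: "bounded (range c)" "bounded (range f)" "bounded (range c')" "bounded (range f')"
    and c: "\<And>p. \<bar>c p - c' p\<bar> \<le> e" and f: "\<And>x. \<bar>f x - f' x\<bar> \<le> d"
  shows "\<bar>cctrans c f x - cctrans c' f' x\<bar> \<le> 2 * e + d"
proof -
  have "\<bar>cctrans c f x - cctrans c' f' x\<bar> \<le> e + (e + d)"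
    unfolding cctrans_eq_ctrans
  proof (rule ctrans_diff_le)
    show "\<bar>ctrans c f y - ctrans c' f' y\<bar> \<le> e + d" for y
      by (rule ctrans_diff_le[OF bdd c f])
    show "\<bar>(c \<circ> prod.swap) (y, x) - (c' \<circ> prod.swap) (y, x)\<bar> \<le> e" for y
      using c by simp
  qed (intro bounded_range_swap bounded_ctrans bdd)+
  then show ?thesis
    by simp
qed

definition dual_sum :: "('x \<times> 'y \<Rightarrow> real) \<Rightarrow> ('x \<Rightarrow> real) \<Rightarrow> 'x \<times> 'y \<Rightarrow> real" where
  "dual_sum c f p = cctrans c f (fst p) + ctrans c f (snd p)"

definition dual_value :: "'x measure \<Rightarrow> 'y measure \<Rightarrow> ('x \<times> 'y \<Rightarrow> real) \<Rightarrow> ('x \<Rightarrow> real) \<Rightarrow> real" where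
  "dual_value \<mu> \<nu> c f = integral\<^sup>L \<mu> (cctrans c f) + integral\<^sup>L \<nu> (ctrans c f)"

lemma dual_sum_le:
  assumes "bounded (range c)" "bounded (range f)"
  shows "dual_sum c f p \<le> c p"
  using cctrans_le[OF assms, of "fst p" "snd p"] by (simp add: dual_sum_def)

definition osc :: "real \<Rightarrow> ('x::metric_space \<times> 'y \<Rightarrow> real) \<Rightarrow> real" where
  "osc \<delta> h = (SUP (x, x', y)\<in>{(x, x', y). dist x x' \<le> \<delta>}. \<bar>h (x, y) - h (x', y)\<bar>)"

lemma bdd_above_osc:
  fixes h :: "'x \<times> 'y \<Rightarrow> real"
  assumes "bounded (range h)"
  shows "bdd_above ((\<lambda>(x, x', y). \<bar>h (x, y) - h (x', y)\<bar>) ` S)"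
proof -
  obtain K where K: "\<And>p. \<bar>h p\<bar> \<le> K"
    using bounded_rangeE[OF assms] by blast
  have "\<bar>h (x, y) - h (x', y)\<bar> \<le> 2 * K" for x x' y
    using K[of "(x, y)"] K[of "(x', y)"] by linarith
  then show ?thesis
    by (intro bdd_aboveI2[where M = "2 * K"]) auto
qed

lemma osc_index_nonempty:
  assumes "0 \<le> \<delta>"
  shows "{(x::'a::metric_space, x', y::'b). dist x x' \<le> \<delta>} \<noteq> {}"
proof -
  have "(undefined, undefined, undefined) \<in> {(x::'a, x', y::'b). dist x x' \<le> \<delta>}"
    using assms by simp
  then show ?thesis
    by (rule ex_in_conv[THEN iffD1, OF exI])
qed

lemma abs_diff_le_osc:
  assumes "bounded (range h)" "dist x x' \<le> \<delta>"
  shows "\<bar>h (x, y) - h (x', y)\<bar> \<le> osc \<delta> h"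
  using cSUP_upper[OF _ bdd_above_osc[OF assms(1)], of "(x, x', y)" "{(x, x', y). dist x x' \<le> \<delta>}"] assms(2)
  by (simp add: osc_def)

lemma osc_le:
  assumes "0 \<le> \<delta>" "\<And>x x' y. dist x x' \<le> \<delta> \<Longrightarrow> \<bar>h (x, y) - h (x', y)\<bar> \<le> e"
  shows "osc \<delta> h \<le> e"
  unfolding osc_def using assms(2) by (intro cSUP_least[OF osc_index_nonempty[OF assms(1)]]) auto

lemma osc_nonneg:
  assumes "bounded (range h)" "0 \<le> \<delta>"
  shows "0 \<le> osc \<delta> h"
  using abs_diff_le_osc[OF assms(1), of undefined undefined \<delta> undefined] assms(2) by simp

lemma abs_osc_diff_le:
  assumes "bounded (range g)" "bounded (range h)" "0 \<le> \<delta>" and le: "\<And>p. \<bar>g p - h p\<bar> \<le> e"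
  shows "\<bar>osc \<delta> g - osc \<delta> h\<bar> \<le> 2 * e"
  unfolding osc_def
proof (rule abs_cSUP_diff_le[OF osc_index_nonempty[OF assms(3)] bdd_above_osc[OF assms(1)]
    bdd_above_osc[OF assms(2)]],
    clarsimp)
  show "\<bar>\<bar>g (x, y) - g (x', y)\<bar> - \<bar>h (x, y) - h (x', y)\<bar>\<bar> \<le> 2 * e" for x x' y
    using le[of "(x, y)"] le[of "(x', y)"] by linarith
qed

locale compact_cost =
  fixes c :: "'x::metric_space \<times> 'y::metric_space \<Rightarrow> real"
  assumes X_compact: "compact (UNIV :: 'x set)" and Y_compact: "compact (UNIV :: 'y set)"
    and cost_continuous: "continuous_on UNIV c"
begin

lemma XY_compact: "compact (UNIV :: ('x \<times> 'y) set)"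
  using compact_Times[OF X_compact Y_compact] by simp

lemma bounded_cost: "bounded (range c)"
  by (rule bounded_range_continuous[OF XY_compact cost_continuous])

lemma cost_uniformly_continuousE:
  assumes "0 < e"
  obtains d where "0 < d" "\<And>x y x' y'. dist x x' < d \<Longrightarrow> dist y y' < d \<Longrightarrow> \<bar>c (x, y) - c (x', y')\<bar> < e"
proof -
  obtain d where d: "0 < d" "\<And>p p'. dist p p' < d \<Longrightarrow> dist (c p) (c p') < e"
    using compact_uniformly_continuous[OF cost_continuous XY_compact] assms
    by (rule uniformly_continuous_onE) auto
  have "\<bar>c (x, y) - c (x', y')\<bar> < e" if "dist x x' < d / 2" "dist y y' < d / 2" for x y x' y'
  proof -
    have "dist (x, y) (x', y') \<le> dist x x' + dist y y'"
      unfolding dist_Pair_Pair by (rule sqrt_sum_squares_le_sum) auto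
    then show ?thesis
      using d(2)[of "(x, y)" "(x', y')"] that by (simp add: dist_real_def)
  qed
  then show thesis
    using d(1) by (intro that[of "d / 2"]) auto
qed

lemma compact_cost_swap: "compact_cost (c \<circ> prod.swap)"
proof
  have "continuous_on UNIV (prod.swap :: 'y \<times> 'x \<Rightarrow> 'x \<times> 'y)"
    unfolding prod.swap_def by (intro continuous_intros)
  then show "continuous_on UNIV (c \<circ> prod.swap)"
    by (intro continuous_on_compose continuous_on_subset[OF cost_continuous]) auto
qed (rule X_compact Y_compact)+

lemma continuous_ctrans:
  assumes f: "bounded (range f)"
  shows "continuous_on UNIV (ctrans c f)"
  unfolding continuous_on_iff
proof (intro ballI allI impI)
  fix y :: 'y and e :: real assume "0 < e"
  then obtain d where d: "0 < d" "\<And>x y x' y'. dist x x' < d \<Longrightarrow> dist y y' < d \<Longrightarrow> \<bar>c (x, y) - c (x', y')\<bar> < e / 2"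
    using cost_uniformly_continuousE[of "e / 2"] by auto
  have "dist (ctrans c f y') (ctrans c f y) < e" if "dist y' y < d" for y'
  proof -
    have "\<bar>ctrans c f y' - ctrans c f y\<bar> \<le> e / 2 + 0"
      using d that by (intro ctrans_diff_le[OF bounded_cost f bounded_cost f]) (auto intro: less_imp_le)
    then show ?thesis
      using \<open>0 < e\<close> by (simp add: dist_real_def)
  qed
  then show "\<exists>d>0. \<forall>y'\<in>UNIV. dist y' y < d \<longrightarrow> dist (ctrans c f y') (ctrans c f y) < e"
    using d(1) by blast
qed

lemma continuous_cctrans: "bounded (range f) \<Longrightarrow> continuous_on UNIV (cctrans c f)"
  unfolding cctrans_eq_ctrans
  by (intro compact_cost.continuous_ctrans[OF compact_cost_swap] bounded_ctrans bounded_cost)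

lemma continuous_dual_sum: "bounded (range f) \<Longrightarrow> continuous_on UNIV (dual_sum c f)"
  unfolding dual_sum_def[abs_def]
  by (intro continuous_on_add continuous_on_compose2[OF continuous_cctrans]
      continuous_on_compose2[OF continuous_ctrans] continuous_intros) auto

lemma osc_tendsto_0: "((\<lambda>\<delta>. osc \<delta> c) \<longlongrightarrow> 0) (at_right 0)"
proof (rule tendstoI)
  fix e :: real assume "0 < e"
  then obtain d where d: "0 < d" "\<And>x y x' y'. dist x x' < d \<Longrightarrow> dist y y' < d \<Longrightarrow> \<bar>c (x, y) - c (x', y')\<bar> < e / 2"
    using cost_uniformly_continuousE[of "e / 2"] by auto
  have "\<forall>\<^sub>F \<delta> in at_right 0. 0 < \<delta> \<and> \<delta> < d"
    using d(1) by (auto simp: eventually_at_right_field)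
  then show "\<forall>\<^sub>F \<delta> in at_right 0. dist (osc \<delta> c) 0 < e"
  proof eventually_elim
    case (elim \<delta>)
    have "osc \<delta> c \<le> e / 2"
      using d elim by (intro osc_le) (auto intro!: less_imp_le)
    then show ?case
      using osc_nonneg[OF bounded_cost, of \<delta>] elim \<open>0 < e\<close> by simp
  qed
qed

end

lemma dual_value_diff_le:
  assumes "compact_cost c" "compact_cost c'" "borel_prob_space \<mu>" "borel_prob_space \<nu>"
    and f: "bounded (range f)" "bounded (range f')"
    and le: "\<And>p. \<bar>c p - c' p\<bar> \<le> e" "\<And>x. \<bar>f x - f' x\<bar> \<le> d"
  shows "\<bar>dual_value \<mu> \<nu> c f - dual_value \<mu> \<nu> c' f'\<bar> \<le> 3 * e + 2 * d"
proof -
  interpret c: compact_cost c by fact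
  interpret c': compact_cost c' by fact
  interpret \<mu>: borel_prob_space \<mu> by fact
  interpret \<nu>: borel_prob_space \<nu> by fact
  note bdd = c.bounded_cost f(1) c'.bounded_cost f(2)
  have "\<bar>integral\<^sup>L \<mu> (cctrans c f) - integral\<^sup>L \<mu> (cctrans c' f')\<bar> \<le> 2 * e + d"
    by (intro \<mu>.abs_integral_diff_le c.X_compact c.continuous_cctrans c'.continuous_cctrans
        cctrans_diff_le[OF bdd] f le)
  moreover have "\<bar>integral\<^sup>L \<nu> (ctrans c f) - integral\<^sup>L \<nu> (ctrans c' f')\<bar> \<le> e + d"
    by (intro \<nu>.abs_integral_diff_le c.Y_compact c.continuous_ctrans c'.continuous_ctrans
        ctrans_diff_le[OF bdd] f le)
  ultimately show ?thesis
    unfolding dual_value_def by linarith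
qed

lemma (in compact_cost) dual_value_diff_tendsto_0:
  assumes prob: "\<And>j. borel_prob_space (\<mu> j)" "\<And>j. borel_prob_space (\<nu> j)"
    and bdd: "\<And>j. bounded (range (f j))" "bounded (range g)" and unif: "uniform_limit UNIV f g F"
  shows "((\<lambda>j. dual_value (\<mu> j) (\<nu> j) c (f j) - dual_value (\<mu> j) (\<nu> j) c g) \<longlongrightarrow> 0) F"
proof (rule tendstoI)
  fix e :: real assume "0 < e"
  then have "\<forall>\<^sub>F j in F. \<forall>x\<in>UNIV. dist (f j x) (g x) < e / 3"
    using uniform_limitD[OF unif, of "e / 3"] by simp
  then show "\<forall>\<^sub>F j in F. dist (dual_value (\<mu> j) (\<nu> j) c (f j) - dual_value (\<mu> j) (\<nu> j) c g) 0 < e"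
  proof eventually_elim
    case (elim j)
    then have "\<bar>f j x - g x\<bar> \<le> e / 3" for x
      by (simp add: dist_real_def less_imp_le)
    then have "\<bar>dual_value (\<mu> j) (\<nu> j) c (f j) - dual_value (\<mu> j) (\<nu> j) c g\<bar> \<le> 3 * 0 + 2 * (e / 3)"
      by (intro dual_value_diff_le compact_cost_axioms prob bdd) auto
    then show ?case
      using \<open>0 < e\<close> by simp
  qed
qed

section \<open>Couplings and weak duality\<close>

lemma couplings_iff:
  "\<pi> \<in> couplings \<mu> \<nu> \<longleftrightarrow> borel_prob_space \<pi> \<and> distr \<pi> borel fst = \<mu> \<and> distr \<pi> borel snd = \<nu>"
  by (auto simp: couplings_def borel_prob_space_iff)

lemma (in borel_prob_space) integral_distr_continuous:
  fixes g :: "'b::topological_space \<Rightarrow> real"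
  assumes "continuous_on UNIV \<phi>" "continuous_on UNIV g"
  shows "integral\<^sup>L (distr M borel \<phi>) g = integral\<^sup>L M (\<lambda>p. g (\<phi> p))"
  using measurable_continuous[OF assms(1)] borel_measurable_continuous_onI[OF assms(2)]
  by (rule integral_distr)

lemma couplings_borel_prob_space:
  fixes \<pi> :: "('x::topological_space \<times> 'y::topological_space) measure"
  assumes "\<pi> \<in> couplings \<mu> \<nu>"
  shows "borel_prob_space \<pi>" "borel_prob_space \<mu>" "borel_prob_space \<nu>"
proof -
  interpret borel_prob_space \<pi>
    using assms by (simp add: couplings_iff)
  have "fst \<in> borel_measurable \<pi>" "snd \<in> borel_measurable \<pi>"
    by (intro measurable_continuous continuous_intros)+
  from borel_prob_space_distr[OF this(1)] borel_prob_space_distr[OF this(2)]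
  show "borel_prob_space \<mu>" "borel_prob_space \<nu>"
    using assms by (simp_all add: couplings_iff)
qed (use assms in \<open>simp add: couplings_iff\<close>)

lemma integral_coupling:
  fixes \<mu> :: "'x::topological_space measure" and \<nu> :: "'y::topological_space measure"
    and g :: "'x \<Rightarrow> real" and h :: "'y \<Rightarrow> real"
  assumes "\<pi> \<in> couplings \<mu> \<nu>"
  shows "continuous_on UNIV g \<Longrightarrow> integral\<^sup>L \<pi> (\<lambda>p. g (fst p)) = integral\<^sup>L \<mu> g"
    and "continuous_on UNIV h \<Longrightarrow> integral\<^sup>L \<pi> (\<lambda>p. h (snd p)) = integral\<^sup>L \<nu> h"
  using assms borel_prob_space.integral_distr_continuous[of \<pi> fst g]
    borel_prob_space.integral_distr_continuous[of \<pi> snd h]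
  by (auto simp: couplings_iff continuous_on_fst continuous_on_snd)

lemma OT_ge:
  assumes "couplings \<mu> \<nu> \<noteq> {}" "\<And>\<pi>. \<pi> \<in> couplings \<mu> \<nu> \<Longrightarrow> k \<le> integral\<^sup>L \<pi> c"
  shows "k \<le> OT \<mu> \<nu> c"
  unfolding OT_def using assms by (rule cINF_greatest)

context compact_cost
begin

lemma integral_dual_sum_coupling:
  assumes \<pi>: "\<pi> \<in> couplings \<mu> \<nu>" and f: "bounded (range f)"
  shows "integral\<^sup>L \<pi> (dual_sum c f) = dual_value \<mu> \<nu> c f"
proof -
  interpret \<pi>: borel_prob_space \<pi>
    by (rule couplings_borel_prob_space(1)[OF \<pi>])
  note cont = continuous_cctrans[OF f] continuous_ctrans[OF f]
  have "integrable \<pi> (\<lambda>p. cctrans c f (fst p))" "integrable \<pi> (\<lambda>p. ctrans c f (snd p))"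
    by (intro \<pi>.integrable_continuous[OF XY_compact] continuous_on_compose2[OF cont(1)]
        continuous_on_compose2[OF cont(2)] continuous_intros; simp)+
  then show ?thesis
    using integral_coupling(1)[OF \<pi> cont(1)] integral_coupling(2)[OF \<pi> cont(2)]
    by (simp add: dual_sum_def[abs_def] dual_value_def)
qed

lemma weak_duality:
  assumes \<pi>: "\<pi> \<in> couplings \<mu> \<nu>" and f: "bounded (range f)"
  shows "dual_value \<mu> \<nu> c f \<le> integral\<^sup>L \<pi> c"
proof -
  interpret \<pi>: borel_prob_space \<pi>
    by (rule couplings_borel_prob_space(1)[OF \<pi>])
  have "integral\<^sup>L \<pi> (dual_sum c f) \<le> integral\<^sup>L \<pi> c + 0"
    using dual_sum_le[OF bounded_cost f]
    by (intro \<pi>.integral_le_add XY_compact continuous_dual_sum f cost_continuous) simp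
  then show ?thesis
    by (simp add: integral_dual_sum_coupling[OF \<pi> f])
qed

lemma bdd_below_integrals:
  assumes h: "continuous_on UNIV h" and S: "\<And>\<pi>. \<pi> \<in> S \<Longrightarrow> borel_prob_space \<pi>"
  shows "bdd_below ((\<lambda>\<pi>. integral\<^sup>L \<pi> (h :: 'x \<times> 'y \<Rightarrow> real)) ` S)"
proof -
  obtain K where K: "\<And>p. \<bar>h p\<bar> \<le> K"
    using bounded_rangeE[OF bounded_range_continuous[OF XY_compact h]] by blast
  show ?thesis
  proof (rule bdd_belowI2[where m = "- K"])
    fix \<pi> assume "\<pi> \<in> S"
    from borel_prob_space.abs_integral_le[OF S[OF this] XY_compact h K] show "- K \<le> integral\<^sup>L \<pi> h"
      by linarith
  qed
qed

lemma OT_le: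
  assumes "\<pi> \<in> couplings \<mu> \<nu>"
  shows "OT \<mu> \<nu> c \<le> integral\<^sup>L \<pi> c"
  unfolding OT_def
  using bdd_below_integrals[OF cost_continuous couplings_borel_prob_space(1)] assms by (intro cINF_lower) auto

lemma dual_value_eq_imp_opt:
  assumes \<pi>: "\<pi> \<in> couplings \<mu> \<nu>" and f: "bounded (range f)" and eq: "integral\<^sup>L \<pi> c = dual_value \<mu> \<nu> c f"
  shows "\<pi> \<in> opt_plans \<mu> \<nu> c" "OT \<mu> \<nu> c = dual_value \<mu> \<nu> c f"
proof -
  have "dual_value \<mu> \<nu> c f \<le> OT \<mu> \<nu> c"
    using \<pi> weak_duality[OF _ f] by (intro OT_ge) auto
  then show "OT \<mu> \<nu> c = dual_value \<mu> \<nu> c f"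
    using OT_le[OF \<pi>] eq by linarith
  then show "\<pi> \<in> opt_plans \<mu> \<nu> c"
    using \<pi> eq by (simp add: opt_plans_def)
qed

end

section \<open>Discrete optimal transport\<close>

lemma emp_meas_eq_distr:
  fixes x :: "nat \<Rightarrow> 'a::topological_space"
  assumes "0 < n"
  shows "emp_meas n x = distr (measure_pmf (pmf_of_set {..<n})) borel x" (is "_ = ?N")
proof -
  have "emp_meas n x = measure_of (space ?N) (sets ?N) (emeasure ?N)"
    unfolding emp_meas_def space_distr sets_distr space_borel
  proof (rule measure_of_eq)
    fix A :: "'a set" assume "A \<in> sigma_sets UNIV (sets borel)"
    then have "A \<in> sets borel"
      using sets.sigma_sets_eq[of "borel :: 'a measure"] by simp
    then have "emeasure ?N A = emeasure (measure_pmf (pmf_of_set {..<n})) (x -` A)"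
      by (subst emeasure_distr) auto
    also have "\<dots> = ennreal (real (card ({..<n} \<inter> x -` A)) / real n)"
      using assms by (subst emeasure_pmf_of_set) (auto simp: lessThan_empty_iff)
    also have "{..<n} \<inter> x -` A = {i. i < n \<and> x i \<in> A}"
      by auto
    finally show "ennreal (real (card {i. i < n \<and> x i \<in> A}) / real n) = emeasure ?N A"
      by simp
  qed simp
  then show ?thesis
    by (simp only: measure_of_of_measure)
qed

lemma borel_prob_space_emp_meas: "0 < n \<Longrightarrow> borel_prob_space (emp_meas n x)"
  by (simp add: emp_meas_eq_distr borel_prob_space_iff
      prob_space.prob_space_distr prob_space_measure_pmf)

lemma integral_emp_meas:
  fixes g :: "'a::topological_space \<Rightarrow> real"
  assumes "0 < n" "g \<in> borel_measurable borel"
  shows "integral\<^sup>L (emp_meas n x) g = (\<Sum>i<n. g (x i)) / real n"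
  unfolding emp_meas_eq_distr[OF assms(1)] using assms
  by (subst integral_distr) (auto simp: integral_pmf_of_set lessThan_empty_iff)

lemma distr_emp_meas:
  assumes "0 < n" "h \<in> measurable borel borel"
  shows "distr (emp_meas n x) borel h = emp_meas n (\<lambda>i. h (x i))"
  unfolding emp_meas_eq_distr[OF assms(1)] using assms by (subst distr_distr) (auto simp: o_def)

lemma emp_meas_cong_card:
  assumes "\<And>A. real (card {i. i < n \<and> x i \<in> A}) / real n = real (card {i. i < m \<and> y i \<in> A}) / real m"
  shows "emp_meas n x = emp_meas m y"
  unfolding emp_meas_def using assms by simp

lemma emp_meas_mod:
  assumes "0 < n" "0 < m"
  shows "emp_meas (n * m) (\<lambda>i. x (i mod n)) = emp_meas n x"
proof (rule emp_meas_cong_card)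
  fix A
  have lt: "b * n + a < n * m" if "a < n" "b < m" for a b
  proof -
    have "b * n + a < Suc b * n"
      using that(1) by simp
    also have "\<dots> \<le> m * n"
      using that(2) by (intro mult_le_mono1) simp
    finally show ?thesis
      by (simp add: mult.commute)
  qed
  have "bij_betw (\<lambda>i. (i mod n, i div n)) {i. i < n * m \<and> x (i mod n) \<in> A} ({i. i < n \<and> x i \<in> A} \<times> {..<m})"
    using assms lt
    by (intro bij_betw_byWitness[where f' = "\<lambda>(a, b). b * n + a"])
      (auto simp: less_mult_imp_div_less mult.commute)
  then have "card {i. i < n * m \<and> x (i mod n) \<in> A} = card {i. i < n \<and> x i \<in> A} * m"
    by (simp add: bij_betw_same_card card_cartesian_product)
  then show "real (card {i. i < n * m \<and> x (i mod n) \<in> A}) / real (n * m)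
      = real (card {i. i < n \<and> x i \<in> A}) / real n"
    using assms by simp
qed

lemma emp_meas_permute:
  assumes "p permutes {..<n}"
  shows "emp_meas n (\<lambda>i. x (p i)) = emp_meas n x"
proof (rule emp_meas_cong_card)
  fix A
  have less_iff: "p i < n \<longleftrightarrow> i < n" for i
    using permutes_in_image[OF assms, of i] by simp
  have "p ` {i. i < n \<and> x (p i) \<in> A} = {i. i < n \<and> x i \<in> A}"
  proof (intro equalityI subsetI)
    fix i assume i: "i \<in> {i. i < n \<and> x i \<in> A}"
    obtain j where "i = p j"
      using permutes_surj[OF assms] by (metis surjD)
    with i less_iff show "i \<in> p ` {i. i < n \<and> x (p i) \<in> A}"
      by auto
  qed (use less_iff in auto)
  then have "bij_betw p {i. i < n \<and> x (p i) \<in> A} {i. i < n \<and> x i \<in> A}"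
    using permutes_inj_on[OF assms] by (auto simp: bij_betw_def)
  then show "real (card {i. i < n \<and> x (p i) \<in> A}) / real n = real (card {i. i < n \<and> x i \<in> A}) / real n"
    by (simp add: bij_betw_same_card)
qed

lemma emp_meas_coupling:
  fixes x :: "nat \<Rightarrow> 'x::topological_space" and y :: "nat \<Rightarrow> 'y::topological_space"
  assumes "0 < n"
  shows "emp_meas n (\<lambda>i. (x i, y i)) \<in> couplings (emp_meas n x) (emp_meas n y)"
proof -
  have "fst \<in> measurable (borel :: ('x \<times> 'y) measure) borel"
    "snd \<in> measurable (borel :: ('x \<times> 'y) measure) borel"
    by (auto intro!: borel_measurable_continuous_onI continuous_intros)
  then show ?thesis
    using distr_emp_meas[OF assms, of fst "\<lambda>i. (x i, y i)"] distr_emp_meas[OF assms, of snd "\<lambda>i. (x i, y i)"]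
      borel_prob_space_emp_meas[OF assms] by (simp add: couplings_iff)
qed

definition path_weight :: "('a \<Rightarrow> 'a \<Rightarrow> real) \<Rightarrow> 'a list \<Rightarrow> real" where
  "path_weight A l = sum_list (map2 A l (tl l))"

lemma path_weight_singleton: "path_weight A [i] = 0"
  by (simp add: path_weight_def)

lemma path_weight_Cons: "l \<noteq> [] \<Longrightarrow> path_weight A (i # l) = A i (hd l) + path_weight A l"
  by (cases l) (auto simp: path_weight_def)

lemma path_weight_append: "path_weight A (xs @ a # ys) = path_weight A (xs @ [a]) + path_weight A (a # ys)"
proof (induction xs)
  case (Cons b xs)
  have "hd (xs @ a # ys) = hd (xs @ [a])"
    by (cases xs) auto
  then show ?case
    using Cons path_weight_Cons[of "xs @ a # ys" A b] path_weight_Cons[of "xs @ [a]" A b] by simp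
qed (simp add: path_weight_singleton)

lemma path_weight_cycle:
  assumes "distinct (i # l)"
  shows "path_weight A (i # l @ [i]) = (\<Sum>j\<in>set (i # l). A j (cycle_of_list (i # l) j))"
proof -
  let ?p = "cycle_of_list (i # l)"
  have "(\<Sum>j\<in>set (i # l). A j (?p j)) = sum_list (map (\<lambda>j. A j (?p j)) (i # l))"
    by (rule sum_list_distinct_conv_sum_set[OF assms, symmetric])
  also have "map (\<lambda>j. A j (?p j)) (i # l) = map2 A (i # l) (map ?p (i # l))"
    by (simp add: map2_map_map[of A "\<lambda>j. j" "i # l" ?p, simplified])
  also have "map ?p (i # l) = l @ [i]"
    using cyclic_rotation[of "i # l" 1] assms by simp
  also have "map2 A (i # l) (l @ [i]) = map2 A ((i # l) @ [i]) (l @ [i])"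
    by (subst zip_append1) simp
  finally show ?thesis
    by (simp add: path_weight_def)
qed

lemma optimal_assignment_cycle_nonneg:
  fixes C :: "nat \<Rightarrow> nat \<Rightarrow> real"
  assumes opt: "\<And>p. p permutes {..<n} \<Longrightarrow> (\<Sum>i<n. C i i) \<le> (\<Sum>i<n. C i (p i))"
    and cycle: "distinct (i # l)" "set (i # l) \<subseteq> {..<n}"
  shows "0 \<le> path_weight (\<lambda>j k. C j k - C k k) (i # l @ [i])"
proof -
  define p where "p = cycle_of_list (i # l)"
  have p: "p permutes set (i # l)"
    unfolding p_def by (rule cycle_permutes)
  then have pn: "p permutes {..<n}"
    using cycle(2) by (rule permutes_subset)
  have "0 \<le> (\<Sum>j<n. C j (p j)) - (\<Sum>j<n. C j j)"
    using opt[OF pn] by simp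
  also have "\<dots> = (\<Sum>j<n. C j (p j) - C (p j) (p j))"
    using sum.permute[OF pn, of "\<lambda>j. C j j"] by (simp add: o_def sum_subtractf)
  also have "\<dots> = (\<Sum>j\<in>set (i # l). C j (p j) - C (p j) (p j))"
    using cycle(2) permutes_not_in[OF p] by (intro sum.mono_neutral_right) auto
  also have "\<dots> = path_weight (\<lambda>j k. C j k - C k k) (i # l @ [i])"
    unfolding p_def by (rule path_weight_cycle[OF cycle(1), symmetric])
  finally show ?thesis .
qed

text \<open>If \<open>l\<close> already visits \<open>i\<close>, then \<open>i # l\<close> starts with a simple cycle, which can be dropped.\<close>

lemma simple_path_prepend:
  assumes cycles: "\<And>i l. distinct (i # l) \<Longrightarrow> set (i # l) \<subseteq> V \<Longrightarrow> 0 \<le> path_weight A (i # l @ [i])"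
    and l: "distinct l" "set l \<subseteq> V" and i: "i \<in> V"
  obtains l' where "distinct (i # l')" "set l' \<subseteq> V" "path_weight A (i # l') \<le> path_weight A (i # l)"
proof (cases "i \<in> set l")
  case False
  then show thesis
    using that[of l] l by simp
next
  case True
  then obtain q r where qr: "l = q @ i # r"
    by (meson split_list)
  have "0 \<le> path_weight A (i # q @ [i])"
    using l qr i by (intro cycles) auto
  moreover have "path_weight A (i # l) = path_weight A (i # q @ [i]) + path_weight A (i # r)"
    using path_weight_append[of A "i # q" i r] qr by simp
  ultimately show thesis
    using that[of r] l qr by simp
qed

lemma ex_potential_if_cycles_nonneg:
  assumes V: "finite V"
    and cycles: "\<And>i l. distinct (i # l) \<Longrightarrow> set (i # l) \<subseteq> V \<Longrightarrow> 0 \<le> path_weight A (i # l @ [i])"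
  shows "\<exists>u. \<forall>i\<in>V. \<forall>j\<in>V. u i \<le> u j + A i j"
proof -
  define paths where "paths i = {l. set l \<subseteq> V \<and> distinct l \<and> l \<noteq> [] \<and> hd l = i}" for i
  define u where "u i = Min (path_weight A ` paths i)" for i
  have fin: "finite (paths i)" for i
    by (rule finite_subset[OF _ finite_subset_distinct[OF V]]) (auto simp: paths_def)
  have "u i \<le> u j + A i j" if ij: "i \<in> V" "j \<in> V" for i j
  proof -
    have "[j] \<in> paths j"
      using ij by (simp add: paths_def)
    then have "u j \<in> path_weight A ` paths j"
      unfolding u_def using fin by (intro Min_in) auto
    then obtain l where l: "l \<in> paths j" "u j = path_weight A l"
      by blast
    obtain l' where l': "distinct (i # l')" "set l' \<subseteq> V" "path_weight A (i # l') \<le> path_weight A (i # l)"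
      by (rule simple_path_prepend[OF cycles, where l = l and i = i]) (use l(1) ij in \<open>auto simp: paths_def\<close>)
    have "u i \<le> path_weight A (i # l')"
      unfolding u_def using l' ij fin by (intro Min_le) (auto simp: paths_def)
    also have "\<dots> \<le> u j + A i j"
      using l' l path_weight_Cons[of l A i] by (simp add: paths_def)
    finally show ?thesis .
  qed
  then show ?thesis
    by blast
qed

lemma ex_optimal_permutation:
  fixes cost :: "(nat \<Rightarrow> nat) \<Rightarrow> real"
  obtains p where "p permutes {..<n::nat}" "\<And>q. q permutes {..<n} \<Longrightarrow> cost p \<le> cost q"
proof -
  have "finite {p. p permutes {..<n}}" "id \<in> {p. p permutes {..<n}}"
    by (auto simp: finite_permutations permutes_id)
  then show thesis
    using that arg_min_if_finite[of "{p. p permutes {..<n}}" cost]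
    by (metis empty_iff mem_Collect_eq not_less)
qed

lemma ex_dual_potential_on_pairs:
  fixes c :: "'x::metric_space \<times> 'y \<Rightarrow> real" and x :: "nat \<Rightarrow> 'x" and y :: "nat \<Rightarrow> 'y"
  assumes n: "0 < n" and C: "\<And>p. \<bar>c p\<bar> \<le> C"
    and W: "\<And>x x' y. \<bar>c (x, y) - c (x', y)\<bar> \<le> W (dist x x')"
    and u: "\<And>i j. i < n \<Longrightarrow> j < n \<Longrightarrow> u i \<le> u j + (c (x i, y j) - c (x j, y j))"
  obtains f where "f \<in> Fclass C W" "\<And>i. i < n \<Longrightarrow> dual_sum c f (x i, y i) = c (x i, y i)"
proof -
  define g where "g z j = c (z, y j) - c (x j, y j) + u j" for z j
  define f0 where "f0 z = (INF j\<in>{..<n}. g z j)" for z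
  define f where "f z = f0 z - f0 (x 0)" for z
  have ne: "{..<n} \<noteq> {}"
    using n by auto
  have f0_le: "f0 z \<le> g z j" if "j < n" for z j
    unfolding f0_def using that by (intro cINF_lower) auto
  have f0_diff: "\<bar>f0 z - f0 z'\<bar> \<le> e" if "\<And>y. \<bar>c (z, y) - c (z', y)\<bar> \<le> e" for z z' e
    unfolding f0_def using that by (intro abs_cINF_diff_le[OF ne]) (auto simp: g_def)
  have f0_x: "f0 (x i) = u i" if "i < n" for i
  proof (rule antisym)
    show "f0 (x i) \<le> u i"
      using f0_le[OF that, of "x i"] by (simp add: g_def)
    show "u i \<le> f0 (x i)"
      unfolding f0_def g_def using u[OF that] by (intro cINF_greatest[OF ne]) (auto simp: algebra_simps)
  qed
  have "\<bar>c (z, y) - c (x 0, y)\<bar> \<le> 2 * C" for z y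
    using C[of "(z, y)"] C[of "(x 0, y)"] by linarith
  then have f: "f \<in> Fclass C W"
    using f0_diff W by (simp add: Fclass_def f_def)
  have bdd: "bounded (range c)" "bounded (range f)"
    using C Fclass_bounded[OF f] by (auto simp: bounded_iff)
  have "dual_sum c f (x i, y i) = c (x i, y i)" if i: "i < n" for i
  proof (rule antisym[OF dual_sum_le[OF bdd]])
    have "c (x i, y i) - f (x i) \<le> c (z, y i) - f z" for z
      using f0_le[OF i, of z] f0_x[OF i] by (simp add: f_def g_def)
    then have "c (x i, y i) - f (x i) \<le> ctrans c f (y i)"
      by (rule ctrans_ge)
    then show "c (x i, y i) \<le> dual_sum c f (x i, y i)"
      using le_cctrans[OF bdd, of "x i"] by (simp add: dual_sum_def)
  qed
  with f show thesis
    using that by blast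
qed

lemma discrete_duality:
  fixes c :: "'x::metric_space \<times> 'y \<Rightarrow> real" and x :: "nat \<Rightarrow> 'x" and y :: "nat \<Rightarrow> 'y"
  assumes n: "0 < n" and C: "\<And>p. \<bar>c p\<bar> \<le> C"
    and W: "\<And>x x' y. \<bar>c (x, y) - c (x', y)\<bar> \<le> W (dist x x')"
  obtains p f where "p permutes {..<n}" "f \<in> Fclass C W"
    "\<And>i. i < n \<Longrightarrow> dual_sum c f (x i, y (p i)) = c (x i, y (p i))"
proof -
  obtain p where p: "p permutes {..<n}"
    and p_opt: "\<And>q. q permutes {..<n} \<Longrightarrow> (\<Sum>i<n. c (x i, y (p i))) \<le> (\<Sum>i<n. c (x i, y (q i)))"
    using ex_optimal_permutation[of n "\<lambda>p. \<Sum>i<n. c (x i, y (p i))"] by blast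
  have opt: "(\<Sum>i<n. c (x i, y (p i))) \<le> (\<Sum>i<n. c (x i, y (p (q i))))" if "q permutes {..<n}" for q
    using p_opt[OF permutes_compose[OF that p]] by simp
  obtain u where "\<forall>i\<in>{..<n}. \<forall>j\<in>{..<n}. u i \<le> u j + (c (x i, y (p j)) - c (x j, y (p j)))"
    using ex_potential_if_cycles_nonneg[OF finite_lessThan
        optimal_assignment_cycle_nonneg[of n "\<lambda>i j. c (x i, y (p j))", OF opt]] by blast
  then obtain f where "f \<in> Fclass C W" "\<And>i. i < n \<Longrightarrow> dual_sum c f (x i, y (p i)) = c (x i, y (p i))"
    using ex_dual_potential_on_pairs[of n c C W u x "\<lambda>i. y (p i)", OF n C W] by blast
  then show thesis
    using that p by blast
qed

lemma (in compact_cost) emp_meas_duality: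
  assumes N: "0 < N" and M: "0 < M" and C: "\<And>p. \<bar>c p\<bar> \<le> C"
    and W: "\<And>x x' y. \<bar>c (x, y) - c (x', y)\<bar> \<le> W (dist x x')"
  obtains \<pi> f where "\<pi> \<in> couplings (emp_meas N x) (emp_meas M y)" "f \<in> Fclass C W"
    "integral\<^sup>L \<pi> c = dual_value (emp_meas N x) (emp_meas M y) c f"
proof -
  define n where "n = N * M"
  define x' where "x' i = x (i mod N)" for i
  define y' where "y' i = y (i mod M)" for i
  have n: "0 < n"
    using N M by (simp add: n_def)
  obtain p f where p: "p permutes {..<n}" and f: "f \<in> Fclass C W"
    and eq: "\<And>i. i < n \<Longrightarrow> dual_sum c f (x' i, y' (p i)) = c (x' i, y' (p i))"
    using discrete_duality[of n c C W x' y', OF n C W] by blast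
  define \<pi> where "\<pi> = emp_meas n (\<lambda>i. (x' i, y' (p i)))"
  have "emp_meas n x' = emp_meas N x"
    unfolding n_def x'_def by (rule emp_meas_mod[OF N M])
  moreover have "emp_meas n (\<lambda>i. y' (p i)) = emp_meas M y"
    using emp_meas_mod[OF M N, of y] emp_meas_permute[OF p, of y']
    by (simp add: n_def mult.commute flip: y'_def)
  ultimately have \<pi>: "\<pi> \<in> couplings (emp_meas N x) (emp_meas M y)"
    using emp_meas_coupling[OF n, of x' "\<lambda>i. y' (p i)"] by (simp add: \<pi>_def)
  have "integral\<^sup>L \<pi> c = integral\<^sup>L \<pi> (dual_sum c f)"
    using eq n borel_measurable_continuous_onI[OF cost_continuous]
      borel_measurable_continuous_onI[OF continuous_dual_sum[OF Fclass_bounded[OF f]]]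
    by (simp add: \<pi>_def integral_emp_meas)
  then show thesis
    using that[OF \<pi> f] integral_dual_sum_coupling[OF \<pi> Fclass_bounded[OF f]] by simp
qed

section \<open>Outer expectation and outer probability\<close>

context prob_space
begin

lemma outer_exp_le:
  assumes U: "integrable M U" "\<And>x. x \<in> space M \<Longrightarrow> f x \<le> U x" and f: "\<And>x. x \<in> space M \<Longrightarrow> \<bar>f x\<bar> \<le> K"
  shows "outer_exp M f \<le> integral\<^sup>L M U"
  unfolding outer_exp_def
proof (rule cInf_lower)
  show "integral\<^sup>L M U \<in> {integral\<^sup>L M U |U. U \<in> borel_measurable M \<and> integrable M U
      \<and> (\<forall>x\<in>space M. f x \<le> U x)}"
    using U by blast
  show "bdd_below {integral\<^sup>L M U |U. U \<in> borel_measurable M \<and> integrable M U \<and> (\<forall>x\<in>space M. f x \<le> U x)}"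
  proof (rule bdd_belowI[where m = "- K"])
    fix v assume "v \<in> {integral\<^sup>L M U |U. U \<in> borel_measurable M \<and> integrable M U \<and> (\<forall>x\<in>space M. f x \<le> U x)}"
    then obtain V where V: "v = integral\<^sup>L M V" "integrable M V" "\<And>x. x \<in> space M \<Longrightarrow> f x \<le> V x"
      by blast
    have "- K \<le> V x" if "x \<in> space M" for x
      using f[OF that] V(3)[OF that] by linarith
    then have "integral\<^sup>L M (\<lambda>x. - K) \<le> integral\<^sup>L M V"
      using V by (intro integral_mono) auto
    then show "- K \<le> v"
      using V by (simp add: prob_space)
  qed
qed

lemma outer_exp_ge:
  assumes f: "\<And>x. x \<in> space M \<Longrightarrow> \<bar>f x\<bar> \<le> K"
    and ge: "\<And>U. integrable M U \<Longrightarrow> (\<And>x. x \<in> space M \<Longrightarrow> f x \<le> U x) \<Longrightarrow> k \<le> integral\<^sup>L M U"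
  shows "k \<le> outer_exp M f"
  unfolding outer_exp_def
proof (rule cInf_greatest)
  have "integral\<^sup>L M (\<lambda>_. K) \<in> {integral\<^sup>L M U |U. U \<in> borel_measurable M \<and> integrable M U
      \<and> (\<forall>x\<in>space M. f x \<le> U x)}"
    using f by (intro CollectI exI[of _ "\<lambda>_. K"]) (auto simp: abs_le_iff)
  then show "{integral\<^sup>L M U |U. U \<in> borel_measurable M \<and> integrable M U \<and> (\<forall>x\<in>space M. f x \<le> U x)} \<noteq> {}"
    by blast
qed (use ge in blast)

lemma outer_exp_le_off_set:
  assumes f: "\<And>x. x \<in> space M \<Longrightarrow> \<bar>f x\<bar> \<le> K" and g: "\<And>x. x \<in> space M \<Longrightarrow> \<bar>g x\<bar> \<le> K"
    and B: "B \<in> sets M" and le: "\<And>x. x \<in> space M - B \<Longrightarrow> f x \<le> g x + e" and e: "0 \<le> e"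
  shows "outer_exp M f \<le> outer_exp M g + e + 2 * K * measure M B"
proof -
  have "outer_exp M f - e - 2 * K * measure M B \<le> outer_exp M g"
  proof (rule outer_exp_ge[OF g])
    fix U assume U: "integrable M U" "\<And>x. x \<in> space M \<Longrightarrow> g x \<le> U x"
    have B_int: "integrable M (\<lambda>x. 2 * K * indicator B x)"
      using B by (intro integrable_mult_right) (simp add: emeasure_eq_measure)
    have "f x \<le> U x + e + 2 * K * indicator B x" if x: "x \<in> space M" for x
      using f[OF x] g[OF x] U(2)[OF x] le[of x] x e by (cases "x \<in> B") auto
    then have "outer_exp M f \<le> integral\<^sup>L M (\<lambda>x. U x + e + 2 * K * indicator B x)"
      using U B_int by (intro outer_exp_le[OF _ _ f]) auto
    also have "\<dots> = integral\<^sup>L M U + e + 2 * K * measure M B"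
      using U B_int B by (simp add: prob_space)
    finally show "outer_exp M f - e - 2 * K * measure M B \<le> integral\<^sup>L M U"
      by linarith
  qed
  then show ?thesis
    by linarith
qed

lemma outer_prob_le:
  assumes "B \<in> sets M" "A \<inter> space M \<subseteq> B"
  shows "outer_prob M A \<le> measure M B"
  unfolding outer_prob_def
proof (rule cInf_lower)
  show "bdd_below {measure M B |B. B \<in> sets M \<and> A \<inter> space M \<subseteq> B}"
    by (rule bdd_belowI[where m = 0]) auto
qed (use assms in blast)

lemma outer_prob_nonneg: "0 \<le> outer_prob M A"
  unfolding outer_prob_def by (rule cInf_greatest) auto

lemma outer_prob_coverE:
  assumes "outer_prob M A < e"
  obtains B where "B \<in> sets M" "A \<inter> space M \<subseteq> B" "measure M B < e"
proof -
  have "measure M (space M) \<in> {measure M B |B. B \<in> sets M \<and> A \<inter> space M \<subseteq> B}"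
    by auto
  then obtain b where "b \<in> {measure M B |B. B \<in> sets M \<and> A \<inter> space M \<subseteq> B}" "b < e"
    using assms unfolding outer_prob_def by (metis (no_types, lifting) cInf_lessD empty_iff)
  then show thesis
    using that by blast
qed

lemma outer_prob_mono:
  assumes "A \<inter> space M \<subseteq> A'"
  shows "outer_prob M A \<le> outer_prob M A'"
proof (rule field_le_epsilon)
  fix e :: real assume "0 < e"
  then obtain B where "B \<in> sets M" "A' \<inter> space M \<subseteq> B" "measure M B < outer_prob M A' + e"
    using outer_prob_coverE[of A' "outer_prob M A' + e"] by auto
  moreover from this have "outer_prob M A \<le> measure M B"
    using assms by (intro outer_prob_le) auto
  ultimately show "outer_prob M A \<le> outer_prob M A' + e"
    by linarith
qed

lemma outer_prob_Un: "outer_prob M (A \<union> A') \<le> outer_prob M A + outer_prob M A'"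
proof (rule field_le_epsilon)
  fix e :: real assume "0 < e"
  obtain B where B: "B \<in> sets M" "A \<inter> space M \<subseteq> B" "measure M B < outer_prob M A + e / 2"
    using outer_prob_coverE[of A "outer_prob M A + e / 2"] \<open>0 < e\<close> by auto
  obtain B' where B': "B' \<in> sets M" "A' \<inter> space M \<subseteq> B'" "measure M B' < outer_prob M A' + e / 2"
    using outer_prob_coverE[of A' "outer_prob M A' + e / 2"] \<open>0 < e\<close> by auto
  have "outer_prob M (A \<union> A') \<le> measure M (B \<union> B')"
    using B B' by (intro outer_prob_le) auto
  also have "\<dots> \<le> measure M B + measure M B'"
    using B B' by (intro measure_Un_le)
  finally show "outer_prob M (A \<union> A') \<le> outer_prob M A + outer_prob M A' + e"
    using B B' by linarith
qed

lemma outer_prob_less_1_imp_ex: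
  assumes "outer_prob M A < 1"
  obtains x where "x \<in> space M" "x \<notin> A"
proof -
  obtain B where B: "B \<in> sets M" "A \<inter> space M \<subseteq> B" "measure M B < 1"
    using outer_prob_coverE[OF assms] by blast
  then have "B \<noteq> space M"
    using prob_space by auto
  then show thesis
    using that sets.sets_into_space[OF B(1)] B(2) by blast
qed

lemma outer_prob_Markov:
  assumes f: "\<And>x. x \<in> space M \<Longrightarrow> 0 \<le> f x \<and> f x \<le> K" and e: "0 < e"
  shows "outer_prob M {x \<in> space M. e \<le> f x} \<le> outer_exp M f / e"
proof -
  have "e * outer_prob M {x \<in> space M. e \<le> f x} \<le> outer_exp M f"
  proof (rule outer_exp_ge)
    show "\<bar>f x\<bar> \<le> K" if "x \<in> space M" for x
      using f[OF that] by simp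
    fix U assume U: "integrable M U" "\<And>x. x \<in> space M \<Longrightarrow> f x \<le> U x"
    have "U \<in> borel_measurable M"
      using U(1) by auto
    then have "{x \<in> space M. e \<le> U x} \<in> sets M"
      by measurable
    then have "outer_prob M {x \<in> space M. e \<le> f x} \<le> measure M {x \<in> space M. e \<le> U x}"
      using U(2) by (intro outer_prob_le) (auto intro: order_trans)
    also have "\<dots> \<le> integral\<^sup>L M U / e"
    proof (rule integral_Markov_inequality_measure[where A = "{}" and u = U, simplified])
      have "0 \<le> U x" if "x \<in> space M" for x
        using f[OF that] U(2)[OF that] by linarith
      then show "AE x in M. 0 \<le> U x"
        by (rule AE_I2)
    qed (use U(1) e in auto)
    finally show "e * outer_prob M {x \<in> space M. e \<le> f x} \<le> integral\<^sup>L M U"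
      using e by (simp add: field_simps)
  qed
  then show ?thesis
    using e by (simp add: field_simps)
qed

lemma outer_prob_tendsto_0_mono:
  assumes "\<forall>\<^sub>F k in F. A k \<inter> space M \<subseteq> A' k" "((\<lambda>k. outer_prob M (A' k)) \<longlongrightarrow> 0) F"
  shows "((\<lambda>k. outer_prob M (A k)) \<longlongrightarrow> 0) F"
proof (rule Lim_null_comparison[OF _ assms(2)])
  show "\<forall>\<^sub>F k in F. norm (outer_prob M (A k)) \<le> outer_prob M (A' k)"
    using assms(1) by eventually_elim (simp add: outer_prob_mono outer_prob_nonneg)
qed

lemma outer_prob_tendsto_0_Un:
  assumes "((\<lambda>k. outer_prob M (A k)) \<longlongrightarrow> 0) F" "((\<lambda>k. outer_prob M (A' k)) \<longlongrightarrow> 0) F"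
  shows "((\<lambda>k. outer_prob M (A k \<union> A' k)) \<longlongrightarrow> 0) F"
proof (rule Lim_null_comparison)
  show "((\<lambda>k. outer_prob M (A k) + outer_prob M (A' k)) \<longlongrightarrow> 0) F"
    using tendsto_add[OF assms] by simp
  show "\<forall>\<^sub>F k in F. norm (outer_prob M (A k \<union> A' k)) \<le> outer_prob M (A k) + outer_prob M (A' k)"
    by (simp add: outer_prob_Un outer_prob_nonneg)
qed

end

section \<open>Consistency of empirical measures\<close>

lemma BL_close_if_net:
  assumes cpt: "compact (UNIV :: 'a::metric_space set)" and M: "borel_prob_space M"
    and N: "borel_prob_space N"
    and T: "T \<subseteq> unit_BL" "\<And>f. f \<in> unit_BL \<Longrightarrow> \<exists>g\<in>T. \<forall>x::'a. \<bar>f x - g x\<bar> < e / 3"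
    and close: "\<And>g. g \<in> T \<Longrightarrow> \<bar>integral\<^sup>L M g - integral\<^sup>L N g\<bar> \<le> e / 3"
  shows "BL_close e M N"
  unfolding BL_close_def
proof
  fix f :: "'a \<Rightarrow> real" assume f: "f \<in> unit_BL"
  obtain g where g: "g \<in> T" "\<And>x. \<bar>f x - g x\<bar> \<le> e / 3"
    using T(2)[OF f] less_imp_le by meson
  then have cont: "continuous_on UNIV f" "continuous_on UNIV g"
    using unit_BL_continuous f T(1) by blast+
  have "\<bar>integral\<^sup>L M f - integral\<^sup>L M g\<bar> \<le> e / 3" "\<bar>integral\<^sup>L N f - integral\<^sup>L N g\<bar> \<le> e / 3"
    using borel_prob_space.abs_integral_diff_le[OF M cpt cont g(2)]
      borel_prob_space.abs_integral_diff_le[OF N cpt cont g(2)] .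
  then show "\<bar>integral\<^sup>L M f - integral\<^sup>L N f\<bar> \<le> e"
    using close[OF g(1)] by linarith
qed

context prob_space
begin

lemma emp_meas_deviation_le:
  fixes X :: "nat \<Rightarrow> 'a \<Rightarrow> 'b::metric_space"
  assumes X: "\<And>i. X i \<in> borel_measurable M" "\<And>i. distr M borel (X i) = \<mu>" "indep_vars (\<lambda>_. borel) X UNIV"
    and g: "g \<in> unit_BL" and n: "0 < n" and e: "0 < e"
  defines "A \<equiv> {\<omega> \<in> space M. e \<le> \<bar>integral\<^sup>L (emp_meas n (\<lambda>i. X i \<omega>)) g - integral\<^sup>L \<mu> g\<bar>}"
  shows "A \<in> sets M" "measure M A \<le> 2 * exp (- (e\<^sup>2 / 2)) ^ n"
proof -
  have g_meas: "g \<in> borel_measurable borel"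
    by (rule borel_measurable_continuous_onI[OF unit_BL_continuous[OF g]])
  have gX: "(\<lambda>\<omega>. g (X i \<omega>)) \<in> borel_measurable M" for i
    using X(1) g_meas by (rule measurable_compose)
  have A: "A = {\<omega> \<in> space M. e \<le> \<bar>(\<Sum>i<n. g (X i \<omega>)) / real n - integral\<^sup>L \<mu> g\<bar>}"
    unfolding A_def by (simp add: integral_emp_meas[OF n g_meas])
  show "A \<in> sets M"
    unfolding A using gX by measurable
  interpret H: Hoeffding_ineq_iid M "{..<n}" "\<lambda>i \<omega>. g (X i \<omega>)" "\<lambda>\<omega>. g (X 0 \<omega>)" "-1" "1"
    "expectation (\<lambda>\<omega>. g (X 0 \<omega>))"
  proof unfold_locales
    show "indep_vars (\<lambda>_. borel) (\<lambda>i \<omega>. g (X i \<omega>)) {..<n}"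
      using g_meas by (intro indep_vars_compose2[OF indep_vars_subset[OF X(3)]]) auto
    show "distr M borel (\<lambda>\<omega>. g (X i \<omega>)) = distr M borel (\<lambda>\<omega>. g (X 0 \<omega>))" for i
      using distr_distr[OF g_meas X(1), of i] distr_distr[OF g_meas X(1), of 0] X(2) by (simp add: o_def)
    have "\<bar>g x\<bar> \<le> 1" for x
      using Fclass_abs_le[OF g[unfolded unit_BL_def], of x] by simp
    then show "AE \<omega> in M. g (X 0 \<omega>) \<in> {- 1..1}"
      by (simp add: abs_le_iff minus_le_iff)
  qed (use gX in auto)
  have "expectation (\<lambda>\<omega>. g (X 0 \<omega>)) = integral\<^sup>L \<mu> g"
    using integral_distr[OF X(1) g_meas, of 0] X(2) by simp
  moreover have "{..<n} \<noteq> {}"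
    using n by auto
  ultimately have "measure M A \<le> 2 * exp (- 2 * real n * e\<^sup>2 / 4)"
    using H.Hoeffding_ineq_abs_ge'[of e] e by (simp add: A)
  also have "exp (- 2 * real n * e\<^sup>2 / 4) = exp (- (e\<^sup>2 / 2)) ^ n"
    by (subst exp_of_nat_mult[symmetric]) simp
  finally show "measure M A \<le> 2 * exp (- (e\<^sup>2 / 2)) ^ n" .
qed

lemma outer_prob_not_BL_close_emp_meas_le:
  fixes X :: "nat \<Rightarrow> 'a \<Rightarrow> 'b::metric_space"
  assumes cpt: "compact (UNIV :: 'b set)"
    and X: "\<And>i. X i \<in> borel_measurable M" "\<And>i. distr M borel (X i) = \<mu>" "indep_vars (\<lambda>_. borel) X UNIV"
    and T: "T \<subseteq> unit_BL" "finite T" "\<And>f. f \<in> unit_BL \<Longrightarrow> \<exists>g\<in>T. \<forall>x::'b. \<bar>f x - g x\<bar> < e / 3"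
    and n: "0 < n" and e: "0 < e"
  shows "outer_prob M {\<omega> \<in> space M. \<not> BL_close e (emp_meas n (\<lambda>i. X i \<omega>)) \<mu>}
    \<le> real (card T) * (2 * exp (- ((e / 3)\<^sup>2 / 2)) ^ n)"
proof -
  have \<mu>: "borel_prob_space \<mu>"
    using prob_space_distr[OF X(1), of 0] X(2)[of 0] by (auto simp: borel_prob_space_iff)
  define A where "A g = {\<omega> \<in> space M. e / 3 \<le> \<bar>integral\<^sup>L (emp_meas n (\<lambda>i. X i \<omega>)) g - integral\<^sup>L \<mu> g\<bar>}" for g
  have A: "A g \<in> sets M" "measure M (A g) \<le> 2 * exp (- ((e / 3)\<^sup>2 / 2)) ^ n" if "g \<in> T" for g
    using emp_meas_deviation_le[OF X, of g n "e / 3"] that T(1) n e by (auto simp: A_def)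
  have "outer_prob M {\<omega> \<in> space M. \<not> BL_close e (emp_meas n (\<lambda>i. X i \<omega>)) \<mu>} \<le> measure M (\<Union>g\<in>T. A g)"
  proof (rule outer_prob_le)
    show "(\<Union>g\<in>T. A g) \<in> sets M"
      using T(2) A(1) by auto
    show "{\<omega> \<in> space M. \<not> BL_close e (emp_meas n (\<lambda>i. X i \<omega>)) \<mu>} \<inter> space M \<subseteq> (\<Union>g\<in>T. A g)"
      using BL_close_if_net[OF cpt borel_prob_space_emp_meas[OF n] \<mu> T(1,3)] by (force simp: A_def)
  qed
  also have "\<dots> \<le> (\<Sum>g\<in>T. measure M (A g))"
    using T(2) A(1) by (intro finite_measure_subadditive_finite) auto
  also have "\<dots> \<le> real (card T) * (2 * exp (- ((e / 3)\<^sup>2 / 2)) ^ n)"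
    using A(2) by (rule sum_bounded_above)
  finally show ?thesis .
qed

theorem emp_meas_BL_consistent:
  fixes X :: "nat \<Rightarrow> 'a \<Rightarrow> 'b::metric_space"
  assumes cpt: "compact (UNIV :: 'b set)"
    and X: "\<And>i. X i \<in> borel_measurable M" "\<And>i. distr M borel (X i) = \<mu>" "indep_vars (\<lambda>_. borel) X UNIV"
    and e: "0 < e"
  shows "(\<lambda>n. outer_prob M {\<omega> \<in> space M. \<not> BL_close e (emp_meas n (\<lambda>i. X i \<omega>)) \<mu>}) \<longlonglongrightarrow> 0"
proof -
  obtain T where T: "T \<subseteq> (unit_BL :: ('b \<Rightarrow> real) set)" "finite T"
    and net: "\<And>f::'b \<Rightarrow> real. f \<in> unit_BL \<Longrightarrow> \<exists>g\<in>T. \<forall>x. \<bar>f x - g x\<bar> < e / 3"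
    using Fclass_finite_net[OF cpt tendsto_ident_at, of "e / 3" "1/2"] e unfolding unit_BL_def by auto
  show ?thesis
  proof (rule Lim_null_comparison)
    show "\<forall>\<^sub>F n in sequentially. norm (outer_prob M {\<omega> \<in> space M. \<not> BL_close e (emp_meas n (\<lambda>i. X i \<omega>)) \<mu>})
        \<le> real (card T) * (2 * exp (- ((e / 3)\<^sup>2 / 2)) ^ n)"
      using outer_prob_not_BL_close_emp_meas_le[OF cpt X T net _ e]
      by (intro eventually_sequentiallyI[of 1]) (simp add: outer_prob_nonneg)
    have "(\<lambda>n. exp (- ((e / 3)\<^sup>2 / 2)) ^ n) \<longlonglongrightarrow> 0"
      using e by (intro LIMSEQ_realpow_zero) auto
    then show "(\<lambda>n. real (card T) * (2 * exp (- ((e / 3)\<^sup>2 / 2)) ^ n)) \<longlonglongrightarrow> 0"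
      by (intro tendsto_mult_right_zero)
  qed
qed

end

lemma ex_emp_meas_BL_close:
  fixes \<mu> :: "'a::metric_space measure"
  assumes cpt: "compact (UNIV :: 'a set)" and \<mu>: "borel_prob_space \<mu>" and e: "0 < e"
  obtains n x where "0 < n" "BL_close e (emp_meas n x) \<mu>"
proof -
  interpret \<mu>: borel_prob_space \<mu> by (rule \<mu>)
  define P where "P = (\<Pi>\<^sub>M i\<in>(UNIV :: nat set). \<mu>)"
  interpret P: prob_space P
    unfolding P_def by (rule prob_space_PiM) (rule \<mu>.prob_space_axioms)
  have sets_P: "sets P = sets (\<Pi>\<^sub>M i\<in>(UNIV :: nat set). borel)"
    unfolding P_def by (rule sets_PiM_cong) auto
  have coord: "(\<lambda>\<omega>. \<omega> i) \<in> borel_measurable P" for i :: nat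
    unfolding measurable_cong_sets[OF sets_P refl] by measurable
  have law: "distr P borel (\<lambda>\<omega>. \<omega> i) = \<mu>" for i :: nat
  proof -
    have "distr P borel (\<lambda>\<omega>. \<omega> i) = distr P \<mu> (\<lambda>\<omega>. \<omega> i)"
      by (rule distr_cong) auto
    also have "\<dots> = \<mu>"
      unfolding P_def by (rule distr_PiM_component) (auto intro: \<mu>.prob_space_axioms)
    finally show ?thesis .
  qed
  have "distr P (\<Pi>\<^sub>M i\<in>(UNIV :: nat set). borel) (\<lambda>\<omega>. \<lambda>i\<in>UNIV. \<omega> i) = P"
    using distr_id2[OF sets_P[symmetric]] by (simp add: restrict_def)
  then have "P.indep_vars (\<lambda>_. borel) (\<lambda>i \<omega>. \<omega> i) UNIV"
    using P.indep_vars_iff_distr_eq_PiM[of UNIV "\<lambda>i \<omega>. \<omega> i" "\<lambda>_. borel"] coord law by (simp add: P_def)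
  then have "(\<lambda>n. outer_prob P {\<omega> \<in> space P. \<not> BL_close e (emp_meas n (\<lambda>i. \<omega> i)) \<mu>}) \<longlonglongrightarrow> 0"
    by (rule P.emp_meas_BL_consistent[OF cpt coord law _ e])
  then have "\<forall>\<^sub>F n in sequentially. outer_prob P {\<omega> \<in> space P. \<not> BL_close e (emp_meas n (\<lambda>i. \<omega> i)) \<mu>} < 1"
    by (rule order_tendstoD) simp
  with eventually_gt_at_top[of 0] have "\<forall>\<^sub>F n in sequentially. 0 < n
      \<and> outer_prob P {\<omega> \<in> space P. \<not> BL_close e (emp_meas n (\<lambda>i. \<omega> i)) \<mu>} < 1"
    by (rule eventually_conj)
  then obtain n where n: "0 < n" "outer_prob P {\<omega> \<in> space P. \<not> BL_close e (emp_meas n (\<lambda>i. \<omega> i)) \<mu>} < 1"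
    using eventually_happens'[OF sequentially_bot] by blast
  obtain \<omega> where "BL_close e (emp_meas n (\<lambda>i. \<omega> i)) \<mu>"
    using P.outer_prob_less_1_imp_ex[OF n(2)] by blast
  with n(1) show thesis
    by (rule that)
qed

section \<open>Kantorovich duality on compact metric spaces\<close>

lemma weakly_converges_distr:
  assumes \<rho>: "\<And>j. borel_prob_space (\<rho> j)" and \<pi>: "borel_prob_space \<pi>"
    and conv: "weakly_converges \<rho> \<pi>" and \<phi>: "continuous_on UNIV \<phi>"
  shows "weakly_converges (\<lambda>j. distr (\<rho> j) borel \<phi>) (distr \<pi> borel \<phi>)"
  unfolding weakly_converges_def
proof (intro allI impI)
  fix h :: "'b \<Rightarrow> real" assume h: "continuous_on UNIV h"
  have "continuous_on UNIV (\<lambda>p. h (\<phi> p))"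
    by (intro continuous_on_compose2[OF h \<phi>]) auto
  then show "(\<lambda>j. integral\<^sup>L (distr (\<rho> j) borel \<phi>) h) \<longlonglongrightarrow> integral\<^sup>L (distr \<pi> borel \<phi>) h"
    using weakly_convergesD[OF conv] borel_prob_space.integral_distr_continuous[OF \<rho> \<phi> h]
      borel_prob_space.integral_distr_continuous[OF \<pi> \<phi> h] by simp
qed

lemma weak_limit_eq_if_BL_close:
  fixes \<mu> \<mu>' :: "'a::metric_space measure"
  assumes "borel_prob_space \<mu>" "borel_prob_space \<mu>'" and conv: "weakly_converges \<rho> \<mu>'"
    and close: "\<And>j. BL_close (e j) (\<rho> j) \<mu>" and e: "e \<longlonglongrightarrow> 0"
  shows "\<mu>' = \<mu>"
proof (rule BL_close_0_imp_eq)
  show "BL_close 0 \<mu>' \<mu>"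
    unfolding BL_close_def
  proof
    fix g :: "'a \<Rightarrow> real" assume g: "g \<in> unit_BL"
    have "(\<lambda>j. integral\<^sup>L (\<rho> j) g - integral\<^sup>L \<mu> g) \<longlonglongrightarrow> 0"
      using BL_closeD[OF close g] by (intro Lim_null_comparison[OF _ e]) simp
    then have "(\<lambda>j. integral\<^sup>L (\<rho> j) g) \<longlonglongrightarrow> integral\<^sup>L \<mu> g"
      by (simp add: LIM_zero_iff)
    then show "\<bar>integral\<^sup>L \<mu>' g - integral\<^sup>L \<mu> g\<bar> \<le> 0"
      using LIMSEQ_unique weakly_convergesD[OF conv unit_BL_continuous[OF g]] by fastforce
  qed
qed fact+

lemma weak_limit_in_couplings:
  fixes \<mu> :: "'x::metric_space measure" and \<nu> :: "'y::metric_space measure"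
  assumes \<mu>: "borel_prob_space \<mu>" and \<nu>: "borel_prob_space \<nu>"
    and \<rho>: "\<And>j. borel_prob_space (\<rho> j)" and \<pi>: "borel_prob_space \<pi>" and conv: "weakly_converges \<rho> \<pi>"
    and fst: "\<And>j. BL_close (e j) (distr (\<rho> j) borel fst) \<mu>"
    and snd: "\<And>j. BL_close (e j) (distr (\<rho> j) borel snd) \<nu>" and e: "e \<longlonglongrightarrow> 0"
  shows "\<pi> \<in> couplings \<mu> \<nu>"
proof -
  interpret \<pi>: borel_prob_space \<pi> by (rule \<pi>)
  have cont: "continuous_on UNIV (fst :: 'x \<times> 'y \<Rightarrow> 'x)" "continuous_on UNIV (snd :: 'x \<times> 'y \<Rightarrow> 'y)"
    by (intro continuous_intros)+
  have "distr \<pi> borel fst = \<mu>"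
    using weak_limit_eq_if_BL_close[OF \<mu> _ weakly_converges_distr[OF \<rho> \<pi> conv cont(1)] fst e]
      \<pi>.borel_prob_space_distr[OF \<pi>.measurable_continuous[OF cont(1)]] by blast
  moreover have "distr \<pi> borel snd = \<nu>"
    using weak_limit_eq_if_BL_close[OF \<nu> _ weakly_converges_distr[OF \<rho> \<pi> conv cont(2)] snd e]
      \<pi>.borel_prob_space_distr[OF \<pi>.measurable_continuous[OF cont(2)]] by blast
  ultimately show ?thesis
    using \<pi> by (simp add: couplings_iff)
qed

context compact_cost
begin

lemma dual_attainment_limit:
  assumes W: "(W \<longlongrightarrow> 0) (at_right 0)" and \<mu>: "borel_prob_space \<mu>" and \<nu>: "borel_prob_space \<nu>"
    and \<rho>: "\<And>j. \<rho> j \<in> couplings (\<mu>' j) (\<nu>' j)" and f: "\<And>j. f j \<in> Fclass B W"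
    and eq: "\<And>j. integral\<^sup>L (\<rho> j) c = dual_value (\<mu>' j) (\<nu>' j) c (f j)"
    and close: "\<And>j. BL_close (e j) (\<mu>' j) \<mu>" "\<And>j. BL_close (e j) (\<nu>' j) \<nu>" and e: "e \<longlonglongrightarrow> 0"
  obtains \<pi> g where "\<pi> \<in> couplings \<mu> \<nu>" "g \<in> Fclass B W" "integral\<^sup>L \<pi> c = dual_value \<mu> \<nu> c g"
proof -
  obtain r g where r: "strict_mono (r :: nat \<Rightarrow> nat)" and g: "g \<in> Fclass B W"
    and unif: "uniform_limit UNIV (\<lambda>j. f (r j)) g sequentially"
    using Fclass_convergent_subseq[where f = f, OF X_compact W f] by blast
  have \<rho>_prob: "borel_prob_space (\<rho> j)" for j
    by (rule couplings_borel_prob_space(1)[OF \<rho>])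
  then obtain r' \<pi> where r': "strict_mono (r' :: nat \<Rightarrow> nat)" and \<pi>: "borel_prob_space \<pi>"
    and conv: "weakly_converges (\<lambda>j. \<rho> (r (r' j))) \<pi>"
    using borel_prob_space_weak_compactness[OF XY_compact, of "\<lambda>j. \<rho> (r j)"] by blast
  define q where "q j = r (r' j)" for j
  have "strict_mono q"
    using strict_mono_o[OF r r'] by (simp add: q_def[abs_def] o_def)
  then have "(\<lambda>j. e (q j)) \<longlonglongrightarrow> 0"
    using LIMSEQ_subseq_LIMSEQ[OF e] by (simp add: o_def)
  then have \<pi>_coupling: "\<pi> \<in> couplings \<mu> \<nu>"
    using weak_limit_in_couplings[OF \<mu> \<nu> \<rho>_prob \<pi> conv, of "\<lambda>j. e (q j)"] \<rho> close
    by (simp add: couplings_iff q_def)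
  note bdd = Fclass_bounded[OF f] Fclass_bounded[OF g]
  have "uniform_limit UNIV (\<lambda>j. f (q j)) g sequentially"
    unfolding q_def by (rule filterlim_compose[OF unif filterlim_subseq[OF r']])
  then have "(\<lambda>j. integral\<^sup>L (\<rho> (q j)) c - integral\<^sup>L (\<rho> (q j)) (dual_sum c g)) \<longlonglongrightarrow> 0"
    using dual_value_diff_tendsto_0[OF couplings_borel_prob_space(2,3)[OF \<rho>] bdd]
    by (simp add: eq integral_dual_sum_coupling[OF \<rho> bdd(2)])
  moreover have "(\<lambda>j. integral\<^sup>L (\<rho> (q j)) c - integral\<^sup>L (\<rho> (q j)) (dual_sum c g))
      \<longlonglongrightarrow> integral\<^sup>L \<pi> c - integral\<^sup>L \<pi> (dual_sum c g)"
    using conv unfolding q_def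
    by (intro tendsto_diff weakly_convergesD cost_continuous continuous_dual_sum bdd)
  ultimately have "integral\<^sup>L \<pi> c = integral\<^sup>L \<pi> (dual_sum c g)"
    using LIMSEQ_unique by fastforce
  then show thesis
    using that[OF \<pi>_coupling g] integral_dual_sum_coupling[OF \<pi>_coupling bdd(2)] by simp
qed

theorem Kantorovich_duality:
  assumes \<mu>: "borel_prob_space \<mu>" and \<nu>: "borel_prob_space \<nu>" and C: "\<And>p. \<bar>c p\<bar> \<le> C"
    and W: "\<And>x x' y. \<bar>c (x, y) - c (x', y)\<bar> \<le> W (dist x x')" "(W \<longlongrightarrow> 0) (at_right 0)"
  obtains \<pi> f where "\<pi> \<in> couplings \<mu> \<nu>" "f \<in> Fclass C W" "integral\<^sup>L \<pi> c = dual_value \<mu> \<nu> c f"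
proof -
  have "\<exists>n x. 0 < n \<and> BL_close (1 / real (Suc j)) (emp_meas n x) \<mu>" for j
    by (rule ex_emp_meas_BL_close[OF X_compact \<mu>, of "1 / real (Suc j)"]) auto
  then obtain N x where N: "0 < N j" "BL_close (1 / real (Suc j)) (emp_meas (N j) (x j)) \<mu>" for j
    by metis
  have "\<exists>n y. 0 < n \<and> BL_close (1 / real (Suc j)) (emp_meas n y) \<nu>" for j
    by (rule ex_emp_meas_BL_close[OF Y_compact \<nu>, of "1 / real (Suc j)"]) auto
  then obtain M y where M: "0 < M j" "BL_close (1 / real (Suc j)) (emp_meas (M j) (y j)) \<nu>" for j
    by metis
  have "\<exists>\<pi> f. \<pi> \<in> couplings (emp_meas (N j) (x j)) (emp_meas (M j) (y j)) \<and> f \<in> Fclass C W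
      \<and> integral\<^sup>L \<pi> c = dual_value (emp_meas (N j) (x j)) (emp_meas (M j) (y j)) c f" for j
    using emp_meas_duality[of "N j" "M j" C W "x j" "y j", OF N(1) M(1) C W(1)] by blast
  then obtain \<rho> f where "\<rho> j \<in> couplings (emp_meas (N j) (x j)) (emp_meas (M j) (y j))" "f j \<in> Fclass C W"
    "integral\<^sup>L (\<rho> j) c = dual_value (emp_meas (N j) (x j)) (emp_meas (M j) (y j)) c (f j)" for j
    by metis
  then show thesis
    using dual_attainment_limit[OF W(2) \<mu> \<nu> _ _ _ N(2) M(2) LIMSEQ_Suc[OF lim_1_over_n]] that by blast
qed

lemma opt_plans_nonempty:
  assumes "borel_prob_space \<mu>" "borel_prob_space \<nu>"
  shows "opt_plans \<mu> \<nu> c \<noteq> {}"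
proof -
  obtain C where C: "\<And>p. \<bar>c p\<bar> \<le> C"
    using bounded_rangeE[OF bounded_cost] by blast
  have "\<bar>c (x, y) - c (x', y)\<bar> \<le> osc (dist x x') c" for x x' y
    by (rule abs_diff_le_osc[OF bounded_cost]) simp
  then obtain \<pi> f where "\<pi> \<in> couplings \<mu> \<nu>" "f \<in> Fclass C (\<lambda>\<delta>. osc \<delta> c)" "integral\<^sup>L \<pi> c = dual_value \<mu> \<nu> c f"
    using Kantorovich_duality[OF assms C, where W = "\<lambda>\<delta>. osc \<delta> c"] osc_tendsto_0 by blast
  then show ?thesis
    using dual_value_eq_imp_opt(1) Fclass_bounded by blast
qed

end

section \<open>Nearly optimal plans\<close>

definition near_opt_plans :: "'x::metric_space measure \<Rightarrow> 'y::metric_space measure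
    \<Rightarrow> ('x \<times> 'y \<Rightarrow> real) \<Rightarrow> real \<Rightarrow> ('x \<times> 'y) measure set" where
  "near_opt_plans \<mu> \<nu> c e = {\<pi>. borel_prob_space \<pi> \<and> BL_close e (distr \<pi> borel fst) \<mu> \<and>
     BL_close e (distr \<pi> borel snd) \<nu> \<and> integral\<^sup>L \<pi> c \<le> OT \<mu> \<nu> c + e}"

lemma near_opt_plans_mono: "e \<le> e' \<Longrightarrow> near_opt_plans \<mu> \<nu> c e \<subseteq> near_opt_plans \<mu> \<nu> c e'"
  by (auto simp: near_opt_plans_def intro: BL_close_mono)

lemma opt_plans_subset_near_opt_plans:
  "0 \<le> e \<Longrightarrow> opt_plans \<mu> \<nu> c \<subseteq> near_opt_plans \<mu> \<nu> c e"
  by (auto simp: near_opt_plans_def opt_plans_def couplings_iff BL_close_refl)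

lemma near_opt_plans_borel_prob_space: "\<pi> \<in> near_opt_plans \<mu> \<nu> c e \<Longrightarrow> borel_prob_space \<pi>"
  by (simp add: near_opt_plans_def)

lemma opt_plans_borel_prob_space: "\<pi> \<in> opt_plans \<mu> \<nu> c \<Longrightarrow> borel_prob_space \<pi>"
  by (simp add: opt_plans_def couplings_iff)

lemma coupling_in_near_opt_plans:
  assumes "\<pi> \<in> couplings \<mu>' \<nu>'" "BL_close e \<mu>' \<mu>" "BL_close e \<nu>' \<nu>" "integral\<^sup>L \<pi> c \<le> OT \<mu> \<nu> c + e"
  shows "\<pi> \<in> near_opt_plans \<mu> \<nu> c e"
  using assms by (simp add: near_opt_plans_def couplings_iff)

definition plan_inf :: "('x \<times> 'y) measure set \<Rightarrow> ('x \<times> 'y \<Rightarrow> real) \<Rightarrow> real" where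
  "plan_inf S h = (INF \<pi>\<in>S. integral\<^sup>L \<pi> h)"

context compact_cost
begin

lemma plan_inf_le:
  assumes "continuous_on UNIV h" "\<And>\<pi>. \<pi> \<in> S \<Longrightarrow> borel_prob_space \<pi>" "\<pi> \<in> S"
  shows "plan_inf S h \<le> integral\<^sup>L \<pi> (h :: 'x \<times> 'y \<Rightarrow> real)"
  unfolding plan_inf_def using assms by (intro cINF_lower bdd_below_integrals)

lemma plan_inf_less_iff:
  fixes h :: "'x \<times> 'y \<Rightarrow> real"
  assumes "continuous_on UNIV h" "\<And>\<pi>. \<pi> \<in> S \<Longrightarrow> borel_prob_space \<pi>" "S \<noteq> {}"
  shows "plan_inf S h < a \<longleftrightarrow> (\<exists>\<pi>\<in>S. integral\<^sup>L \<pi> h < a)"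
  unfolding plan_inf_def using assms by (intro cINF_less_iff bdd_below_integrals)

lemma abs_plan_inf_diff_le:
  fixes g h :: "'x \<times> 'y \<Rightarrow> real"
  assumes S: "S \<noteq> {}" "\<And>\<pi>. \<pi> \<in> S \<Longrightarrow> borel_prob_space \<pi>"
    and cont: "continuous_on UNIV g" "continuous_on UNIV h" and le: "\<And>p. \<bar>g p - h p\<bar> \<le> e"
  shows "\<bar>plan_inf S g - plan_inf S h\<bar> \<le> e"
  unfolding plan_inf_def
  using borel_prob_space.abs_integral_diff_le[OF S(2) XY_compact cont le]
  by (intro abs_cINF_diff_le S(1) bdd_below_integrals cont S(2))

lemma plan_inf_antimono:
  assumes "continuous_on UNIV h" "\<And>\<pi>. \<pi> \<in> S' \<Longrightarrow> borel_prob_space \<pi>" "S \<noteq> {}" "S \<subseteq> S'"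
  shows "plan_inf S' h \<le> plan_inf S (h :: 'x \<times> 'y \<Rightarrow> real)"
  unfolding plan_inf_def
  by (rule cINF_superset_mono[OF assms(3) bdd_below_integrals[OF assms(1,2)] assms(4)]) auto

lemma near_opt_plans_limit:
  assumes \<mu>: "borel_prob_space \<mu>" and \<nu>: "borel_prob_space \<nu>"
    and \<rho>: "\<And>j. \<rho> j \<in> near_opt_plans \<mu> \<nu> c (e j)" and e: "e \<longlonglongrightarrow> 0"
  obtains r \<pi> where "strict_mono (r :: nat \<Rightarrow> nat)" "\<pi> \<in> opt_plans \<mu> \<nu> c" "weakly_converges (\<lambda>j. \<rho> (r j)) \<pi>"
proof -
  have \<rho>_prob: "borel_prob_space (\<rho> j)" for j
    by (rule near_opt_plans_borel_prob_space[OF \<rho>])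
  then obtain r \<pi> where r: "strict_mono (r :: nat \<Rightarrow> nat)" and \<pi>: "borel_prob_space \<pi>"
    and conv: "weakly_converges (\<lambda>j. \<rho> (r j)) \<pi>"
    using borel_prob_space_weak_compactness[OF XY_compact] by blast
  have e_r: "(\<lambda>j. e (r j)) \<longlonglongrightarrow> 0"
    using LIMSEQ_subseq_LIMSEQ[OF e r] by (simp add: o_def)
  have \<pi>_coupling: "\<pi> \<in> couplings \<mu> \<nu>"
    using weak_limit_in_couplings[OF \<mu> \<nu> \<rho>_prob \<pi> conv _ _ e_r] \<rho> by (simp add: near_opt_plans_def)
  have "integral\<^sup>L \<pi> c \<le> OT \<mu> \<nu> c + 0"
    using \<rho>
    by (intro LIMSEQ_le[OF weakly_convergesD[OF conv cost_continuous] tendsto_add[OF tendsto_const e_r]])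
      (auto simp: near_opt_plans_def)
  then have "\<pi> \<in> opt_plans \<mu> \<nu> c"
    using OT_le[OF \<pi>_coupling] \<pi>_coupling by (simp add: opt_plans_def)
  with r conv show thesis
    using that by blast
qed

lemma plan_inf_near_opt_plans_tendsto:
  fixes h :: "'x \<times> 'y \<Rightarrow> real"
  assumes \<mu>: "borel_prob_space \<mu>" and \<nu>: "borel_prob_space \<nu>" and h: "continuous_on UNIV h"
  shows "(\<lambda>j. plan_inf (near_opt_plans \<mu> \<nu> c (1 / real (Suc j))) h) \<longlonglongrightarrow> plan_inf (opt_plans \<mu> \<nu> c) h"
proof (rule increasing_LIMSEQ)
  let ?S = "\<lambda>j. near_opt_plans \<mu> \<nu> c (1 / real (Suc j))"
  have opt_subset: "opt_plans \<mu> \<nu> c \<subseteq> ?S j" for j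
    by (rule opt_plans_subset_near_opt_plans) simp
  have ne: "?S j \<noteq> {}" for j
    using opt_plans_nonempty[OF \<mu> \<nu>] opt_subset[of j] by blast
  show "plan_inf (?S j) h \<le> plan_inf (opt_plans \<mu> \<nu> c) h" for j
    by (rule plan_inf_antimono[OF h near_opt_plans_borel_prob_space opt_plans_nonempty[OF \<mu> \<nu>] opt_subset])
  show "plan_inf (?S j) h \<le> plan_inf (?S (Suc j)) h" for j
    by (rule plan_inf_antimono[OF h near_opt_plans_borel_prob_space ne])
      (auto intro!: near_opt_plans_mono divide_left_mono)
  show "\<exists>j. plan_inf (opt_plans \<mu> \<nu> c) h \<le> plan_inf (?S j) h + e" if "0 < e" for e
  proof (rule ccontr)
    assume "\<not> ?thesis"
    then have "plan_inf (?S j) h < plan_inf (opt_plans \<mu> \<nu> c) h - e" for j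
      by (simp add: not_le less_diff_eq)
    then have "\<exists>\<pi>\<in>?S j. integral\<^sup>L \<pi> h < plan_inf (opt_plans \<mu> \<nu> c) h - e" for j
      using plan_inf_less_iff[OF h near_opt_plans_borel_prob_space ne] by simp
    then obtain \<rho> where \<rho>: "\<rho> j \<in> ?S j" "integral\<^sup>L (\<rho> j) h < plan_inf (opt_plans \<mu> \<nu> c) h - e" for j
      by metis
    obtain r \<pi> where \<pi>: "\<pi> \<in> opt_plans \<mu> \<nu> c" and conv: "weakly_converges (\<lambda>j. \<rho> (r j)) \<pi>"
      using near_opt_plans_limit[OF \<mu> \<nu> \<rho>(1) LIMSEQ_Suc[OF lim_1_over_n]] by blast
    have "integral\<^sup>L \<pi> h \<le> plan_inf (opt_plans \<mu> \<nu> c) h - e"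
      using \<rho>(2) by (intro LIMSEQ_le_const2[OF weakly_convergesD[OF conv h]]) (auto intro: less_imp_le)
    moreover have "plan_inf (opt_plans \<mu> \<nu> c) h \<le> integral\<^sup>L \<pi> h"
      by (rule plan_inf_le[OF h opt_plans_borel_prob_space \<pi>])
    ultimately show False
      using \<open>0 < e\<close> by linarith
  qed
qed

end

section \<open>Asymptotic domination in outer probability\<close>

definition asymp_le :: "'o measure \<Rightarrow> (nat \<Rightarrow> 'o \<Rightarrow> real) \<Rightarrow> (nat \<Rightarrow> 'o \<Rightarrow> real) \<Rightarrow> bool" where
  "asymp_le P X Y \<longleftrightarrow> (\<forall>e>0. (\<lambda>k. outer_prob P {\<omega> \<in> space P. Y k \<omega> + e < X k \<omega>}) \<longlonglongrightarrow> 0)"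

lemma asymp_leD: "asymp_le P X Y \<Longrightarrow> 0 < e \<Longrightarrow> (\<lambda>k. outer_prob P {\<omega> \<in> space P. Y k \<omega> + e < X k \<omega>}) \<longlonglongrightarrow> 0"
  by (simp add: asymp_le_def)

context prob_space
begin

lemma outer_prob_tendsto_0I:
  assumes "\<And>\<eta>. 0 < \<eta> \<Longrightarrow> \<forall>\<^sub>F k in F. outer_prob M (A k) < \<eta>"
  shows "((\<lambda>k. outer_prob M (A k)) \<longlongrightarrow> 0) F"
  using assms by (intro tendstoI) (simp add: outer_prob_nonneg)

lemma outer_prob_less_Un:
  assumes "\<forall>\<^sub>F k in F. outer_prob M (A k) < \<eta> / 2" "\<forall>\<^sub>F k in F. outer_prob M (A' k) < \<eta> / 2"
    and "\<And>k. B k \<inter> space M \<subseteq> A k \<union> A' k"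
  shows "\<forall>\<^sub>F k in F. outer_prob M (B k) < \<eta>"
  using assms(1,2)
proof eventually_elim
  case (elim k)
  then show ?case
    using outer_prob_mono[OF assms(3)[of k]] outer_prob_Un[of "A k" "A' k"] by linarith
qed

lemma asymp_le_off_null_set:
  assumes "\<forall>\<^sub>F k in sequentially. \<forall>\<omega>\<in>space M. \<omega> \<notin> B k \<longrightarrow> X k \<omega> \<le> Y k \<omega>"
    and "(\<lambda>k. outer_prob M (B k)) \<longlonglongrightarrow> 0"
  shows "asymp_le M X Y"
  unfolding asymp_le_def
proof (intro allI impI)
  fix e :: real assume "0 < e"
  show "(\<lambda>k. outer_prob M {\<omega> \<in> space M. Y k \<omega> + e < X k \<omega>}) \<longlonglongrightarrow> 0"
    using assms(1)
    by (intro outer_prob_tendsto_0_mono[OF _ assms(2)]) (auto elim!: eventually_mono; use \<open>0 < e\<close> in force)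
qed

lemma asymp_le_trans:
  assumes "asymp_le M X Y" "asymp_le M Y Z"
  shows "asymp_le M X Z"
  unfolding asymp_le_def
proof (intro allI impI)
  fix e :: real assume "0 < e"
  note half = half_gt_zero[OF \<open>0 < e\<close>]
  show "(\<lambda>k. outer_prob M {\<omega> \<in> space M. Z k \<omega> + e < X k \<omega>}) \<longlonglongrightarrow> 0"
    by (rule outer_prob_tendsto_0_mono[OF always_eventually
          outer_prob_tendsto_0_Un[OF asymp_leD[OF assms(1) half] asymp_leD[OF assms(2) half]]]) force
qed

lemma asymp_le_add:
  assumes "asymp_le M X Y" "asymp_le M X' Y'"
  shows "asymp_le M (\<lambda>k \<omega>. X k \<omega> + X' k \<omega>) (\<lambda>k \<omega>. Y k \<omega> + Y' k \<omega>)"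
  unfolding asymp_le_def
proof (intro allI impI)
  fix e :: real assume "0 < e"
  note half = half_gt_zero[OF \<open>0 < e\<close>]
  show "(\<lambda>k. outer_prob M {\<omega> \<in> space M. Y k \<omega> + Y' k \<omega> + e < X k \<omega> + X' k \<omega>}) \<longlonglongrightarrow> 0"
    by (rule outer_prob_tendsto_0_mono[OF always_eventually
          outer_prob_tendsto_0_Un[OF asymp_leD[OF assms(1) half] asymp_leD[OF assms(2) half]]]) force
qed

lemma asymp_le_0I:
  assumes le: "\<forall>\<^sub>F k in sequentially. \<forall>\<omega>\<in>space M. X k \<omega> \<le> \<bar>Y k \<omega>\<bar>"
    and lim: "\<And>e. 0 < e \<Longrightarrow> (\<lambda>k. outer_prob M {\<omega> \<in> space M. e < \<bar>Y k \<omega>\<bar>}) \<longlonglongrightarrow> 0"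
  shows "asymp_le M X (\<lambda>_ _. 0)"
  unfolding asymp_le_def
proof (intro allI impI)
  fix e :: real assume "0 < e"
  show "(\<lambda>k. outer_prob M {\<omega> \<in> space M. 0 + e < X k \<omega>}) \<longlonglongrightarrow> 0"
    by (rule outer_prob_tendsto_0_mono[OF _ lim[OF \<open>0 < e\<close>]]) (use le in \<open>eventually_elim, fastforce\<close>)
qed

lemma outer_exp_asymp_close:
  assumes bdd: "\<And>k \<omega>. \<omega> \<in> space M \<Longrightarrow> \<bar>f k \<omega>\<bar> \<le> K" "\<And>k \<omega>. \<omega> \<in> space M \<Longrightarrow> \<bar>g k \<omega>\<bar> \<le> K"
    and close: "\<And>\<eta>. 0 < \<eta> \<Longrightarrow> (\<lambda>k. outer_prob M {\<omega> \<in> space M. \<eta> < \<bar>f k \<omega> - g k \<omega>\<bar>}) \<longlonglongrightarrow> 0"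
  shows "(\<lambda>k. outer_exp M (f k) - outer_exp M (g k)) \<longlonglongrightarrow> 0"
proof (rule tendstoI)
  fix e :: real assume "0 < e"
  have "0 \<le> K"
    using bdd(1) not_empty abs_ge_zero order_trans by (metis ex_in_conv)
  define \<eta> where "\<eta> = e / (2 * (1 + 2 * K))"
  have \<eta>: "0 < \<eta>" "\<eta> + 2 * K * \<eta> < e"
  proof -
    show "0 < \<eta>"
      using \<open>0 < e\<close> \<open>0 \<le> K\<close> by (simp add: \<eta>_def)
    have "\<eta> + 2 * K * \<eta> = (1 + 2 * K) * \<eta>"
      by (simp add: algebra_simps)
    also have "\<dots> = e / 2"
      using \<open>0 \<le> K\<close> by (simp add: \<eta>_def divide_simps)
    finally show "\<eta> + 2 * K * \<eta> < e"
      using \<open>0 < e\<close> by linarith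
  qed
  have "\<forall>\<^sub>F k in sequentially. outer_prob M {\<omega> \<in> space M. \<eta> < \<bar>f k \<omega> - g k \<omega>\<bar>} < \<eta>"
    using close \<eta>(1) by (intro order_tendstoD(2)) auto
  then show "\<forall>\<^sub>F k in sequentially. dist (outer_exp M (f k) - outer_exp M (g k)) 0 < e"
  proof eventually_elim
    case (elim k)
    then obtain B where B: "B \<in> sets M" "{\<omega> \<in> space M. \<eta> < \<bar>f k \<omega> - g k \<omega>\<bar>} \<inter> space M \<subseteq> B" "measure M B < \<eta>"
      using outer_prob_coverE by blast
    have off: "f k \<omega> \<le> g k \<omega> + \<eta>" "g k \<omega> \<le> f k \<omega> + \<eta>" if "\<omega> \<in> space M - B" for \<omega>
      using B(2) that by (auto simp: subset_iff not_less abs_le_iff)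
    have "outer_exp M (f k) \<le> outer_exp M (g k) + \<eta> + 2 * K * measure M B"
      "outer_exp M (g k) \<le> outer_exp M (f k) + \<eta> + 2 * K * measure M B"
      using \<eta>(1) off by (auto intro!: outer_exp_le_off_set[OF bdd(1,2) B(1)]
        outer_exp_le_off_set[OF bdd(2,1) B(1)])
    then have "\<bar>outer_exp M (f k) - outer_exp M (g k)\<bar> \<le> \<eta> + 2 * K * measure M B"
      by linarith
    also have "\<dots> \<le> \<eta> + 2 * K * \<eta>"
      using B(3) \<open>0 \<le> K\<close> by (intro add_left_mono mult_left_mono) auto
    finally show ?case
      using \<eta>(2) by simp
  qed
qed

lemma continuous_asymp_close:
  fixes X Y :: "nat \<Rightarrow> 'a \<Rightarrow> real" and h :: "real \<Rightarrow> real"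
  assumes h: "continuous_on UNIV h"
    and tight: "\<And>\<eta>. 0 < \<eta> \<Longrightarrow> \<exists>R. \<forall>\<^sub>F k in sequentially. outer_prob M {\<omega> \<in> space M. R \<le> \<bar>Y k \<omega>\<bar>} < \<eta>"
    and close: "\<And>e. 0 < e \<Longrightarrow> (\<lambda>k. outer_prob M {\<omega> \<in> space M. e < \<bar>X k \<omega> - Y k \<omega>\<bar>}) \<longlonglongrightarrow> 0"
    and e: "0 < e"
  shows "(\<lambda>k. outer_prob M {\<omega> \<in> space M. e < \<bar>h (X k \<omega>) - h (Y k \<omega>)\<bar>}) \<longlonglongrightarrow> 0"
proof (rule outer_prob_tendsto_0I)
  fix \<eta> :: real assume "0 < \<eta>"
  then obtain R where R: "\<forall>\<^sub>F k in sequentially. outer_prob M {\<omega> \<in> space M. R \<le> \<bar>Y k \<omega>\<bar>} < \<eta> / 2"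
    using tight[of "\<eta> / 2"] by auto
  define I where "I = {- R - 1..R + 1}"
  have "uniformly_continuous_on I h"
    unfolding I_def by (intro compact_uniformly_continuous continuous_on_subset[OF h]) auto
  then obtain \<delta> where \<delta>: "0 < \<delta>" "\<And>s t. s \<in> I \<Longrightarrow> t \<in> I \<Longrightarrow> \<bar>s - t\<bar> < \<delta> \<Longrightarrow> \<bar>h s - h t\<bar> < e"
    using e unfolding uniformly_continuous_on_def dist_real_def by blast
  define \<delta>' where "\<delta>' = min (\<delta> / 2) (1 / 2)"
  have \<delta>': "0 < \<delta>'" "\<delta>' < \<delta>" "\<delta>' < 1"
    using \<delta>(1) by (auto simp: \<delta>'_def)
  have "\<forall>\<^sub>F k in sequentially. outer_prob M {\<omega> \<in> space M. \<delta>' < \<bar>X k \<omega> - Y k \<omega>\<bar>} < \<eta> / 2"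
    using close[OF \<delta>'(1)] \<open>0 < \<eta>\<close> by (intro order_tendstoD(2)) auto
  moreover have "{\<omega> \<in> space M. e < \<bar>h (X k \<omega>) - h (Y k \<omega>)\<bar>} \<inter> space M
      \<subseteq> {\<omega> \<in> space M. R \<le> \<bar>Y k \<omega>\<bar>} \<union> {\<omega> \<in> space M. \<delta>' < \<bar>X k \<omega> - Y k \<omega>\<bar>}" for k
  proof -
    have "\<bar>h s - h t\<bar> < e" if "\<bar>t\<bar> < R" "\<bar>s - t\<bar> \<le> \<delta>'" for s t
      using that \<delta>' by (intro \<delta>(2)) (auto simp: I_def abs_le_iff abs_less_iff)
    then show ?thesis
      by (force simp: not_le not_less)
  qed
  ultimately show "\<forall>\<^sub>F k in sequentially. outer_prob M {\<omega> \<in> space M. e < \<bar>h (X k \<omega>) - h (Y k \<omega>)\<bar>} < \<eta>"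
    by (rule outer_prob_less_Un[OF R])
qed

end

section \<open>Weak convergence in pseudometric spaces\<close>

lemma pm_cont_compose:
  assumes "pm_cont d D h" "continuous_on UNIV (g :: real \<Rightarrow> real)"
  shows "pm_cont d D (\<lambda>x. g (h x))"
  unfolding pm_cont_def
proof (intro ballI allI impI)
  fix x e assume x: "x \<in> D" and "(0::real) < e"
  then obtain s where s: "0 < s" "\<And>t. \<bar>t - h x\<bar> < s \<Longrightarrow> \<bar>g t - g (h x)\<bar> < e"
    using assms(2) unfolding continuous_on_iff dist_real_def by (metis UNIV_I)
  obtain d' where "d' > 0" "\<forall>y\<in>D. d x y < d' \<longrightarrow> \<bar>h y - h x\<bar> < s"
    using assms(1) x s(1) unfolding pm_cont_def by blast
  then show "\<exists>d'>0. \<forall>y\<in>D. d x y < d' \<longrightarrow> \<bar>g (h y) - g (h x)\<bar> < e"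
    using s(2) by blast
qed

lemma pm_cont_add:
  assumes "pm_cont d D h" "pm_cont d D k"
  shows "pm_cont d D (\<lambda>x. h x + k x)"
  unfolding pm_cont_def
proof (intro ballI allI impI)
  fix x e assume x: "x \<in> D" and "(0::real) < e"
  note half = half_gt_zero[OF \<open>0 < e\<close>]
  obtain d1 where d1: "d1 > 0" "\<forall>y\<in>D. d x y < d1 \<longrightarrow> \<bar>h y - h x\<bar> < e / 2"
    using assms(1) x half unfolding pm_cont_def by blast
  obtain d2 where d2: "d2 > 0" "\<forall>y\<in>D. d x y < d2 \<longrightarrow> \<bar>k y - k x\<bar> < e / 2"
    using assms(2) x half unfolding pm_cont_def by blast
  have "\<bar>h y + k y - (h x + k x)\<bar> < e" if "y \<in> D" "d x y < min d1 d2" for y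
  proof -
    have "\<bar>h y - h x\<bar> < e / 2" "\<bar>k y - k x\<bar> < e / 2"
      using that d1 d2 by auto
    then show ?thesis
      by linarith
  qed
  then show "\<exists>d'>0. \<forall>y\<in>D. d x y < d' \<longrightarrow> \<bar>h y + k y - (h x + k x)\<bar> < e"
    using d1 d2 by (intro exI[of _ "min d1 d2"]) auto
qed

lemma pm_cont_diff:
  assumes "pm_cont d D h" "pm_cont d D k"
  shows "pm_cont d D (\<lambda>x. h x - k x)"
proof -
  have "pm_cont d D (\<lambda>x. - k x)"
    using assms(2) by (rule pm_cont_compose) (intro continuous_intros)
  from pm_cont_add[OF assms(1) this] show ?thesis
    by simp
qed

lemma pm_cont_Lipschitz:
  assumes "0 \<le> K" "\<And>x y. x \<in> D \<Longrightarrow> y \<in> D \<Longrightarrow> \<bar>h y - h x\<bar> \<le> K * d x y"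
  shows "pm_cont d D h"
  unfolding pm_cont_def
proof (intro ballI allI impI)
  fix x e assume x: "x \<in> D" and e: "(0::real) < e"
  have "\<bar>h y - h x\<bar> < e" if y: "y \<in> D" "d x y < e / (K + 1)" for y
  proof -
    have "\<bar>h y - h x\<bar> \<le> K * d x y"
      using assms(2) x y(1) by blast
    also have "K * d x y \<le> K * (e / (K + 1))"
      using y(2) assms(1) by (intro mult_left_mono) auto
    also have "\<dots> < e"
      using assms(1) e by (simp add: divide_less_eq algebra_simps)
    finally show ?thesis .
  qed
  then show "\<exists>d'>0. \<forall>y\<in>D. d x y < d' \<longrightarrow> \<bar>h y - h x\<bar> < e"
    using e assms(1) by (intro exI[of _ "e / (K + 1)"]) auto
qed

lemma pm_cont_dist_iff: "pm_cont dist UNIV h \<longleftrightarrow> continuous_on UNIV (h :: real \<Rightarrow> real)"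
  by (simp add: pm_cont_def continuous_on_iff dist_real_def abs_minus_commute)

lemma pm_open_dist_iff: "pm_open dist UNIV U \<longleftrightarrow> open (U :: real set)"
  by (simp add: pm_open_def open_dist dist_commute)

lemma borel_measurable_pm_cont:
  assumes "borel_into Q d D L" "pm_cont d D h"
  shows "(\<lambda>q. h (L q)) \<in> borel_measurable Q"
proof (rule borel_measurableI)
  fix S :: "real set" assume S: "open S"
  have "pm_open d D {x \<in> D. h x \<in> S}"
    unfolding pm_open_def
  proof (intro conjI ballI)
    fix x assume x: "x \<in> {x \<in> D. h x \<in> S}"
    then obtain e where e: "e > 0" "\<And>t. dist t (h x) < e \<Longrightarrow> t \<in> S"
      using S unfolding open_dist by blast
    then obtain d' where "d' > 0" "\<forall>y\<in>D. d x y < d' \<longrightarrow> \<bar>h y - h x\<bar> < e"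
      using assms(2) x unfolding pm_cont_def by blast
    then show "\<exists>e>0. \<forall>y\<in>D. d x y < e \<longrightarrow> y \<in> {x \<in> D. h x \<in> S}"
      using e(2) by (auto simp: dist_real_def)
  qed auto
  then have "{q \<in> space Q. L q \<in> {x \<in> D. h x \<in> S}} \<in> sets Q"
    using assms(1) unfolding borel_into_def by blast
  also have "{q \<in> space Q. L q \<in> {x \<in> D. h x \<in> S}} = (\<lambda>q. h (L q)) -` S \<inter> space Q"
    using assms(1) unfolding borel_into_def by auto
  finally show "(\<lambda>q. h (L q)) -` S \<inter> space Q \<in> sets Q" .
qed

lemma HJ_conv_lim:
  assumes "HJ_conv P Z d D Q L" "pm_cont d D h" "\<And>x. x \<in> D \<Longrightarrow> \<bar>h x\<bar> \<le> K"
  shows "(\<lambda>k. outer_exp P (\<lambda>\<omega>. h (Z k \<omega>))) \<longlonglongrightarrow> integral\<^sup>L Q (\<lambda>q. h (L q))"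
  using assms unfolding HJ_conv_def by blast

lemma HJ_conv_in:
  assumes "HJ_conv P Z d D Q L"
  shows "\<omega> \<in> space P \<Longrightarrow> Z k \<omega> \<in> D" "q \<in> space Q \<Longrightarrow> L q \<in> D"
  using assms unfolding HJ_conv_def borel_into_def by auto

lemma HJ_conv_measurable:
  assumes "HJ_conv P Z d D Q L" "pm_cont d D h"
  shows "(\<lambda>q. h (L q)) \<in> borel_measurable Q"
  using assms borel_measurable_pm_cont unfolding HJ_conv_def by blast

lemma HJ_conv_vanishing:
  assumes P: "prob_space P" and Q: "prob_space Q" and HJ: "HJ_conv P Z d D Q L"
    and \<psi>: "\<And>j. pm_cont d D (\<psi> j)" and lim: "AE q in Q. (\<lambda>j::nat. \<psi> j (L q)) \<longlonglongrightarrow> 0"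
    and e: "0 < e" and \<eta>: "0 < \<eta>"
  obtains j where "\<forall>\<^sub>F k in sequentially. outer_prob P {\<omega> \<in> space P. e \<le> \<bar>\<psi> j (Z k \<omega>)\<bar>} < \<eta>"
proof -
  interpret P: prob_space P by (rule P)
  interpret Q: prob_space Q by (rule Q)
  define \<zeta> where "\<zeta> j x = min 1 (\<bar>\<psi> j x\<bar> / e)" for j x
  have \<zeta>: "pm_cont d D (\<zeta> j)" for j
    unfolding \<zeta>_def by (rule pm_cont_compose[OF \<psi>]) (intro continuous_intros; use e in simp)
  have \<zeta>_bounds: "0 \<le> \<zeta> j x \<and> \<zeta> j x \<le> 1" for j x
    using e by (auto simp: \<zeta>_def)
  have "(\<lambda>j. integral\<^sup>L Q (\<lambda>q. \<zeta> j (L q))) \<longlonglongrightarrow> integral\<^sup>L Q (\<lambda>q. 0)"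
  proof (rule integral_dominated_convergence[where w = "\<lambda>_. 1"])
    show "(\<lambda>q. \<zeta> j (L q)) \<in> borel_measurable Q" for j
      by (rule HJ_conv_measurable[OF HJ \<zeta>])
    show "AE q in Q. (\<lambda>j. \<zeta> j (L q)) \<longlonglongrightarrow> 0"
      using lim
    proof eventually_elim
      case (elim q)
      have "(\<lambda>j. min 1 (\<bar>\<psi> j (L q)\<bar> / e)) \<longlonglongrightarrow> min 1 (\<bar>0\<bar> / e)"
        by (intro tendsto_intros elim) (use e in simp)
      then show ?case
        by (simp add: \<zeta>_def)
    qed
  qed (use \<zeta>_bounds in auto)
  then have "\<forall>\<^sub>F j in sequentially. integral\<^sup>L Q (\<lambda>q. \<zeta> j (L q)) < \<eta>"
    using \<eta> by (intro order_tendstoD(2)) auto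
  then obtain j where "integral\<^sup>L Q (\<lambda>q. \<zeta> j (L q)) < \<eta>"
    using eventually_happens'[OF sequentially_bot] by blast
  then have "\<forall>\<^sub>F k in sequentially. outer_exp P (\<lambda>\<omega>. \<zeta> j (Z k \<omega>)) < \<eta>"
    using \<zeta>_bounds by (intro order_tendstoD(2)[OF HJ_conv_lim[OF HJ \<zeta>, of _ 1]]) auto
  then have "\<forall>\<^sub>F k in sequentially. outer_prob P {\<omega> \<in> space P. 1 \<le> \<zeta> j (Z k \<omega>)} < \<eta>"
  proof eventually_elim
    case (elim k)
    then show ?case
      using P.outer_prob_Markov[of "\<lambda>\<omega>. \<zeta> j (Z k \<omega>)" 1 1] \<zeta>_bounds by auto
  qed
  moreover have "1 \<le> \<zeta> j x \<longleftrightarrow> e \<le> \<bar>\<psi> j x\<bar>" for x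
    using e by (simp add: \<zeta>_def le_divide_eq)
  ultimately show thesis
    using that[of j] by simp
qed

lemma HJ_conv_asymp_bounded:
  assumes P: "prob_space P" and Q: "prob_space Q" and HJ: "HJ_conv P Z d D Q L"
    and g: "pm_cont d D g" and \<eta>: "0 < \<eta>"
  obtains R where "\<forall>\<^sub>F k in sequentially. outer_prob P {\<omega> \<in> space P. R \<le> \<bar>g (Z k \<omega>)\<bar>} < \<eta>"
proof -
  have \<psi>: "pm_cont d D (\<lambda>x. g x / real (Suc j))" for j
    by (rule pm_cont_compose[OF g]) (intro continuous_intros; simp)
  have lim: "AE q in Q. (\<lambda>j. g (L q) / real (Suc j)) \<longlonglongrightarrow> 0"
    by (intro AE_I2 LIMSEQ_Suc[OF lim_const_over_n])
  obtain j where "\<forall>\<^sub>F k in sequentially. outer_prob P {\<omega> \<in> space P. 1 \<le> \<bar>g (Z k \<omega>) / real (Suc j)\<bar>} < \<eta>"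
    using HJ_conv_vanishing[OF P Q HJ \<psi> lim zero_less_one \<eta>] by blast
  then show thesis
    using that[of "real (Suc j)"] by (simp add: le_divide_eq)
qed

lemma HJ_conv_outer_prob_exceeds_rate:
  assumes P: "prob_space P" and Q: "prob_space Q" and HJ: "HJ_conv P Z d D Q L"
    and g: "pm_cont d D g" and r: "filterlim r at_top sequentially"
  shows "(\<lambda>k. outer_prob P {\<omega> \<in> space P. r k < g (Z k \<omega>)}) \<longlonglongrightarrow> 0"
proof (rule prob_space.outer_prob_tendsto_0I[OF P])
  interpret P: prob_space P by (rule P)
  fix \<eta> :: real assume "0 < \<eta>"
  then obtain R where "\<forall>\<^sub>F k in sequentially. outer_prob P {\<omega> \<in> space P. R \<le> \<bar>g (Z k \<omega>)\<bar>} < \<eta>"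
    using HJ_conv_asymp_bounded[OF P Q HJ g] by blast
  moreover have "\<forall>\<^sub>F k in sequentially. R \<le> r k"
    using r by (simp add: filterlim_at_top)
  ultimately show "\<forall>\<^sub>F k in sequentially. outer_prob P {\<omega> \<in> space P. r k < g (Z k \<omega>)} < \<eta>"
  proof eventually_elim
    case (elim k)
    have "outer_prob P {\<omega> \<in> space P. r k < g (Z k \<omega>)} \<le> outer_prob P {\<omega> \<in> space P. R \<le> \<bar>g (Z k \<omega>)\<bar>}"
      using elim(2) by (intro P.outer_prob_mono) auto
    then show ?case
      using elim(1) by linarith
  qed
qed

lemma HJ_conv_continuous_mapping:
  assumes HJ: "HJ_conv P Z d D Q L" and \<phi>: "pm_cont d D \<phi>"
  shows "HJ_conv P (\<lambda>k \<omega>. \<phi> (Z k \<omega>)) dist UNIV Q (\<lambda>q. \<phi> (L q))"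
  unfolding HJ_conv_def
proof (intro conjI allI impI)
  show "borel_into Q dist UNIV (\<lambda>q. \<phi> (L q))"
    unfolding borel_into_def
  proof (intro conjI allI impI)
    fix U :: "real set" assume "pm_open dist UNIV U"
    then have "(\<lambda>q. \<phi> (L q)) -` U \<inter> space Q \<in> sets Q"
      using measurable_sets[OF HJ_conv_measurable[OF HJ \<phi>]] by (simp add: pm_open_dist_iff)
    also have "(\<lambda>q. \<phi> (L q)) -` U \<inter> space Q = {q \<in> space Q. \<phi> (L q) \<in> U}"
      by auto
    finally show "{q \<in> space Q. \<phi> (L q) \<in> U} \<in> sets Q" .
  qed simp
  fix h :: "real \<Rightarrow> real" assume "pm_cont dist UNIV h \<and> (\<exists>B. \<forall>x\<in>UNIV. \<bar>h x\<bar> \<le> B)"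
  then show "(\<lambda>k. outer_exp P (\<lambda>\<omega>. h (\<phi> (Z k \<omega>)))) \<longlonglongrightarrow> integral\<^sup>L Q (\<lambda>q. h (\<phi> (L q)))"
    using HJ_conv_lim[OF HJ pm_cont_compose[OF \<phi>]] by (auto simp: pm_cont_dist_iff)
qed auto

lemma HJ_conv_Slutsky:
  assumes P: "prob_space P" and Q: "prob_space Q" and Y: "HJ_conv P Y dist UNIV Q L"
    and close: "asymp_le P X Y" "asymp_le P Y X"
  shows "HJ_conv P X dist UNIV Q (L :: 'q \<Rightarrow> real)"
  unfolding HJ_conv_def
proof (intro conjI allI impI)
  interpret P: prob_space P by (rule P)
  show "borel_into Q dist UNIV L"
    using Y by (simp add: HJ_conv_def)
  fix h :: "real \<Rightarrow> real" assume "pm_cont dist UNIV h \<and> (\<exists>B. \<forall>x\<in>UNIV. \<bar>h x\<bar> \<le> B)"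
  then obtain K where h: "pm_cont dist UNIV h" and K: "\<And>x. \<bar>h x\<bar> \<le> K"
    by auto
  have id: "pm_cont dist UNIV (\<lambda>t::real. t)"
    by (simp add: pm_cont_dist_iff)
  have tight: "\<exists>R. \<forall>\<^sub>F k in sequentially. outer_prob P {\<omega> \<in> space P. R \<le> \<bar>Y k \<omega>\<bar>} < \<eta>" if "0 < \<eta>" for \<eta>
    using HJ_conv_asymp_bounded[OF P Q Y id that] by blast
  have diff: "(\<lambda>k. outer_prob P {\<omega> \<in> space P. e < \<bar>X k \<omega> - Y k \<omega>\<bar>}) \<longlonglongrightarrow> 0" if "0 < e" for e
    by (rule P.outer_prob_tendsto_0_mono[OF always_eventually
          P.outer_prob_tendsto_0_Un[OF asymp_leD[OF close(1) that] asymp_leD[OF close(2) that]]]) force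
  have "(\<lambda>k. outer_exp P (\<lambda>\<omega>. h (X k \<omega>)) - outer_exp P (\<lambda>\<omega>. h (Y k \<omega>))) \<longlonglongrightarrow> 0"
    by (rule P.outer_exp_asymp_close[OF K K
        P.continuous_asymp_close[OF h[unfolded pm_cont_dist_iff] tight diff]])
  from tendsto_add[OF this HJ_conv_lim[OF Y h, of K]] K
  show "(\<lambda>k. outer_exp P (\<lambda>\<omega>. h (X k \<omega>))) \<longlonglongrightarrow> integral\<^sup>L Q (\<lambda>q. h (L q))"
    by simp
qed auto

lemma asymp_le_if_vanishing_error:
  assumes P: "prob_space P" and Q: "prob_space Q" and HJ: "HJ_conv P Z d D Q L"
    and \<psi>: "\<And>j. pm_cont d D (\<psi> j)" and lim: "AE q in Q. (\<lambda>j::nat. \<psi> j (L q)) \<longlonglongrightarrow> 0"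
    and le: "\<And>j. asymp_le P X (\<lambda>k \<omega>. Y k \<omega> + \<psi> j (Z k \<omega>))"
  shows "asymp_le P X Y"
  unfolding asymp_le_def
proof (intro allI impI)
  interpret P: prob_space P by (rule P)
  fix e :: real assume "0 < e"
  show "(\<lambda>k. outer_prob P {\<omega> \<in> space P. Y k \<omega> + e < X k \<omega>}) \<longlonglongrightarrow> 0"
  proof (rule P.outer_prob_tendsto_0I)
    fix \<eta> :: real assume "0 < \<eta>"
    then obtain j where j: "\<forall>\<^sub>F k in sequentially. outer_prob P {\<omega> \<in> space P. e / 2 \<le> \<bar>\<psi> j (Z k \<omega>)\<bar>} < \<eta> / 2"
      using HJ_conv_vanishing[OF P Q HJ \<psi> lim, of "e / 2" "\<eta> / 2"] \<open>0 < e\<close> by auto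
    have "\<forall>\<^sub>F k in sequentially. outer_prob P {\<omega> \<in> space P. Y k \<omega> + \<psi> j (Z k \<omega>) + e / 2 < X k \<omega>} < \<eta> / 2"
      using asymp_leD[OF le, of "e / 2" j] \<open>0 < e\<close> \<open>0 < \<eta>\<close> by (intro order_tendstoD(2)[of _ 0]) auto
    then show "\<forall>\<^sub>F k in sequentially. outer_prob P {\<omega> \<in> space P. Y k \<omega> + e < X k \<omega>} < \<eta>"
      by (rule P.outer_prob_less_Un[OF j]) force
  qed
qed

theorem HJ_conv_sandwich:
  assumes P: "prob_space P" and Q: "prob_space Q" and HJ: "HJ_conv P Z d D Q L"
    and \<phi>: "pm_cont d D \<phi>" and up: "\<And>j. pm_cont d D (up j)" and lo: "\<And>j. pm_cont d D (lo j)"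
    and up_lim: "AE q in Q. (\<lambda>j::nat. up j (L q)) \<longlonglongrightarrow> \<phi> (L q)"
    and lo_lim: "AE q in Q. (\<lambda>j::nat. lo j (L q)) \<longlonglongrightarrow> \<phi> (L q)"
    and upper: "\<And>j. asymp_le P X (\<lambda>k \<omega>. up j (Z k \<omega>))"
    and lower: "\<And>j. asymp_le P (\<lambda>k \<omega>. lo j (Z k \<omega>)) X"
  shows "HJ_conv P X dist UNIV Q (\<lambda>q. \<phi> (L q))"
proof (rule HJ_conv_Slutsky[OF P Q HJ_conv_continuous_mapping[OF HJ \<phi>]])
  show "asymp_le P X (\<lambda>k \<omega>. \<phi> (Z k \<omega>))"
  proof (rule asymp_le_if_vanishing_error[OF P Q HJ, where \<psi> = "\<lambda>j x. up j x - \<phi> x"])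
    show "AE q in Q. (\<lambda>j. up j (L q) - \<phi> (L q)) \<longlonglongrightarrow> 0"
      using up_lim by eventually_elim (simp add: LIM_zero)
  qed (use pm_cont_diff[OF up \<phi>] upper in auto)
  show "asymp_le P (\<lambda>k \<omega>. \<phi> (Z k \<omega>)) X"
  proof (rule asymp_le_if_vanishing_error[OF P Q HJ, where \<psi> = "\<lambda>j x. \<phi> x - lo j x"])
    show "AE q in Q. (\<lambda>j. \<phi> (L q) - lo j (L q)) \<longlonglongrightarrow> 0"
      using lo_lim
    proof eventually_elim
      case (elim q)
      show ?case
        using tendsto_diff[OF tendsto_const elim, of "\<phi> (L q)"] by simp
    qed
    show "asymp_le P (\<lambda>k \<omega>. \<phi> (Z k \<omega>)) (\<lambda>k \<omega>. X k \<omega> + (\<phi> (Z k \<omega>) - lo j (Z k \<omega>)))" for j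
      using lower[of j] by (simp add: asymp_le_def algebra_simps)
  qed (rule pm_cont_diff[OF \<phi> lo])
qed

locale pseudometric_on =
  fixes D :: "'d set" and d :: "'d \<Rightarrow> 'd \<Rightarrow> real"
  assumes nonneg: "x \<in> D \<Longrightarrow> y \<in> D \<Longrightarrow> 0 \<le> d x y"
    and self: "x \<in> D \<Longrightarrow> d x x = 0"
    and sym: "d x y = d y x"
    and triangle: "x \<in> D \<Longrightarrow> y \<in> D \<Longrightarrow> z \<in> D \<Longrightarrow> d x z \<le> d x y + d y z"
begin

lemma abs_diff_le: "x \<in> D \<Longrightarrow> y \<in> D \<Longrightarrow> z \<in> D \<Longrightarrow> \<bar>d y z - d x z\<bar> \<le> d x y"
  using triangle[of x y z] triangle[of y x z] sym[of x y] by linarith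

lemma pm_cont_dist_to: "z \<in> D \<Longrightarrow> pm_cont d D (\<lambda>x. d x z)"
  using abs_diff_le by (intro pm_cont_Lipschitz[of 1]) auto

context
  fixes E assumes E: "E \<subseteq> D" "E \<noteq> {}"
begin

lemma bdd_below_dist: "x \<in> D \<Longrightarrow> bdd_below (d x ` E)"
  using nonneg E(1) by (intro bdd_belowI2[where m = 0]) auto

lemma pm_cont_INF_dist: "pm_cont d D (\<lambda>x. INF y\<in>E. d x y)"
proof (rule pm_cont_Lipschitz[of 1])
  fix x y assume xy: "x \<in> D" "y \<in> D"
  show "\<bar>(INF z\<in>E. d y z) - (INF z\<in>E. d x z)\<bar> \<le> 1 * d x y"
    using abs_diff_le[OF xy] E(1) by (intro abs_cINF_diff_le[OF E(2)] bdd_below_dist xy) auto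
qed simp

lemma INF_dist_nonneg: "x \<in> D \<Longrightarrow> 0 \<le> (INF y\<in>E. d x y)"
  using nonneg E by (intro cINF_greatest) auto

lemma INF_dist_mem: "x \<in> E \<Longrightarrow> (INF y\<in>E. d x y) = 0"
  using cINF_lower[OF bdd_below_dist, of x x] INF_dist_nonneg[of x] self[of x] E(1) by fastforce

lemma HJ_conv_limit_in_closed:
  assumes P: "prob_space P" and Q: "prob_space Q" and HJ: "HJ_conv P Z d D Q L"
    and ev: "\<forall>\<^sub>F k in sequentially. \<forall>\<omega>\<in>space P. Z k \<omega> \<in> E"
    and closed: "\<And>x. x \<in> D \<Longrightarrow> (\<And>e. 0 < e \<Longrightarrow> \<exists>y\<in>E. d x y < e) \<Longrightarrow> x \<in> E"
  shows "AE q in Q. L q \<in> E"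
proof -
  interpret P: prob_space P by (rule P)
  interpret Q: prob_space Q by (rule Q)
  define h where "h x = min 1 (INF y\<in>E. d x y)" for x
  have h: "pm_cont d D h"
    unfolding h_def by (rule pm_cont_compose[OF pm_cont_INF_dist]) (intro continuous_intros)
  have h_bounds: "0 \<le> h x" "\<bar>h x\<bar> \<le> 1" if "x \<in> D" for x
    using INF_dist_nonneg[OF that] by (auto simp: h_def)
  have h_nonneg: "AE q in Q. 0 \<le> h (L q)"
    using h_bounds(1) HJ_conv_in(2)[OF HJ] by (intro AE_I2) auto
  have "\<forall>\<^sub>F k in sequentially. outer_exp P (\<lambda>\<omega>. h (Z k \<omega>)) \<le> integral\<^sup>L P (\<lambda>_. 0)"
    using ev by eventually_elim (rule P.outer_exp_le[where K = 0]; simp add: h_def INF_dist_mem)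
  then have "integral\<^sup>L Q (\<lambda>q. h (L q)) \<le> 0"
    using tendsto_upperbound[OF HJ_conv_lim[OF HJ h h_bounds(2)]] by simp
  moreover have "integrable Q (\<lambda>q. h (L q))"
    using HJ_conv_measurable[OF HJ h] h_bounds(2) HJ_conv_in(2)[OF HJ]
    by (intro Q.integrable_const_bound[of _ 1]) auto
  ultimately have "AE q in Q. h (L q) = 0"
    using integral_nonneg_eq_0_iff_AE[OF _ h_nonneg] integral_nonneg_AE[OF h_nonneg] by fastforce
  with AE_space show ?thesis
  proof eventually_elim
    case (elim q)
    then have L: "L q \<in> D" "(INF y\<in>E. d (L q) y) = 0"
      using HJ_conv_in(2)[OF HJ] by (auto simp: h_def min_def split: if_splits)
    show ?case
      using closed[OF L(1)] cINF_less_iff[OF E(2) bdd_below_dist[OF L(1)]] L(2) by simp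
  qed
qed

end

end

section \<open>The product of function spaces carrying the estimation errors\<close>

abbreviation cost_part :: "('a \<times> 'b \<times> 'c) \<Rightarrow> 'c" where
  "cost_part z \<equiv> snd (snd z)"

lemma mem_D3_iff:
  "z \<in> D3 G1 G2 \<longleftrightarrow> bounded (fst z ` G1) \<and> bounded (fst (snd z) ` G2) \<and> continuous_on UNIV (cost_part z)"
  by (cases z) (simp add: D3_def)

lemma dist3_eq_max:
  "dist3 G1 G2 u v = max (SUP g\<in>G1. \<bar>fst u g - fst v g\<bar>)
     (max (SUP g\<in>G2. \<bar>fst (snd u) g - fst (snd v) g\<bar>) (SUP p. \<bar>cost_part u p - cost_part v p\<bar>))"
  by (simp add: dist3_def split: prod.splits)

lemma bdd_above_abs_diff:
  fixes a b :: "'a \<Rightarrow> real"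
  assumes "bounded (a ` G)" "bounded (b ` G)"
  shows "bdd_above ((\<lambda>g. \<bar>a g - b g\<bar>) ` G)"
proof -
  obtain K K' where "\<And>g. g \<in> G \<Longrightarrow> \<bar>a g\<bar> \<le> K" "\<And>g. g \<in> G \<Longrightarrow> \<bar>b g\<bar> \<le> K'"
    using assms by (auto simp: bounded_iff)
  then show ?thesis
    by (intro bdd_aboveI2[where M = "K + K'"]) (meson abs_triangle_ineq4 add_mono order_trans)
qed

locale nonempty_D3 =
  fixes G1 :: "('x::topological_space \<Rightarrow> real) set" and G2 :: "('y::topological_space \<Rightarrow> real) set"
  assumes compact_prod: "compact (UNIV :: ('x \<times> 'y) set)" and nonempty: "G1 \<noteq> {}" "G2 \<noteq> {}"
begin

lemma dist3_ge:
  assumes u: "u \<in> D3 G1 G2" and v: "v \<in> D3 G1 G2"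
  shows "g \<in> G1 \<Longrightarrow> \<bar>fst u g - fst v g\<bar> \<le> dist3 G1 G2 u v"
    and "h \<in> G2 \<Longrightarrow> \<bar>fst (snd u) h - fst (snd v) h\<bar> \<le> dist3 G1 G2 u v"
    and "\<bar>cost_part u p - cost_part v p\<bar> \<le> dist3 G1 G2 u v"
proof -
  have bdd: "bdd_above ((\<lambda>g. \<bar>fst u g - fst v g\<bar>) ` G1)"
    "bdd_above ((\<lambda>g. \<bar>fst (snd u) g - fst (snd v) g\<bar>) ` G2)"
    "bdd_above (range (\<lambda>p. \<bar>cost_part u p - cost_part v p\<bar>))"
    using u v by (auto intro!: bdd_above_abs_diff bounded_range_continuous[OF compact_prod] simp: mem_D3_iff)
  show "\<bar>fst u g - fst v g\<bar> \<le> dist3 G1 G2 u v" if "g \<in> G1"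
    using cSUP_upper[OF that bdd(1)] by (simp add: dist3_eq_max)
  show "\<bar>fst (snd u) h - fst (snd v) h\<bar> \<le> dist3 G1 G2 u v" if "h \<in> G2"
    using cSUP_upper[OF that bdd(2)] by (simp add: dist3_eq_max)
  show "\<bar>cost_part u p - cost_part v p\<bar> \<le> dist3 G1 G2 u v"
    using cSUP_upper[OF UNIV_I bdd(3), of p] by (simp add: dist3_eq_max)
qed

lemma dist3_le:
  assumes "\<And>g. g \<in> G1 \<Longrightarrow> \<bar>fst u g - fst v g\<bar> \<le> e" "\<And>h. h \<in> G2 \<Longrightarrow> \<bar>fst (snd u) h - fst (snd v) h\<bar> \<le> e"
    and "\<And>p. \<bar>cost_part u p - cost_part v p\<bar> \<le> e"
  shows "dist3 G1 G2 u v \<le> e"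
  unfolding dist3_eq_max using assms nonempty by (auto intro!: cSUP_least)

sublocale pseudometric_on "D3 G1 G2" "dist3 G1 G2"
proof
  show "0 \<le> dist3 G1 G2 u v" if "u \<in> D3 G1 G2" "v \<in> D3 G1 G2" for u v
    using dist3_ge(3)[OF that, of undefined] by linarith
  show "dist3 G1 G2 u u = 0" for u
    using nonempty by (simp add: dist3_eq_max)
  show "dist3 G1 G2 u v = dist3 G1 G2 v u" for u v
    by (simp add: dist3_eq_max abs_minus_commute)
  show "dist3 G1 G2 t v \<le> dist3 G1 G2 t u + dist3 G1 G2 u v"
    if t: "t \<in> D3 G1 G2" and u: "u \<in> D3 G1 G2" and v: "v \<in> D3 G1 G2" for t u v
  proof (rule dist3_le)
    show "\<bar>fst t g - fst v g\<bar> \<le> dist3 G1 G2 t u + dist3 G1 G2 u v" if "g \<in> G1" for g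
      using dist3_ge(1)[OF t u that] dist3_ge(1)[OF u v that] by linarith
    show "\<bar>fst (snd t) h - fst (snd v) h\<bar> \<le> dist3 G1 G2 t u + dist3 G1 G2 u v" if "h \<in> G2" for h
      using dist3_ge(2)[OF t u that] dist3_ge(2)[OF u v that] by linarith
    show "\<bar>cost_part t p - cost_part v p\<bar> \<le> dist3 G1 G2 t u + dist3 G1 G2 u v" for p
      using dist3_ge(3)[OF t u, of p] dist3_ge(3)[OF u v, of p] by linarith
  qed
qed

end

section \<open>The limit functional and its approximations\<close>

type_synonym ('x, 'y) ot_error = "(('x \<Rightarrow> real) \<Rightarrow> real) \<times> (('y \<Rightarrow> real) \<Rightarrow> real) \<times> ('x \<times> 'y \<Rightarrow> real)"

locale ot_problem = compact_cost c + \<mu>: borel_prob_space \<mu> + \<nu>: borel_prob_space \<nu>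
  for c :: "'x::metric_space \<times> 'y::metric_space \<Rightarrow> real" and \<mu> :: "'x measure" and \<nu> :: "'y measure" +
  fixes B :: real and W :: "real \<Rightarrow> real"
  assumes abs_cost_le: "\<bar>c p\<bar> \<le> B"
    and cost_modulus: "\<bar>c (x, y) - c (x', y)\<bar> \<le> W (dist x x')"
    and W_tendsto: "(W \<longlongrightarrow> 0) (at_right 0)"
begin

abbreviation F :: "('x \<Rightarrow> real) set" where "F \<equiv> Fclass B W"
abbreviation J :: "('x \<Rightarrow> real) \<Rightarrow> real" where "J \<equiv> dual_value \<mu> \<nu> c"
abbreviation opt_value :: real where "opt_value \<equiv> OT \<mu> \<nu> c"
abbreviation "D \<equiv> D3 (cctrans c ` F) (ctrans c ` F)"
abbreviation "dD \<equiv> dist3 (cctrans c ` F) (ctrans c ` F)"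

lemmas marginals_borel_prob_space = \<mu>.borel_prob_space_axioms \<nu>.borel_prob_space_axioms

lemma J_le_opt_value:
  assumes "f \<in> F"
  shows "J f \<le> opt_value"
proof -
  have "couplings \<mu> \<nu> \<noteq> {}"
    using opt_plans_nonempty[OF marginals_borel_prob_space] by (auto simp: opt_plans_def)
  then show ?thesis
    using weak_duality[OF _ Fclass_bounded[OF assms]] by (intro OT_ge) auto
qed

lemma J_attains_opt_value: "\<exists>f\<in>F. J f = opt_value"
proof -
  obtain \<pi> f where "\<pi> \<in> couplings \<mu> \<nu>" "f \<in> F" "integral\<^sup>L \<pi> c = J f"
    using Kantorovich_duality[OF marginals_borel_prob_space abs_cost_le cost_modulus W_tendsto]
    by blast
  then show ?thesis
    using dual_value_eq_imp_opt(2) Fclass_bounded by metis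
qed

lemma mem_Sc_iff: "f \<in> Sc F \<mu> \<nu> c \<longleftrightarrow> f \<in> F \<and> J f = opt_value"
proof -
  have "f \<in> Sc F \<mu> \<nu> c \<longleftrightarrow> f \<in> F \<and> (\<forall>g\<in>F. J g \<le> J f)"
    by (simp add: Sc_def dual_value_def)
  also have "\<dots> \<longleftrightarrow> f \<in> F \<and> J f = opt_value"
    using J_attains_opt_value J_le_opt_value by (metis antisym)
  finally show ?thesis .
qed

lemma F_nonempty: "F \<noteq> {}"
  using J_attains_opt_value by blast

lemma Sc_nonempty: "Sc F \<mu> \<nu> c \<noteq> {}"
  using J_attains_opt_value mem_Sc_iff by blast

lemma J_tendsto:
  assumes f: "\<And>n. f n \<in> F" "g \<in> F" and unif: "uniform_limit UNIV f g sequentially"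
  shows "(\<lambda>n. J (f n)) \<longlonglongrightarrow> J g"
  using dual_value_diff_tendsto_0[OF marginals_borel_prob_space Fclass_bounded[OF f(1)]
      Fclass_bounded[OF f(2)] unif] by (simp add: LIM_zero_iff)

lemma maximizing_sequence_convergent_subseq:
  assumes f: "\<And>n. f n \<in> F" and max: "(\<lambda>n. J (f n)) \<longlonglongrightarrow> opt_value"
  obtains r g where "strict_mono (r :: nat \<Rightarrow> nat)" "g \<in> Sc F \<mu> \<nu> c"
      "uniform_limit UNIV (\<lambda>n. f (r n)) g sequentially"
proof -
  obtain r g where r: "strict_mono (r :: nat \<Rightarrow> nat)" and g: "g \<in> F"
    and unif: "uniform_limit UNIV (\<lambda>n. f (r n)) g sequentially"
    using Fclass_convergent_subseq[where f = f, OF X_compact W_tendsto f] by blast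
  have "J g = opt_value"
    using LIMSEQ_unique[OF J_tendsto[OF f g unif]] LIMSEQ_subseq_LIMSEQ[OF max r] by (simp add: o_def)
  then show thesis
    using that r g unif mem_Sc_iff by blast
qed

sublocale D: nonempty_D3 "cctrans c ` F" "ctrans c ` F"
  by standard (use XY_compact F_nonempty in auto)

definition pairing :: "('x, 'y) ot_error \<Rightarrow> ('x \<Rightarrow> real) \<Rightarrow> real" where
  "pairing z f = fst z (cctrans c f) + fst (snd z) (ctrans c f)"

lemma cost_part_continuous: "z \<in> D \<Longrightarrow> continuous_on UNIV (cost_part z)"
  by (simp add: mem_D3_iff)

lemma bounded_cost_part: "z \<in> D \<Longrightarrow> bounded (range (cost_part z))"
  by (rule bounded_range_continuous[OF XY_compact cost_part_continuous])

lemma abs_pairing_diff_le: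
  assumes "z \<in> D" "z' \<in> D" "f \<in> F"
  shows "\<bar>pairing z f - pairing z' f\<bar> \<le> 2 * dD z z'"
  using D.dist3_ge(1)[OF assms(1,2) imageI[OF assms(3)]] D.dist3_ge(2)[OF assms(1,2) imageI[OF assms(3)]]
  unfolding pairing_def by linarith

definition zero_error :: "('x, 'y) ot_error" where
  "zero_error = (\<lambda>_. 0, \<lambda>_. 0, \<lambda>_. 0)"

definition error_size :: "('x, 'y) ot_error \<Rightarrow> real" where
  "error_size z = dD z zero_error"

lemma zero_error_in_D: "zero_error \<in> D"
  by (auto simp: mem_D3_iff zero_error_def bounded_iff)

lemma error_size_nonneg: "z \<in> D \<Longrightarrow> 0 \<le> error_size z"
  unfolding error_size_def by (rule D.nonneg[OF _ zero_error_in_D])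

lemma abs_error_size_diff_le: "z \<in> D \<Longrightarrow> z' \<in> D \<Longrightarrow> \<bar>error_size z - error_size z'\<bar> \<le> dD z z'"
  unfolding error_size_def using D.abs_diff_le[OF _ _ zero_error_in_D, of z' z] by (simp add: D.sym)

lemma abs_pairing_le: "z \<in> D \<Longrightarrow> f \<in> F \<Longrightarrow> \<bar>pairing z f\<bar> \<le> 2 * error_size z"
  using abs_pairing_diff_le[OF _ zero_error_in_D] by (simp add: error_size_def pairing_def zero_error_def)

lemma abs_cost_part_le: "z \<in> D \<Longrightarrow> \<bar>cost_part z p\<bar> \<le> error_size z"
  using D.dist3_ge(3)[OF _ zero_error_in_D] by (simp add: error_size_def zero_error_def)

definition continuous_errors :: "('x, 'y) ot_error set" where
  "continuous_errors = {z \<in> D. \<forall>f\<in>F. \<forall>e>0. \<exists>\<delta>>0. \<forall>g\<in>F. (\<forall>x. \<bar>f x - g x\<bar> \<le> \<delta>)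
      \<longrightarrow> \<bar>pairing z f - pairing z g\<bar> \<le> e}"

lemma continuous_errorsE:
  assumes "z \<in> continuous_errors" "f \<in> F" "0 < e"
  obtains \<delta> where "0 < \<delta>" "\<And>g. g \<in> F \<Longrightarrow> (\<And>x. \<bar>f x - g x\<bar> \<le> \<delta>) \<Longrightarrow> \<bar>pairing z f - pairing z g\<bar> \<le> e"
  using assms unfolding continuous_errors_def by blast

lemma zero_error_continuous: "zero_error \<in> continuous_errors"
  using zero_error_in_D by (auto simp: continuous_errors_def pairing_def zero_error_def intro: exI[of _ 1])

lemma continuous_errors_closed:
  assumes z: "z \<in> D" and approx: "\<And>e. 0 < e \<Longrightarrow> \<exists>z'\<in>continuous_errors. dD z z' < e"
  shows "z \<in> continuous_errors"
  unfolding continuous_errors_def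
proof (intro CollectI conjI z ballI allI impI)
  fix f and e :: real assume f: "f \<in> F" and "0 < e"
  then obtain z' where z': "z' \<in> continuous_errors" "dD z z' < e / 8"
    using approx[of "e / 8"] by auto
  then have "z' \<in> D"
    by (simp add: continuous_errors_def)
  obtain \<delta> where \<delta>: "0 < \<delta>"
    "\<And>g. g \<in> F \<Longrightarrow> (\<And>x. \<bar>f x - g x\<bar> \<le> \<delta>) \<Longrightarrow> \<bar>pairing z' f - pairing z' g\<bar> \<le> e / 2"
    using continuous_errorsE[OF z'(1) f half_gt_zero[OF \<open>0 < e\<close>]] by blast
  have "\<bar>pairing z f - pairing z g\<bar> \<le> e" if g: "g \<in> F" "\<forall>x. \<bar>f x - g x\<bar> \<le> \<delta>" for g
    using \<delta>(2)[OF g(1) g(2)[rule_format]] abs_pairing_diff_le[OF z \<open>z' \<in> D\<close> f]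
      abs_pairing_diff_le[OF z \<open>z' \<in> D\<close> g(1)] z'(2)
    by linarith
  then show "\<exists>\<delta>>0. \<forall>g\<in>F. (\<forall>x. \<bar>f x - g x\<bar> \<le> \<delta>) \<longrightarrow> \<bar>pairing z f - pairing z g\<bar> \<le> e"
    using \<delta>(1) by blast
qed

lemma pairing_tendsto:
  assumes z: "z \<in> continuous_errors" and f: "\<And>n. f n \<in> F" "g \<in> F"
    and unif: "uniform_limit UNIV f g sequentially"
  shows "(\<lambda>n. pairing z (f n)) \<longlonglongrightarrow> pairing z g"
proof (rule tendstoI)
  fix e :: real assume "0 < e"
  obtain \<delta> where \<delta>: "0 < \<delta>"
    "\<And>h. h \<in> F \<Longrightarrow> (\<And>x. \<bar>g x - h x\<bar> \<le> \<delta>) \<Longrightarrow> \<bar>pairing z g - pairing z h\<bar> \<le> e / 2"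
    using continuous_errorsE[OF z f(2) half_gt_zero[OF \<open>0 < e\<close>]] by blast
  from uniform_limitD[OF unif \<delta>(1)] show "\<forall>\<^sub>F n in sequentially. dist (pairing z (f n)) (pairing z g) < e"
  proof eventually_elim
    case (elim n)
    then have "\<bar>g x - f n x\<bar> \<le> \<delta>" for x
      by (simp add: dist_real_def abs_minus_commute less_imp_le)
    from \<delta>(2)[OF f(1) this] show ?case
      using \<open>0 < e\<close> by (simp add: dist_real_def abs_minus_commute)
  qed
qed

definition dual_sup :: "('x, 'y) ot_error \<Rightarrow> real" where
  "dual_sup z = (SUP f\<in>Sc F \<mu> \<nu> c. pairing z f)"

text \<open>\<open>s\<close> bounds the contribution of a cost perturbation at optimal potentials and the cruder \<open>t\<close> the
  one at arbitrary potentials, which pay for their suboptimality at the rate \<open>\<rho>\<close>.\<close>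

definition penalized_sup ::
    "real \<Rightarrow> real \<Rightarrow> real \<Rightarrow> ('x, 'y) ot_error \<Rightarrow> real" where
  "penalized_sup \<rho> s t z = (SUP f\<in>F. min s (t - \<rho> * (opt_value - J f)) + pairing z f)"

lemma bdd_above_dual_sup:
  assumes "z \<in> D"
  shows "bdd_above (pairing z ` Sc F \<mu> \<nu> c)"
proof (rule bdd_aboveI2)
  show "pairing z f \<le> 2 * error_size z" if "f \<in> Sc F \<mu> \<nu> c" for f
    using abs_pairing_le[OF assms, of f] that mem_Sc_iff by force
qed

lemma bdd_above_penalized_sup:
  assumes "z \<in> D"
  shows "bdd_above ((\<lambda>f. min s (t - \<rho> * (opt_value - J f)) + pairing z f) ` F)"
proof (rule bdd_aboveI2)
  show "min s (t - \<rho> * (opt_value - J f)) + pairing z f \<le> s + 2 * error_size z" if "f \<in> F" for f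
    using abs_pairing_le[OF assms that] by linarith
qed

lemma pairing_le_dual_sup: "z \<in> D \<Longrightarrow> f \<in> Sc F \<mu> \<nu> c \<Longrightarrow> pairing z f \<le> dual_sup z"
  unfolding dual_sup_def by (intro cSUP_upper bdd_above_dual_sup)

lemma dual_sup_le: "(\<And>f. f \<in> Sc F \<mu> \<nu> c \<Longrightarrow> pairing z f \<le> k) \<Longrightarrow> dual_sup z \<le> k"
  unfolding dual_sup_def by (rule cSUP_least[OF Sc_nonempty])

lemma penalized_sup_ge:
  assumes "z \<in> D" "f \<in> F" "v \<le> min s (t - \<rho> * (opt_value - J f))"
  shows "v + pairing z f \<le> penalized_sup \<rho> s t z"
proof -
  have "v + pairing z f \<le> min s (t - \<rho> * (opt_value - J f)) + pairing z f"
    using assms(3) by simp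
  also have "\<dots> \<le> penalized_sup \<rho> s t z"
    unfolding penalized_sup_def by (intro cSUP_upper bdd_above_penalized_sup assms)
  finally show ?thesis .
qed

lemma abs_dual_sup_diff_le:
  assumes "z \<in> D" "z' \<in> D"
  shows "\<bar>dual_sup z - dual_sup z'\<bar> \<le> 2 * dD z z'"
  unfolding dual_sup_def using abs_pairing_diff_le[OF assms]
  by (intro abs_cSUP_diff_le Sc_nonempty bdd_above_dual_sup assms) (auto simp: mem_Sc_iff)

lemma abs_penalized_sup_diff_le:
  assumes z: "z \<in> D" "z' \<in> D"
  shows "\<bar>penalized_sup \<rho> s t z - penalized_sup \<rho> s' t' z'\<bar> \<le> \<bar>s - s'\<bar> + \<bar>t - t'\<bar> + 2 * dD z z'"
  unfolding penalized_sup_def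
proof (rule abs_cSUP_diff_le[OF F_nonempty bdd_above_penalized_sup[OF z(1)] bdd_above_penalized_sup[OF z(2)]])
  fix f assume f: "f \<in> F"
  have "\<bar>min s (t - k) - min s' (t' - k)\<bar> \<le> \<bar>s - s'\<bar> + \<bar>t - t'\<bar>" for k
    by linarith
  then show "\<bar>min s (t - \<rho> * (opt_value - J f)) + pairing z f
      - (min s' (t' - \<rho> * (opt_value - J f)) + pairing z' f)\<bar>
      \<le> \<bar>s - s'\<bar> + \<bar>t - t'\<bar> + 2 * dD z z'"
    using abs_pairing_diff_le[OF z f] by (smt (verit, best))
qed

lemma penalized_sup_antimono:
  assumes "z \<in> D" "\<rho> \<le> \<rho>'"
  shows "penalized_sup \<rho>' s t z \<le> penalized_sup \<rho> s t z"
  unfolding penalized_sup_def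
proof (rule cSUP_mono[OF F_nonempty bdd_above_penalized_sup[OF assms(1)]])
  fix f assume f: "f \<in> F"
  have "\<rho> * (opt_value - J f) \<le> \<rho>' * (opt_value - J f)"
    using assms(2) J_le_opt_value[OF f] by (intro mult_right_mono) auto
  then show "\<exists>g\<in>F. min s (t - \<rho>' * (opt_value - J f)) + pairing z f \<le> min s (t - \<rho> * (opt_value - J g))
      + pairing z g"
    by (intro bexI[OF _ f]) linarith
qed

lemma dual_sup_le_penalized_sup:
  assumes "z \<in> D" "s \<le> t"
  shows "s + dual_sup z \<le> penalized_sup \<rho> s t z"
proof -
  have "dual_sup z \<le> penalized_sup \<rho> s t z - s"
  proof (rule dual_sup_le)
    fix f assume "f \<in> Sc F \<mu> \<nu> c"
    then show "pairing z f \<le> penalized_sup \<rho> s t z - s"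
      using penalized_sup_ge[OF assms(1), of f s s t \<rho>] assms(2)
      by (simp add: mem_Sc_iff le_diff_eq add.commute)
  qed
  then show ?thesis
    by linarith
qed

lemma penalized_maximizers_approach_opt_value:
  assumes z: "z \<in> D" and f: "\<And>j. f j \<in> F"
    and ge: "\<And>j. a \<le> min s (t - real j * (opt_value - J (f j))) + pairing z (f j)"
  shows "(\<lambda>j. J (f j)) \<longlonglongrightarrow> opt_value"
proof -
  have "norm (J (f j) - opt_value) \<le> (t - a + 2 * error_size z) / real j" if "1 \<le> j" for j
  proof -
    have "real j * (opt_value - J (f j)) \<le> t - a + 2 * error_size z"
      using ge[of j] abs_pairing_le[OF z f, of j] by linarith
    then show ?thesis
      using that J_le_opt_value[OF f, of j] by (simp add: le_divide_eq mult.commute)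
  qed
  then have "(\<lambda>j. J (f j) - opt_value) \<longlonglongrightarrow> 0"
    by (intro Lim_null_comparison[OF _ lim_const_over_n] eventually_sequentiallyI)
  then show ?thesis
    by (simp add: LIM_zero_iff)
qed

lemma penalized_sup_tendsto:
  assumes z: "z \<in> continuous_errors" and st: "s \<le> t"
  shows "(\<lambda>j. penalized_sup (real j) s t z) \<longlonglongrightarrow> s + dual_sup z"
proof -
  have zD: "z \<in> D"
    using z by (simp add: continuous_errors_def)
  have "(\<lambda>j. - penalized_sup (real j) s t z) \<longlonglongrightarrow> - (s + dual_sup z)"
  proof (rule increasing_LIMSEQ)
    show "- penalized_sup (real j) s t z \<le> - penalized_sup (real (Suc j)) s t z" for j
      using penalized_sup_antimono[OF zD] by simp
    show "- penalized_sup (real j) s t z \<le> - (s + dual_sup z)" for j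
      using dual_sup_le_penalized_sup[OF zD st, of "real j"] by linarith
    show "\<exists>j. - (s + dual_sup z) \<le> - penalized_sup (real j) s t z + e" if "0 < e" for e
    proof (rule ccontr)
      assume "\<not> ?thesis"
      then have "\<not> - (s + dual_sup z) \<le> - penalized_sup (real j) s t z + e" for j
        by blast
      then have "s + dual_sup z + e < penalized_sup (real j) s t z" for j
        by (simp add: not_le algebra_simps)
      then have "\<exists>f\<in>F. s + dual_sup z + e < min s (t - real j * (opt_value - J f)) + pairing z f" for j
        unfolding penalized_sup_def less_cSUP_iff[OF F_nonempty bdd_above_penalized_sup[OF zD]] .
      then obtain f where f: "f j \<in> F" "s + dual_sup z + e < min s (t - real j * (opt_value - J (f j)))
          + pairing z (f j)" for j
        by metis
      obtain r g where g: "g \<in> Sc F \<mu> \<nu> c" and unif: "uniform_limit UNIV (\<lambda>n. f (r n)) g sequentially"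
        using maximizing_sequence_convergent_subseq[OF f(1)
            penalized_maximizers_approach_opt_value[OF zD f(1) less_imp_le[OF f(2)]]] by blast
      have "dual_sup z + e \<le> pairing z (f (r n))" for n
        using f(2)[of "r n"] by linarith
      then have "dual_sup z + e \<le> pairing z g"
        using pairing_tendsto[OF z f(1) _ unif] g by (intro LIMSEQ_le_const) (auto simp: mem_Sc_iff)
      then show False
        using pairing_le_dual_sup[OF zD g] \<open>0 < e\<close> by linarith
    qed
  qed
  from tendsto_minus[OF this] show ?thesis
    by (simp add: add.commute)
qed

abbreviation "opt \<equiv> opt_plans \<mu> \<nu> c"
abbreviation "near_opt j \<equiv> near_opt_plans \<mu> \<nu> c (1 / real (Suc j))"

definition ot_derivative where
  "ot_derivative z = plan_inf opt (cost_part z) + dual_sup z"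

definition lower_approx where
  "lower_approx j z = plan_inf (near_opt j) (cost_part z) + dual_sup z"

definition upper_approx where
  "upper_approx j z = penalized_sup (real j) 0 0 z - plan_inf (near_opt j) (\<lambda>p. - cost_part z p)"

definition upper_approx_osc where
  "upper_approx_osc j z = penalized_sup (real j) (plan_inf opt (cost_part z)) (3 * error_size z) z
     + 4 * osc (1 / real (Suc j)) (cost_part z)"

lemma opt_nonempty: "opt \<noteq> {}"
  by (rule opt_plans_nonempty[OF marginals_borel_prob_space])

lemma near_opt_nonempty: "near_opt j \<noteq> {}"
  using opt_nonempty opt_plans_subset_near_opt_plans[of "1 / real (Suc j)" \<mu> \<nu> c] by auto

lemma abs_plan_inf_opt_diff_le:
  assumes "z \<in> D" "z' \<in> D"
  shows "\<bar>plan_inf opt (cost_part z) - plan_inf opt (cost_part z')\<bar> \<le> dD z z'"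
  by (rule abs_plan_inf_diff_le[OF opt_nonempty opt_plans_borel_prob_space])
    (use assms in \<open>auto intro: cost_part_continuous D.dist3_ge(3)\<close>)

lemma pm_cont_dual_sup: "pm_cont dD D dual_sup"
  using abs_dual_sup_diff_le by (intro pm_cont_Lipschitz[of 2]) (auto simp: abs_minus_commute)

lemma pm_cont_plan_inf:
  assumes "S \<noteq> {}" "\<And>\<pi>. \<pi> \<in> S \<Longrightarrow> borel_prob_space \<pi>"
  shows "pm_cont dD D (\<lambda>z. plan_inf S (cost_part z))"
    and "pm_cont dD D (\<lambda>z. plan_inf S (\<lambda>p. - cost_part z p))"
proof -
  have cont: "continuous_on UNIV (cost_part z)" "continuous_on UNIV (\<lambda>p. - cost_part z p)" if "z \<in> D" for z
    using cost_part_continuous[OF that] by (auto intro: continuous_intros)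
  have le: "\<bar>cost_part z' p - cost_part z p\<bar> \<le> dD z z'" "\<bar>- cost_part z' p - - cost_part z p\<bar> \<le> dD z z'"
    if "z \<in> D" "z' \<in> D" for z z' p
    using D.dist3_ge(3)[OF that, of p] by linarith+
  show "pm_cont dD D (\<lambda>z. plan_inf S (cost_part z))" "pm_cont dD D (\<lambda>z. plan_inf S (\<lambda>p. - cost_part z p))"
    using abs_plan_inf_diff_le[OF assms cont(1) cont(1) le(1)]
      abs_plan_inf_diff_le[OF assms cont(2) cont(2) le(2)]
    by (auto intro!: pm_cont_Lipschitz[of 1])
qed

lemma pm_cont_ot_derivative: "pm_cont dD D ot_derivative"
  unfolding ot_derivative_def[abs_def]
  by (intro pm_cont_add pm_cont_plan_inf pm_cont_dual_sup opt_nonempty opt_plans_borel_prob_space)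

lemma pm_cont_lower_approx: "pm_cont dD D (lower_approx j)"
  unfolding lower_approx_def[abs_def]
  by (intro pm_cont_add pm_cont_plan_inf pm_cont_dual_sup near_opt_nonempty near_opt_plans_borel_prob_space)

lemma pm_cont_upper_approx: "pm_cont dD D (upper_approx j)"
proof -
  have "pm_cont dD D (penalized_sup (real j) 0 0)"
    using abs_penalized_sup_diff_le[of _ _ "real j" 0 0 0 0]
    by (intro pm_cont_Lipschitz[of 2]) (auto simp: abs_minus_commute)
  then show ?thesis
    unfolding upper_approx_def[abs_def]
    by (intro pm_cont_diff pm_cont_plan_inf near_opt_nonempty near_opt_plans_borel_prob_space)
qed

lemma pm_cont_upper_approx_osc: "pm_cont dD D (upper_approx_osc j)"
proof (rule pm_cont_Lipschitz[of 14])
  fix z z' assume z: "z \<in> D" "z' \<in> D"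
  let ?s = "\<lambda>z. plan_inf opt (cost_part z)" and ?t = "\<lambda>z. 3 * error_size z" and ?\<delta> = "1 / real (Suc j)"
  have "\<bar>penalized_sup (real j) (?s z) (?t z) z - penalized_sup (real j) (?s z') (?t z') z'\<bar>
      \<le> \<bar>?s z - ?s z'\<bar> + \<bar>?t z - ?t z'\<bar> + 2 * dD z z'"
    by (rule abs_penalized_sup_diff_le[OF z])
  moreover have "\<bar>?t z - ?t z'\<bar> \<le> 3 * dD z z'"
    using abs_error_size_diff_le[OF z] by linarith
  moreover have "\<bar>osc ?\<delta> (cost_part z) - osc ?\<delta> (cost_part z')\<bar> \<le> 2 * dD z z'"
    by (intro abs_osc_diff_le bounded_cost_part z D.dist3_ge(3)) simp
  ultimately show "\<bar>upper_approx_osc j z' - upper_approx_osc j z\<bar> \<le> 14 * dD z z'"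
    using abs_plan_inf_opt_diff_le[OF z] unfolding upper_approx_osc_def by linarith
qed simp

lemma plan_inf_near_opt_tendsto:
  "continuous_on UNIV h \<Longrightarrow> (\<lambda>j. plan_inf (near_opt j) h) \<longlonglongrightarrow> plan_inf opt h"
  by (rule plan_inf_near_opt_plans_tendsto[OF marginals_borel_prob_space])

lemma lower_approx_tendsto:
  assumes "z \<in> D"
  shows "(\<lambda>j. lower_approx j z) \<longlonglongrightarrow> ot_derivative z"
  unfolding lower_approx_def ot_derivative_def
  by (intro tendsto_intros plan_inf_near_opt_tendsto cost_part_continuous assms)

lemma upper_approx_tendsto:
  assumes z: "z \<in> continuous_errors" and unique: "opt = {\<pi>}"
  shows "(\<lambda>j. upper_approx j z) \<longlonglongrightarrow> ot_derivative z"
proof -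
  have "z \<in> D"
    using z by (simp add: continuous_errors_def)
  then have "(\<lambda>j. penalized_sup (real j) 0 0 z - plan_inf (near_opt j) (\<lambda>p. - cost_part z p))
      \<longlonglongrightarrow> (0 + dual_sup z) - plan_inf opt (\<lambda>p. - cost_part z p)"
    by (intro tendsto_diff penalized_sup_tendsto z plan_inf_near_opt_tendsto continuous_intros
        cost_part_continuous) simp
  also have "plan_inf opt (\<lambda>p. - cost_part z p) = - plan_inf opt (cost_part z)"
    unfolding unique plan_inf_def by simp
  finally show ?thesis
    by (simp add: upper_approx_def ot_derivative_def add.commute)
qed

lemma upper_approx_osc_tendsto:
  assumes z: "z \<in> continuous_errors"
  shows "(\<lambda>j. upper_approx_osc j z) \<longlonglongrightarrow> ot_derivative z"
proof -
  have zD: "z \<in> D"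
    using z by (simp add: continuous_errors_def)
  interpret h: compact_cost "cost_part z"
    by standard (rule X_compact Y_compact cost_part_continuous[OF zD])+
  obtain \<pi> where \<pi>: "\<pi> \<in> opt"
    using opt_nonempty by blast
  have "plan_inf opt (cost_part z) \<le> integral\<^sup>L \<pi> (cost_part z)"
    by (rule plan_inf_le[OF cost_part_continuous[OF zD] opt_plans_borel_prob_space \<pi>])
  also have "\<dots> \<le> error_size z"
    using borel_prob_space.abs_integral_le[OF opt_plans_borel_prob_space[OF \<pi>] XY_compact
      cost_part_continuous[OF zD]
        abs_cost_part_le[OF zD]] by linarith
  finally have st: "plan_inf opt (cost_part z) \<le> 3 * error_size z"
    using error_size_nonneg[OF zD] by linarith
  have "filterlim (\<lambda>j. 1 / real (Suc j)) (at_right 0) sequentially"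
    unfolding filterlim_at using LIMSEQ_Suc[OF lim_1_over_n] by (auto intro: always_eventually)
  then have "(\<lambda>j. osc (1 / real (Suc j)) (cost_part z)) \<longlonglongrightarrow> 0"
    by (rule filterlim_compose[OF h.osc_tendsto_0])
  then have "(\<lambda>j. upper_approx_osc j z) \<longlonglongrightarrow> (plan_inf opt (cost_part z) + dual_sup z) + 4 * 0"
    unfolding upper_approx_osc_def by (intro tendsto_intros penalized_sup_tendsto z st)
  then show ?thesis
    by (simp add: ot_derivative_def)
qed

end

section \<open>Concave moduli of continuity and inf-convolution\<close>

lemma concave_modulusD:
  assumes "concave_modulus w"
  shows "w 0 = 0" "0 \<le> t \<Longrightarrow> 0 \<le> w t" "0 \<le> s \<Longrightarrow> s \<le> t \<Longrightarrow> w s \<le> w t" "concave_on {0..} w" "(w \<longlongrightarrow> 0) (at_right 0)"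
  using assms by (auto simp: concave_modulus_def intro: mono_onD)

lemma concave_modulus_scale:
  assumes "concave_modulus w" "0 \<le> a"
  shows "concave_modulus (\<lambda>t. a * w t)"
  using assms tendsto_mult_right_zero[of w "at_right 0" a]
  by (auto simp: concave_modulus_def intro!: concave_on_cmul mult_left_mono mono_onI dest: mono_onD)

lemma concave_modulus_subadditive:
  assumes w: "concave_modulus w" and "0 \<le> a" "0 \<le> b"
  shows "w (a + b) \<le> w a + w b"
proof (cases "a + b = 0")
  case True
  then show ?thesis
    using assms concave_modulusD(1)[OF w] by (simp add: add_nonneg_eq_0_iff)
next
  case False
  then have pos: "0 < a + b"
    using assms by linarith
  have chord: "t / (a + b) * w (a + b) \<le> w t" if t: "0 \<le> t" "t \<le> a + b" for t
  proof -
    have "(1 - t / (a + b)) * w 0 + t / (a + b) * w (a + b)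
        \<le> w ((1 - t / (a + b)) *\<^sub>R 0 + (t / (a + b)) *\<^sub>R (a + b))"
      using t pos by (intro concave_onD[OF concave_modulusD(4)[OF w]]) (auto simp: divide_le_eq)
    then show ?thesis
      using pos by (simp add: concave_modulusD(1)[OF w])
  qed
  have "w (a + b) = a / (a + b) * w (a + b) + b / (a + b) * w (a + b)"
    using pos by (simp flip: distrib_right add_divide_distrib)
  also have "\<dots> \<le> w a + w b"
    using chord[of a] chord[of b] assms by linarith
  finally show ?thesis .
qed

lemma concave_modulus_diff_le:
  assumes w: "concave_modulus w" and "0 \<le> s" "0 \<le> t"
  shows "\<bar>w s - w t\<bar> \<le> w \<bar>s - t\<bar>"
proof -
  have "w s \<le> w t + w \<bar>s - t\<bar>" if "0 \<le> s" "0 \<le> t" for s t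
  proof -
    have "w s \<le> w (t + \<bar>s - t\<bar>)"
      using that by (intro concave_modulusD(3)[OF w]) auto
    also have "\<dots> \<le> w t + w \<bar>s - t\<bar>"
      using that by (intro concave_modulus_subadditive[OF w]) auto
    finally show ?thesis .
  qed
  from this[of s t] this[of t s] show ?thesis
    using assms by (simp add: abs_le_iff abs_minus_commute)
qed

lemma concave_modulus_continuous:
  assumes w: "concave_modulus w"
  shows "continuous_on {0..} w"
  unfolding continuous_on_iff
proof (intro ballI allI impI)
  fix t e :: real assume t: "t \<in> {0..}" and "0 < e"
  then obtain d where d: "0 < d" "\<And>s. 0 < s \<Longrightarrow> s < d \<Longrightarrow> dist (w s) 0 < e"
    using tendstoD[OF concave_modulusD(5)[OF w]] unfolding eventually_at_right_field by auto
  have "dist (w s) (w t) < e" if s: "s \<in> {0..}" "dist s t < d" for s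
  proof (cases "s = t")
    case False
    then have "w \<bar>s - t\<bar> < e"
      using d(2)[of "\<bar>s - t\<bar>"] s(2) by (simp add: dist_real_def)
    then show ?thesis
      using concave_modulus_diff_le[OF w, of s t] s(1) t by (simp add: dist_real_def)
  qed (use \<open>0 < e\<close> in simp)
  then show "\<exists>d>0. \<forall>s\<in>{0..}. dist s t < d \<longrightarrow> dist (w s) (w t) < e"
    using d(1) by blast
qed

definition inf_convolution :: "(real \<Rightarrow> real) \<Rightarrow> ('x::metric_space \<times> 'y \<Rightarrow> real) \<Rightarrow> 'x \<times> 'y \<Rightarrow> real" where
  "inf_convolution k c p = (INF x. c (x, snd p) + k (dist x (fst p)))"

lemma inf_convolution_eq_ctrans:
  "inf_convolution k c = ctrans (\<lambda>(x, p). c (x, snd p) + k (dist x (fst p))) (\<lambda>_. 0)"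
  by (simp add: fun_eq_iff inf_convolution_def ctrans_def)

context compact_cost
begin

context
  fixes k :: "real \<Rightarrow> real"
  assumes k: "concave_modulus k"
begin

lemma inf_convolution_kernel: "compact_cost (\<lambda>(x, p). c (x, snd p) + k (dist x (fst p)))"
proof
  have "continuous_on UNIV (\<lambda>q :: 'x \<times> 'x \<times> 'y. c (fst q, snd (snd q)))"
    by (rule continuous_on_compose2[OF cost_continuous]) (auto intro!: continuous_intros)
  moreover have "continuous_on UNIV (\<lambda>q :: 'x \<times> 'x \<times> 'y. k (dist (fst q) (fst (snd q))))"
    by (rule continuous_on_compose2[OF concave_modulus_continuous[OF k]]) (auto intro!: continuous_intros)
  ultimately show "continuous_on UNIV (\<lambda>(x, p). c (x, snd p) + k (dist x (fst p)))"
    unfolding case_prod_beta by (rule continuous_on_add)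
qed (rule X_compact XY_compact)+

lemma compact_cost_inf_convolution: "compact_cost (inf_convolution k c)"
proof
  show "continuous_on UNIV (inf_convolution k c)"
    unfolding inf_convolution_eq_ctrans by (intro compact_cost.continuous_ctrans inf_convolution_kernel) simp
qed (rule X_compact Y_compact)+

lemma inf_convolution_le_translate: "inf_convolution k c (x, y) \<le> c (x', y) + k (dist x' x)"
  using ctrans_le[OF compact_cost.bounded_cost[OF inf_convolution_kernel], of "\<lambda>_. 0" "(x, y)" x']
  by (simp add: inf_convolution_eq_ctrans)

lemma inf_convolution_ge:
  assumes "\<And>x'. a \<le> c (x', y) + k (dist x' x)"
  shows "a \<le> inf_convolution k c (x, y)"
  unfolding inf_convolution_def using assms by (intro cINF_greatest) auto

lemma inf_convolution_le: "inf_convolution k c p \<le> c p"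
  using inf_convolution_le_translate[of "fst p" "snd p" "fst p"] by (simp add: concave_modulusD(1)[OF k])

lemma inf_convolution_modulus:
  "\<bar>inf_convolution k c (x, y) - inf_convolution k c (x', y)\<bar> \<le> k (dist x x')"
proof -
  have "inf_convolution k c (x, y) - k (dist x x') \<le> inf_convolution k c (x', y)" for x x'
  proof (rule inf_convolution_ge)
    fix u
    have "k (dist u x) \<le> k (dist u x' + dist x x')"
      by (rule concave_modulusD(3)[OF k]) (simp_all add: dist_triangle2)
    also have "\<dots> \<le> k (dist u x') + k (dist x x')"
      by (rule concave_modulus_subadditive[OF k]) simp_all
    finally show "inf_convolution k c (x, y) - k (dist x x') \<le> c (u, y) + k (dist u x')"
      using inf_convolution_le_translate[of x y u] by linarith
  qed
  from this[of x x'] this[of x' x] show ?thesis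
    by (simp add: abs_le_iff dist_commute)
qed

lemma abs_inf_convolution_le:
  assumes "\<And>p. \<bar>c p\<bar> \<le> C"
  shows "\<bar>inf_convolution k c (x, y)\<bar> \<le> C"
proof -
  have "- C \<le> inf_convolution k c (x, y)"
  proof (rule inf_convolution_ge)
    show "- C \<le> c (x', y) + k (dist x' x)" for x'
      using assms[of "(x', y)"] concave_modulusD(2)[OF k, of "dist x' x"] by auto
  qed
  then show ?thesis
    using inf_convolution_le[of "(x, y)"] assms[of "(x, y)"] by linarith
qed

lemma abs_inf_convolution_diff_le:
  assumes "\<And>x x' y. c (x, y) - c (x', y) \<le> e + k (dist x x')"
  shows "\<bar>inf_convolution k c (x, y) - c (x, y)\<bar> \<le> e"
proof -
  have "c (x, y) - e \<le> inf_convolution k c (x, y)"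
  proof (rule inf_convolution_ge)
    show "c (x, y) - e \<le> c (x', y) + k (dist x' x)" for x'
      using assms[of x y x'] by (simp add: dist_commute)
  qed
  then show ?thesis
    using inf_convolution_le[of "(x, y)"] by (simp add: abs_le_iff)
qed

end

end

section \<open>Bounds for one perturbed problem\<close>

context ot_problem
begin

definition scaled_error :: "real \<Rightarrow> 'x measure \<Rightarrow> 'y measure \<Rightarrow> ('x \<times> 'y \<Rightarrow> real) \<Rightarrow> ('x, 'y) ot_error" where
  "scaled_error r \<mu>' \<nu>' c' = (\<lambda>g. r * (integral\<^sup>L \<mu>' g - integral\<^sup>L \<mu> g),
     \<lambda>g. r * (integral\<^sup>L \<nu>' g - integral\<^sup>L \<nu> g), \<lambda>p. r * (c' p - c p))"

definition cc_deviation :: "'x measure \<Rightarrow> ('x \<times> 'y \<Rightarrow> real) \<Rightarrow> ('x \<Rightarrow> real) \<Rightarrow> real" where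
  "cc_deviation \<mu>' c' f = integral\<^sup>L \<mu>' (\<lambda>x. cctrans c' f x - cctrans c f x)
      - integral\<^sup>L \<mu> (\<lambda>x. cctrans c' f x - cctrans c f x)"

definition c_deviation :: "'y measure \<Rightarrow> ('x \<times> 'y \<Rightarrow> real) \<Rightarrow> ('x \<Rightarrow> real) \<Rightarrow> real" where
  "c_deviation \<nu>' c' f = integral\<^sup>L \<nu>' (\<lambda>y. ctrans c' f y - ctrans c f y)
      - integral\<^sup>L \<nu> (\<lambda>y. ctrans c' f y - ctrans c f y)"

lemma uniformly_bounded_transforms:
  obtains K where "\<And>f x. f \<in> F \<Longrightarrow> \<bar>cctrans c f x\<bar> \<le> K" "\<And>f y. f \<in> F \<Longrightarrow> \<bar>ctrans c f y\<bar> \<le> K"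
proof -
  obtain f0 where f0: "f0 \<in> F"
    using F_nonempty by blast
  obtain K1 K2 where K: "\<And>x. \<bar>cctrans c f0 x\<bar> \<le> K1" "\<And>y. \<bar>ctrans c f0 y\<bar> \<le> K2"
    using bounded_rangeE[OF bounded_cctrans[OF bounded_cost Fclass_bounded[OF f0]]]
      bounded_rangeE[OF bounded_ctrans[OF bounded_cost Fclass_bounded[OF f0]]] by metis
  have "\<bar>cctrans c f x\<bar> \<le> max K1 K2 + 4 * B \<and> \<bar>ctrans c f y\<bar> \<le> max K1 K2 + 4 * B" if f: "f \<in> F" for f x y
  proof -
    note bdd = bounded_cost Fclass_bounded[OF f] bounded_cost Fclass_bounded[OF f0]
    have "\<bar>f x - f0 x\<bar> \<le> 4 * B" for x
      using Fclass_abs_le[OF f, of x] Fclass_abs_le[OF f0, of x] by linarith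
    then have "\<bar>cctrans c f x - cctrans c f0 x\<bar> \<le> 2 * 0 + 4 * B" "\<bar>ctrans c f y - ctrans c f0 y\<bar> \<le> 0 + 4 * B"
      by (intro cctrans_diff_le bdd ctrans_diff_le; simp)+
    then show ?thesis
      using K(1)[of x] K(2)[of y] by linarith
  qed
  then show thesis
    using that by blast
qed

end

locale perturbed_ot = ot_problem c \<mu> \<nu> B W + \<mu>': borel_prob_space \<mu>' + \<nu>': borel_prob_space \<nu>'
    + c': compact_cost c'
  for c c' :: "'x::metric_space \<times> 'y::metric_space \<Rightarrow> real" and \<mu> \<mu>' :: "'x measure" and \<nu> \<nu>' :: "'y measure"
    and B :: real and W :: "real \<Rightarrow> real" +
  fixes r :: real
  assumes r_pos: "0 < r"
begin

abbreviation "z \<equiv> scaled_error r \<mu>' \<nu>' c'"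

lemmas perturbed_marginals_borel_prob_space = \<mu>'.borel_prob_space_axioms \<nu>'.borel_prob_space_axioms

lemma perturbed_cost_eq: "c' p = c p + cost_part z p / r"
  using r_pos by (simp add: scaled_error_def)

lemma pairing_scaled_error: "pairing z f = r * (dual_value \<mu>' \<nu>' c f - J f)"
  by (simp add: pairing_def scaled_error_def dual_value_def algebra_simps)

lemma scaled_error_in_D: "z \<in> D"
proof -
  obtain K where K: "\<And>f x. f \<in> F \<Longrightarrow> \<bar>cctrans c f x\<bar> \<le> K" "\<And>f y. f \<in> F \<Longrightarrow> \<bar>ctrans c f y\<bar> \<le> K"
    using uniformly_bounded_transforms by blast
  have scaled: "\<bar>r * (s - t)\<bar> \<le> r * (2 * K)" if "\<bar>s\<bar> \<le> K" "\<bar>t\<bar> \<le> K" for s t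
    using that r_pos by (simp add: abs_mult)
  have "\<bar>fst z (cctrans c f)\<bar> \<le> r * (2 * K)" "\<bar>fst (snd z) (ctrans c f)\<bar> \<le> r * (2 * K)" if f: "f \<in> F" for f
    unfolding scaled_error_def fst_conv snd_conv
    by (intro scaled \<mu>.abs_integral_le \<mu>'.abs_integral_le \<nu>.abs_integral_le \<nu>'.abs_integral_le X_compact
        Y_compact continuous_cctrans continuous_ctrans Fclass_bounded[OF f] K f)+
  then have "bounded (fst z ` cctrans c ` F)" "bounded (fst (snd z) ` ctrans c ` F)"
    by (auto simp: bounded_iff)
  moreover have "continuous_on UNIV (cost_part z)"
    unfolding scaled_error_def snd_conv by (intro continuous_intros cost_continuous c'.cost_continuous)
  ultimately show ?thesis
    by (simp add: mem_D3_iff)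
qed

lemma scaled_error_continuous: "z \<in> continuous_errors"
  unfolding continuous_errors_def
proof (intro CollectI conjI scaled_error_in_D ballI allI impI)
  fix f and e :: real assume f: "f \<in> F" and "0 < e"
  have "\<bar>pairing z f - pairing z g\<bar> \<le> e" if g: "g \<in> F" and fg: "\<And>x. \<bar>f x - g x\<bar> \<le> e / (4 * r)" for g
  proof -
    have diff: "\<bar>dual_value \<mu>1 \<nu>1 c f - dual_value \<mu>1 \<nu>1 c g\<bar> \<le> 3 * 0 + 2 * (e / (4 * r))"
      if "borel_prob_space \<mu>1" "borel_prob_space \<nu>1" for \<mu>1 \<nu>1
      by (intro dual_value_diff_le compact_cost_axioms that Fclass_bounded[OF f] Fclass_bounded[OF g] fg) simp
    have "\<bar>(dual_value \<mu>' \<nu>' c f - J f) - (dual_value \<mu>' \<nu>' c g - J g)\<bar> \<le> e / r"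
      using diff[OF marginals_borel_prob_space] diff[OF perturbed_marginals_borel_prob_space]
      by (simp add: abs_le_iff)
    then have "r * \<bar>(dual_value \<mu>' \<nu>' c f - J f) - (dual_value \<mu>' \<nu>' c g - J g)\<bar> \<le> r * (e / r)"
      using r_pos by (intro mult_left_mono) auto
    then show ?thesis
      using r_pos by (simp add: pairing_scaled_error abs_mult flip: right_diff_distrib)
  qed
  then show "\<exists>\<delta>>0. \<forall>g\<in>F. (\<forall>x. \<bar>f x - g x\<bar> \<le> \<delta>) \<longrightarrow> \<bar>pairing z f - pairing z g\<bar> \<le> e"
    using \<open>0 < e\<close> r_pos by (intro exI[of _ "e / (4 * r)"]) auto
qed

lemmas error_cost_continuous = cost_part_continuous[OF scaled_error_in_D]

lemma integral_perturbed_cost: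
  assumes "borel_prob_space \<pi>"
  shows "integral\<^sup>L \<pi> c' = integral\<^sup>L \<pi> c + integral\<^sup>L \<pi> (cost_part z) / r"
proof -
  interpret borel_prob_space \<pi> by (rule assms)
  have "integrable \<pi> c" "integrable \<pi> (cost_part z)"
    by (intro integrable_continuous XY_compact cost_continuous error_cost_continuous)+
  then show ?thesis
    by (subst perturbed_cost_eq[abs_def]) simp
qed

lemma abs_integral_error_cost_le:
  assumes "borel_prob_space \<pi>"
  shows "\<bar>integral\<^sup>L \<pi> (cost_part z)\<bar> \<le> error_size z"
  by (rule borel_prob_space.abs_integral_le[OF assms XY_compact error_cost_continuous
      abs_cost_part_le[OF scaled_error_in_D]])

lemma perturbed_marginals_duality:
  obtains \<pi> f where "\<pi> \<in> couplings \<mu>' \<nu>'" "f \<in> F" "integral\<^sup>L \<pi> c = J f + pairing z f / r"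
proof -
  obtain \<pi> f where "\<pi> \<in> couplings \<mu>' \<nu>'" "f \<in> F" "integral\<^sup>L \<pi> c = dual_value \<mu>' \<nu>' c f"
    using Kantorovich_duality[OF perturbed_marginals_borel_prob_space abs_cost_le cost_modulus W_tendsto]
    by blast
  then show thesis
    using that r_pos by (simp add: pairing_scaled_error)
qed

lemma perturbed_dual_value_le:
  assumes "f \<in> F"
  shows "J f + pairing z f / r \<le> opt_value + 2 * error_size z / r"
proof -
  have "pairing z f / r \<le> 2 * error_size z / r"
    using abs_pairing_le[OF scaled_error_in_D assms] r_pos by (intro divide_right_mono) auto
  then show ?thesis
    using J_le_opt_value[OF assms] by linarith
qed

context
  fixes e :: real
  assumes close: "BL_close e \<mu>' \<mu>" "BL_close e \<nu>' \<nu>" and small: "4 * error_size z / r \<le> e"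
begin

lemma perturbed_opt_plan_near_opt:
  assumes \<pi>: "\<pi> \<in> opt_plans \<mu>' \<nu>' c'"
  shows "\<pi> \<in> near_opt_plans \<mu> \<nu> c e"
proof -
  have \<pi>_coupling: "\<pi> \<in> couplings \<mu>' \<nu>'"
    using \<pi> by (simp add: opt_plans_def)
  obtain \<pi>0 f where \<pi>0: "\<pi>0 \<in> couplings \<mu>' \<nu>'" and f: "f \<in> F" "integral\<^sup>L \<pi>0 c = J f + pairing z f / r"
    using perturbed_marginals_duality by blast
  note prob = couplings_borel_prob_space(1)[OF \<pi>_coupling] couplings_borel_prob_space(1)[OF \<pi>0]
  have "integral\<^sup>L \<pi> c' \<le> integral\<^sup>L \<pi>0 c'"
    using c'.OT_le[OF \<pi>0] \<pi> by (simp add: opt_plans_def)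
  then have "integral\<^sup>L \<pi> c \<le> integral\<^sup>L \<pi>0 c
      + (integral\<^sup>L \<pi>0 (cost_part z) - integral\<^sup>L \<pi> (cost_part z)) / r"
    using prob by (simp add: integral_perturbed_cost diff_divide_distrib)
  also have "\<dots> \<le> (opt_value + 2 * error_size z / r) + 2 * error_size z / r"
    using perturbed_dual_value_le[OF f(1)] f(2) abs_integral_error_cost_le[OF prob(1)]
      abs_integral_error_cost_le[OF prob(2)] r_pos
    by (intro add_mono divide_right_mono) auto
  also have "\<dots> = opt_value + 4 * error_size z / r"
    by simp
  finally show ?thesis
    using coupling_in_near_opt_plans[OF \<pi>_coupling close] small by simp
qed

lemma perturbed_OT_ge:
  "plan_inf (near_opt_plans \<mu> \<nu> c e) (cost_part z) + dual_sup z \<le> r * (OT \<mu>' \<nu>' c' - opt_value)"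
proof -
  obtain \<pi> where \<pi>: "\<pi> \<in> opt_plans \<mu>' \<nu>' c'"
    using c'.opt_plans_nonempty[OF perturbed_marginals_borel_prob_space] by blast
  then have \<pi>_coupling: "\<pi> \<in> couplings \<mu>' \<nu>'" and opt: "integral\<^sup>L \<pi> c' = OT \<mu>' \<nu>' c'"
    by (auto simp: opt_plans_def)
  have value_eq: "r * (OT \<mu>' \<nu>' c' - opt_value) = r * (integral\<^sup>L \<pi> c - opt_value)
      + integral\<^sup>L \<pi> (cost_part z)"
    using integral_perturbed_cost[OF couplings_borel_prob_space(1)[OF \<pi>_coupling]] opt r_pos
    by (simp add: algebra_simps)
  have "dual_sup z \<le> r * (integral\<^sup>L \<pi> c - opt_value)"
  proof (rule dual_sup_le)
    fix f assume "f \<in> Sc F \<mu> \<nu> c"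
    then have f: "f \<in> F" "J f = opt_value"
      by (simp_all add: mem_Sc_iff)
    have "dual_value \<mu>' \<nu>' c f - opt_value \<le> integral\<^sup>L \<pi> c - opt_value"
      using weak_duality[OF \<pi>_coupling Fclass_bounded[OF f(1)]] by simp
    then show "pairing z f \<le> r * (integral\<^sup>L \<pi> c - opt_value)"
      using r_pos f(2) by (simp add: pairing_scaled_error mult_left_mono)
  qed
  moreover have "plan_inf (near_opt_plans \<mu> \<nu> c e) (cost_part z) \<le> integral\<^sup>L \<pi> (cost_part z)"
    by (rule plan_inf_le[OF error_cost_continuous near_opt_plans_borel_prob_space
        perturbed_opt_plan_near_opt[OF \<pi>]])
  ultimately show ?thesis
    using value_eq by linarith
qed

lemma perturbed_OT_le:
  assumes \<rho>: "\<rho> \<le> r"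
  shows "r * (OT \<mu>' \<nu>' c' - opt_value)
    \<le> penalized_sup \<rho> 0 0 z - plan_inf (near_opt_plans \<mu> \<nu> c e) (\<lambda>p. - cost_part z p)"
proof -
  obtain \<pi> f where \<pi>: "\<pi> \<in> couplings \<mu>' \<nu>'" and f: "f \<in> F" and eq: "integral\<^sup>L \<pi> c = J f + pairing z f / r"
    using perturbed_marginals_duality by blast
  have "integral\<^sup>L \<pi> c \<le> opt_value + 2 * error_size z / r" "0 \<le> 2 * error_size z / r"
    using perturbed_dual_value_le[OF f] eq error_size_nonneg[OF scaled_error_in_D] r_pos by auto
  then have "integral\<^sup>L \<pi> c \<le> opt_value + e"
    using small by simp
  then have "\<pi> \<in> near_opt_plans \<mu> \<nu> c e"
    by (rule coupling_in_near_opt_plans[OF \<pi> close])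
  then have "plan_inf (near_opt_plans \<mu> \<nu> c e) (\<lambda>p. - cost_part z p) \<le> integral\<^sup>L \<pi> (\<lambda>p. - cost_part z p)"
    by (intro plan_inf_le near_opt_plans_borel_prob_space continuous_intros error_cost_continuous)
  moreover have "r * (OT \<mu>' \<nu>' c' - opt_value) \<le> - (r * (opt_value - J f)) + pairing z f
      + integral\<^sup>L \<pi> (cost_part z)"
  proof -
    have "OT \<mu>' \<nu>' c' \<le> J f + pairing z f / r + integral\<^sup>L \<pi> (cost_part z) / r"
      using c'.OT_le[OF \<pi>] integral_perturbed_cost[OF couplings_borel_prob_space(1)[OF \<pi>]] eq by simp
    then have "r * OT \<mu>' \<nu>' c' \<le> r * (J f + pairing z f / r + integral\<^sup>L \<pi> (cost_part z) / r)"
      using r_pos by (intro mult_left_mono) auto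
    then show ?thesis
      using r_pos by (simp add: algebra_simps)
  qed
  moreover have "- (r * (opt_value - J f)) + pairing z f \<le> penalized_sup \<rho> 0 0 z"
  proof (rule penalized_sup_ge[OF scaled_error_in_D f])
    have "\<rho> * (opt_value - J f) \<le> r * (opt_value - J f)" "0 \<le> r * (opt_value - J f)"
      using \<rho> r_pos J_le_opt_value[OF f] by (auto intro: mult_right_mono)
    then show "- (r * (opt_value - J f)) \<le> min 0 (0 - \<rho> * (opt_value - J f))"
      by simp
  qed
  ultimately show ?thesis
    by simp
qed

end

lemma abs_transform_diff_le:
  assumes f: "f \<in> F"
  shows "\<bar>cctrans c' f x - cctrans c f x\<bar> \<le> 2 * (error_size z / r)"
    "\<bar>ctrans c' f y - ctrans c f y\<bar> \<le> error_size z / r"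
proof -
  note bdd = c'.bounded_cost Fclass_bounded[OF f] bounded_cost Fclass_bounded[OF f]
  have "\<bar>c' p - c p\<bar> \<le> error_size z / r" for p
    using abs_cost_part_le[OF scaled_error_in_D, of p] r_pos
    by (simp add: perturbed_cost_eq[of p] abs_divide divide_right_mono)
  then have "\<bar>cctrans c' f x - cctrans c f x\<bar> \<le> 2 * (error_size z / r) + 0"
    "\<bar>ctrans c' f y - ctrans c f y\<bar> \<le> error_size z / r + 0"
    by (intro cctrans_diff_le[OF bdd] ctrans_diff_le[OF bdd]; simp)+
  then show "\<bar>cctrans c' f x - cctrans c f x\<bar> \<le> 2 * (error_size z / r)"
    "\<bar>ctrans c' f y - ctrans c f y\<bar> \<le> error_size z / r"
    by simp_all
qed

lemma continuous_transform_diff: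
  assumes "f \<in> F"
  shows "continuous_on UNIV (\<lambda>x. cctrans c' f x - cctrans c f x)"
    "continuous_on UNIV (\<lambda>y. ctrans c' f y - ctrans c f y)"
  using Fclass_bounded[OF assms]
  by (intro continuous_on_diff c'.continuous_cctrans continuous_cctrans c'.continuous_ctrans
      continuous_ctrans; assumption)+

lemma deviations_le:
  assumes f: "f \<in> F"
  shows "cc_deviation \<mu>' c' f \<le> 4 * (error_size z / r)" "c_deviation \<nu>' c' f \<le> 2 * (error_size z / r)"
proof -
  note cont = continuous_transform_diff[OF f] and le = abs_transform_diff_le[OF f]
  show "cc_deviation \<mu>' c' f \<le> 4 * (error_size z / r)"
    using \<mu>.abs_integral_le[OF X_compact cont(1) le(1)] \<mu>'.abs_integral_le[OF X_compact cont(1) le(1)]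
    unfolding cc_deviation_def by linarith
  show "c_deviation \<nu>' c' f \<le> 2 * (error_size z / r)"
    using \<nu>.abs_integral_le[OF Y_compact cont(2) le(2)] \<nu>'.abs_integral_le[OF Y_compact cont(2) le(2)]
    unfolding c_deviation_def by linarith
qed

lemma deviations_bdd_above: "bdd_above (cc_deviation \<mu>' c' ` F)" "bdd_above (c_deviation \<nu>' c' ` F)"
  using deviations_le by (fast intro: bdd_aboveI2)+

lemma deviations_sum:
  assumes f: "f \<in> F"
  shows "dual_value \<mu>' \<nu>' c' f = dual_value \<mu> \<nu> c' f + pairing z f / r
      + (cc_deviation \<mu>' c' f + c_deviation \<nu>' c' f)"
proof -
  note cont = c'.continuous_cctrans[OF Fclass_bounded[OF f]] continuous_cctrans[OF Fclass_bounded[OF f]]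
    c'.continuous_ctrans[OF Fclass_bounded[OF f]] continuous_ctrans[OF Fclass_bounded[OF f]]
  have "pairing z f / r = dual_value \<mu>' \<nu>' c f - J f"
    using r_pos by (simp add: pairing_scaled_error)
  then show ?thesis
    by (simp add: cc_deviation_def c_deviation_def dual_value_def \<mu>.integrable_continuous[OF X_compact]
        \<mu>'.integrable_continuous[OF X_compact] \<nu>.integrable_continuous[OF Y_compact]
        \<nu>'.integrable_continuous[OF Y_compact] cont)
qed

lemma perturbed_cost_dual_value_le:
  assumes f: "f \<in> F" and \<rho>: "\<rho> \<le> r"
  shows "r * (dual_value \<mu> \<nu> c' f - opt_value)
    \<le> min (plan_inf opt (cost_part z)) (3 * error_size z - \<rho> * (opt_value - J f))"
proof (rule min.boundedI)
  show "r * (dual_value \<mu> \<nu> c' f - opt_value) \<le> plan_inf opt (cost_part z)"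
    unfolding plan_inf_def
  proof (rule cINF_greatest[OF opt_nonempty])
    fix \<pi> assume "\<pi> \<in> opt"
    then have \<pi>: "\<pi> \<in> couplings \<mu> \<nu>" "integral\<^sup>L \<pi> c = opt_value"
      by (auto simp: opt_plans_def)
    have "dual_value \<mu> \<nu> c' f - opt_value \<le> integral\<^sup>L \<pi> (cost_part z) / r"
      using c'.weak_duality[OF \<pi>(1) Fclass_bounded[OF f]] \<pi>(2)
        integral_perturbed_cost[OF couplings_borel_prob_space(1)[OF \<pi>(1)]] by simp
    then show "r * (dual_value \<mu> \<nu> c' f - opt_value) \<le> integral\<^sup>L \<pi> (cost_part z)"
      using r_pos by (simp add: le_divide_eq mult.commute)
  qed
  have "dual_value \<mu> \<nu> c' f - J f \<le> 3 * (error_size z / r)"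
    using \<mu>.abs_integral_diff_le[OF X_compact c'.continuous_cctrans continuous_cctrans
      abs_transform_diff_le(1)[OF f]]
      \<nu>.abs_integral_diff_le[OF Y_compact c'.continuous_ctrans continuous_ctrans
          abs_transform_diff_le(2)[OF f]]
      Fclass_bounded[OF f] unfolding dual_value_def by linarith
  then have "r * (dual_value \<mu> \<nu> c' f - J f) \<le> r * (3 * (error_size z / r))"
    using r_pos by (intro mult_left_mono) auto
  moreover have "\<rho> * (opt_value - J f) \<le> r * (opt_value - J f)"
    using \<rho> J_le_opt_value[OF f] by (intro mult_right_mono) auto
  ultimately show "r * (dual_value \<mu> \<nu> c' f - opt_value) \<le> 3 * error_size z - \<rho> * (opt_value - J f)"
    using r_pos by (simp add: algebra_simps)
qed

end

locale concave_ot_problem = ot_problem c \<mu> \<nu> "2 * (SUP p. \<bar>c p\<bar>) + 1" "\<lambda>t. 2 * w t"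
  for c :: "'x::metric_space \<times> 'y::metric_space \<Rightarrow> real" and \<mu> :: "'x measure" and \<nu> :: "'y measure"
    and w :: "real \<Rightarrow> real" +
  assumes w_modulus: "concave_modulus w" and cost_le_w: "\<bar>c (x, y) - c (x', y)\<bar> \<le> w (dist x x')"

lemma (in compact_cost) abs_cost_le_SUP: "\<bar>c p\<bar> \<le> (SUP p. \<bar>c p\<bar>)"
proof -
  obtain K where "\<And>p. \<bar>c p\<bar> \<le> K"
    using bounded_rangeE[OF bounded_cost] by blast
  then show ?thesis
    by (intro cSUP_upper bdd_aboveI2) auto
qed

lemma (in compact_cost) concave_ot_problemI:
  assumes \<mu>: "borel_prob_space \<mu>" and \<nu>: "borel_prob_space \<nu>" and w: "concave_modulus w"
    and c_w: "\<And>x x' y. \<bar>c (x, y) - c (x', y)\<bar> \<le> w (dist x x')"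
  shows "concave_ot_problem c \<mu> \<nu> w"
proof (intro concave_ot_problem.intro ot_problem.intro compact_cost_axioms \<mu> \<nu> ot_problem_axioms.intro
    concave_ot_problem_axioms.intro w c_w)
  show "\<bar>c p\<bar> \<le> 2 * (SUP p. \<bar>c p\<bar>) + 1" for p
    using abs_cost_le_SUP[of p] by linarith
  show "\<bar>c (x, y) - c (x', y)\<bar> \<le> 2 * w (dist x x')" for x y x'
    using c_w[of x y x'] by linarith
  show "((\<lambda>t. 2 * w t) \<longlongrightarrow> 0) (at_right 0)"
    by (rule tendsto_mult_right_zero[OF concave_modulusD(5)[OF w]])
qed

locale perturbed_concave_ot = concave_ot_problem c \<mu> \<nu> w +
  perturbed_ot c c' \<mu> \<mu>' \<nu> \<nu>' "2 * (SUP p. \<bar>c p\<bar>) + 1" "\<lambda>t. 2 * w t" r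
  for c c' :: "'x::metric_space \<times> 'y::metric_space \<Rightarrow> real" and \<mu> \<mu>' :: "'x measure" and \<nu> \<nu>' :: "'y measure"
    and w :: "real \<Rightarrow> real" and r :: real
begin

context
  fixes \<delta> :: real
  assumes \<delta>: "0 < \<delta>" "2 * error_size z \<le> r * w \<delta>" and size: "error_size z \<le> r"
begin

lemma perturbed_cost_modulus: "c' (x, y) - c' (x', y) \<le> osc \<delta> (cost_part z) / r + 2 * w (dist x x')"
proof -
  have "0 \<le> osc \<delta> (cost_part z) / r" "0 \<le> w (dist x x')"
    using osc_nonneg[OF bounded_cost_part[OF scaled_error_in_D]] \<delta>(1) r_pos
      concave_modulusD(2)[OF w_modulus] by auto
  moreover have "(cost_part z (x, y) - cost_part z (x', y)) / r \<le> osc \<delta> (cost_part z) / r"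
    if "dist x x' \<le> \<delta>"
    using abs_diff_le_osc[OF bounded_cost_part[OF scaled_error_in_D] that, of y] r_pos
    by (intro divide_right_mono) auto
  moreover have "(cost_part z (x, y) - cost_part z (x', y)) / r \<le> w (dist x x')" if "\<not> dist x x' \<le> \<delta>"
  proof -
    have "cost_part z (x, y) - cost_part z (x', y) \<le> 2 * error_size z"
      using abs_cost_part_le[OF scaled_error_in_D, of "(x, y)"]
        abs_cost_part_le[OF scaled_error_in_D, of "(x', y)"] by linarith
    also have "\<dots> \<le> r * w \<delta>"
      by (rule \<delta>(2))
    also have "\<dots> \<le> r * w (dist x x')"
      using that \<delta>(1) r_pos by (intro mult_left_mono concave_modulusD(3)[OF w_modulus]) auto
    finally show ?thesis
      using r_pos by (simp add: divide_le_eq mult.commute)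
  qed
  moreover have "c' (x, y) - c' (x', y) = c (x, y) - c (x', y)
      + (cost_part z (x, y) - cost_part z (x', y)) / r"
    using r_pos by (simp add: perturbed_cost_eq[of "(x, y)"] perturbed_cost_eq[of "(x', y)"]
      diff_divide_distrib)
  ultimately show ?thesis
    using cost_le_w[of x y x'] by linarith
qed

lemma abs_perturbed_cost_le: "\<bar>c' p\<bar> \<le> (SUP p. \<bar>c p\<bar>) + 1"
proof -
  have "\<bar>c' p\<bar> \<le> \<bar>c p\<bar> + \<bar>cost_part z p / r\<bar>"
    unfolding perturbed_cost_eq[of p] by (rule abs_triangle_ineq)
  moreover have "\<bar>cost_part z p / r\<bar> \<le> 1"
    using abs_cost_part_le[OF scaled_error_in_D, of p] size r_pos by (simp add: divide_le_eq abs_divide)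
  ultimately show ?thesis
    using abs_cost_le_SUP[of p] by linarith
qed

lemma ex_potential_perturbed_cost:
  obtains f where "f \<in> F" "OT \<mu>' \<nu>' c' \<le> dual_value \<mu>' \<nu>' c' f + 4 * (osc \<delta> (cost_part z) / r)"
proof -
  define k where "k t = 2 * w t" for t
  define C where "C = (SUP p. \<bar>c p\<bar>)"
  have k: "concave_modulus k"
    unfolding k_def[abs_def] by (rule concave_modulus_scale[OF w_modulus]) simp
  define c'' where "c'' = inf_convolution k c'"
  interpret c'': compact_cost c''
    unfolding c''_def by (rule c'.compact_cost_inf_convolution[OF k])
  have "\<bar>c' p\<bar> \<le> C + 1" for p
    unfolding C_def by (rule abs_perturbed_cost_le)
  then have "\<bar>c'' p\<bar> \<le> C + 1" for p
    using c'.abs_inf_convolution_le[OF k, of "C + 1" "fst p" "snd p"] by (simp add: c''_def)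
  moreover have "\<bar>c'' (x, y) - c'' (x', y)\<bar> \<le> k (dist x x')" for x x' y
    unfolding c''_def by (rule c'.inf_convolution_modulus[OF k])
  ultimately obtain \<pi> f where \<pi>: "\<pi> \<in> couplings \<mu>' \<nu>'" and f: "f \<in> Fclass (C + 1) k"
    and eq: "integral\<^sup>L \<pi> c'' = dual_value \<mu>' \<nu>' c'' f"
    using c''.Kantorovich_duality[OF perturbed_marginals_borel_prob_space, of "C + 1" k]
      concave_modulusD(5)[OF k] by blast
  have "0 \<le> C"
    using abs_cost_le_SUP[of undefined] by (simp add: C_def)
  then have fF: "f \<in> F"
    using Fclass_mono[of "C + 1" "2 * C + 1" k k] f by (auto simp: C_def k_def[abs_def])
  have c''_close: "\<bar>c'' p - c' p\<bar> \<le> osc \<delta> (cost_part z) / r" for p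
    using c'.abs_inf_convolution_diff_le[OF k perturbed_cost_modulus[folded k_def], of "fst p" "snd p"]
    by (simp add: c''_def)
  have "integral\<^sup>L \<pi> c' \<le> integral\<^sup>L \<pi> c'' + osc \<delta> (cost_part z) / r"
    using borel_prob_space.abs_integral_diff_le[OF couplings_borel_prob_space(1)[OF \<pi>] XY_compact
        c''.cost_continuous c'.cost_continuous c''_close] by linarith
  moreover have "\<bar>dual_value \<mu>' \<nu>' c'' f - dual_value \<mu>' \<nu>' c' f\<bar> \<le> 3 * (osc \<delta> (cost_part z) / r) + 2 * 0"
    by (intro dual_value_diff_le c''.compact_cost_axioms c'.compact_cost_axioms
        perturbed_marginals_borel_prob_space Fclass_bounded[OF f] c''_close) simp
  ultimately have "OT \<mu>' \<nu>' c' \<le> dual_value \<mu>' \<nu>' c' f + 4 * (osc \<delta> (cost_part z) / r)"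
    using c'.OT_le[OF \<pi>] eq by linarith
  then show thesis
    using that fF by blast
qed

lemma perturbed_OT_le_osc:
  assumes \<rho>: "\<rho> \<le> r"
  shows "r * (OT \<mu>' \<nu>' c' - opt_value)
    \<le> penalized_sup \<rho> (plan_inf opt (cost_part z)) (3 * error_size z) z + 4 * osc \<delta> (cost_part z)
      + ((SUP f\<in>F. r * cc_deviation \<mu>' c' f) + (SUP f\<in>F. r * c_deviation \<nu>' c' f))"
proof -
  obtain f where f: "f \<in> F" and le: "OT \<mu>' \<nu>' c' \<le> dual_value \<mu>' \<nu>' c' f + 4 * (osc \<delta> (cost_part z) / r)"
    using ex_potential_perturbed_cost by blast
  have "r * (OT \<mu>' \<nu>' c' - opt_value) \<le> r * (dual_value \<mu> \<nu> c' f + pairing z f / r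
      + (cc_deviation \<mu>' c' f + c_deviation \<nu>' c' f) + 4 * (osc \<delta> (cost_part z) / r) - opt_value)"
    using le r_pos by (intro mult_left_mono) (auto simp: deviations_sum[OF f])
  also have "\<dots> = (r * (dual_value \<mu> \<nu> c' f - opt_value) + pairing z f) + 4 * osc \<delta> (cost_part z)
      + (r * cc_deviation \<mu>' c' f + r * c_deviation \<nu>' c' f)"
    using r_pos by (simp add: algebra_simps)
  finally have "r * (OT \<mu>' \<nu>' c' - opt_value) \<le> \<dots>" .
  moreover have "r * cc_deviation \<mu>' c' f \<le> (SUP f\<in>F. r * cc_deviation \<mu>' c' f)"
    "r * c_deviation \<nu>' c' f \<le> (SUP f\<in>F. r * c_deviation \<nu>' c' f)"
    using r_pos by (intro cSUP_upper[OF f] bdd_above_mult_left deviations_bdd_above; simp)+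
  ultimately show ?thesis
    using penalized_sup_ge[OF scaled_error_in_D f perturbed_cost_dual_value_le[OF f \<rho>]] by linarith
qed

end

end

section \<open>Limit theorems for optimal values\<close>

lemma cSUP_scale_le_abs_cSUP:
  fixes e :: "'i \<Rightarrow> real"
  assumes "A \<noteq> {}" "bdd_above (e ` A)" "0 \<le> a" "a \<le> b"
  shows "(SUP i\<in>A. a * e i) \<le> \<bar>SUP i\<in>A. b * e i\<bar>"
proof (rule cSUP_least[OF assms(1)])
  fix i assume i: "i \<in> A"
  have "b * e i \<le> (SUP i\<in>A. b * e i)"
    using assms(3,4) by (intro cSUP_upper[OF i] bdd_above_mult_left assms(2)) linarith
  moreover have "a * e i \<le> b * e i \<or> a * e i \<le> 0"
    using assms(3,4) mult_right_mono[of a b "e i"] mult_nonneg_nonpos[of a "e i"] by linarith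
  ultimately show "a * e i \<le> \<bar>SUP i\<in>A. b * e i\<bar>"
    by linarith
qed

locale ot_limit = ot_problem c \<mu> \<nu> B W + P: prob_space P + Q: prob_space Q
  for c :: "'x::metric_space \<times> 'y::metric_space \<Rightarrow> real" and \<mu> :: "'x measure" and \<nu> :: "'y measure"
    and B :: real and W :: "real \<Rightarrow> real" and P :: "'o measure" and Q :: "'q measure" +
  fixes \<mu>' :: "nat \<Rightarrow> 'o \<Rightarrow> 'x measure" and \<nu>' :: "nat \<Rightarrow> 'o \<Rightarrow> 'y measure"
    and c' :: "nat \<Rightarrow> 'o \<Rightarrow> 'x \<times> 'y \<Rightarrow> real" and r :: "nat \<Rightarrow> real" and L :: "'q \<Rightarrow> ('x, 'y) ot_error"
  assumes eventually_prob: "\<forall>\<^sub>F k in sequentially. \<forall>\<omega>\<in>space P. borel_prob_space (\<mu>' k \<omega>)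
      \<and> borel_prob_space (\<nu>' k \<omega>)"
    and perturbed_continuous: "\<omega> \<in> space P \<Longrightarrow> continuous_on UNIV (c' k \<omega>)"
    and rate_at_top: "filterlim r at_top sequentially"
    and consistent: "0 < e \<Longrightarrow> (\<lambda>k. outer_prob P {\<omega> \<in> space P. \<not> BL_close e (\<mu>' k \<omega>) \<mu>}) \<longlonglongrightarrow> 0"
      "0 < e \<Longrightarrow> (\<lambda>k. outer_prob P {\<omega> \<in> space P. \<not> BL_close e (\<nu>' k \<omega>) \<nu>}) \<longlonglongrightarrow> 0"
    and error_limit: "HJ_conv P (\<lambda>k \<omega>. scaled_error (r k) (\<mu>' k \<omega>) (\<nu>' k \<omega>) (c' k \<omega>)) dD D Q L"
begin

abbreviation "Z k \<omega> \<equiv> scaled_error (r k) (\<mu>' k \<omega>) (\<nu>' k \<omega>) (c' k \<omega>)"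
abbreviation "value_error k \<omega> \<equiv> r k * (OT (\<mu>' k \<omega>) (\<nu>' k \<omega>) (c' k \<omega>) - opt_value)"

lemmas prob_spaces = P.prob_space_axioms Q.prob_space_axioms

lemma eventually_perturbed_ot:
  "\<forall>\<^sub>F k in sequentially. \<forall>\<omega>\<in>space P. perturbed_ot c (c' k \<omega>) \<mu> (\<mu>' k \<omega>) \<nu> (\<nu>' k \<omega>) B W (r k)"
proof -
  have "\<forall>\<^sub>F k in sequentially. 0 < r k"
    using rate_at_top by (simp add: filterlim_at_top_dense)
  with eventually_prob show ?thesis
    by eventually_elim (simp add: perturbed_ot_def perturbed_ot_axioms_def ot_problem_axioms compact_cost_def
        X_compact Y_compact perturbed_continuous)
qed

lemma eventually_deviations_SUP_le:
  assumes "\<And>k. r k \<le> s k"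
  shows "\<forall>\<^sub>F k in sequentially. \<forall>\<omega>\<in>space P.
      (SUP f\<in>F. r k * cc_deviation (\<mu>' k \<omega>) (c' k \<omega>) f) \<le> \<bar>SUP f\<in>F. s k * cc_deviation (\<mu>' k \<omega>) (c' k \<omega>) f\<bar>"
    and "\<forall>\<^sub>F k in sequentially. \<forall>\<omega>\<in>space P.
      (SUP f\<in>F. r k * c_deviation (\<nu>' k \<omega>) (c' k \<omega>) f) \<le> \<bar>SUP f\<in>F. s k * c_deviation (\<nu>' k \<omega>) (c' k \<omega>) f\<bar>"
  using assms by (auto intro!: eventually_mono[OF eventually_perturbed_ot] cSUP_scale_le_abs_cSUP F_nonempty
      perturbed_ot.deviations_bdd_above less_imp_le[OF perturbed_ot.r_pos])

lemma asymp_le_deviations_rescale: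
  assumes "\<And>k. r k \<le> s k"
  shows "(\<And>e. 0 < e \<Longrightarrow> (\<lambda>k. outer_prob P {\<omega> \<in> space P. e < \<bar>SUP f\<in>F. s k * cc_deviation (\<mu>' k \<omega>) (c' k \<omega>) f\<bar>})
        \<longlonglongrightarrow> 0)
      \<Longrightarrow> asymp_le P (\<lambda>k \<omega>. SUP f\<in>F. r k * cc_deviation (\<mu>' k \<omega>) (c' k \<omega>) f) (\<lambda>_ _. 0)"
    and "(\<And>e. 0 < e \<Longrightarrow> (\<lambda>k. outer_prob P {\<omega> \<in> space P. e < \<bar>SUP f\<in>F. s k * c_deviation (\<nu>' k \<omega>) (c' k \<omega>) f\<bar>})
        \<longlonglongrightarrow> 0)
      \<Longrightarrow> asymp_le P (\<lambda>k \<omega>. SUP f\<in>F. r k * c_deviation (\<nu>' k \<omega>) (c' k \<omega>) f) (\<lambda>_ _. 0)"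
  using P.asymp_le_0I[OF eventually_deviations_SUP_le(1)[OF assms]]
    P.asymp_le_0I[OF eventually_deviations_SUP_le(2)[OF assms]] by blast+

lemma AE_continuous_errors: "AE q in Q. L q \<in> continuous_errors"
proof (rule D.HJ_conv_limit_in_closed[OF _ _ prob_spaces error_limit])
  show "continuous_errors \<subseteq> D"
    by (auto simp: continuous_errors_def)
  show "continuous_errors \<noteq> {}"
    using zero_error_continuous by blast
  show "\<forall>\<^sub>F k in sequentially. \<forall>\<omega>\<in>space P. Z k \<omega> \<in> continuous_errors"
    using eventually_perturbed_ot by eventually_elim (blast intro: perturbed_ot.scaled_error_continuous)
qed (rule continuous_errors_closed)

lemma error_size_negligible:
  assumes "0 < \<eta>"
  shows "(\<lambda>k. outer_prob P {\<omega> \<in> space P. \<eta> * r k < error_size (Z k \<omega>)}) \<longlonglongrightarrow> 0"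
proof (rule HJ_conv_outer_prob_exceeds_rate[OF prob_spaces error_limit])
  show "pm_cont dD D error_size"
    unfolding error_size_def[abs_def] by (rule D.pm_cont_dist_to[OF zero_error_in_D])
  show "filterlim (\<lambda>k. \<eta> * r k) at_top sequentially"
    using filterlim_tendsto_pos_mult_at_top[OF tendsto_const assms rate_at_top] .
qed

definition bad_event :: "real \<Rightarrow> nat \<Rightarrow> 'o set" where
  "bad_event e k = {\<omega> \<in> space P. \<not> BL_close e (\<mu>' k \<omega>) \<mu>} \<union> {\<omega> \<in> space P. \<not> BL_close e (\<nu>' k \<omega>) \<nu>}
     \<union> {\<omega> \<in> space P. e / 4 * r k < error_size (Z k \<omega>)}"

lemma bad_event_negligible: "0 < e \<Longrightarrow> (\<lambda>k. outer_prob P (bad_event e k)) \<longlonglongrightarrow> 0"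
  unfolding bad_event_def by (intro P.outer_prob_tendsto_0_Un consistent error_size_negligible) auto

lemma not_bad_eventD:
  assumes "\<omega> \<in> space P" "\<omega> \<notin> bad_event e k" "0 < r k"
  shows "BL_close e (\<mu>' k \<omega>) \<mu>" "BL_close e (\<nu>' k \<omega>) \<nu>" "4 * error_size (Z k \<omega>) / r k \<le> e"
  using assms by (auto simp: bad_event_def divide_le_eq)

lemma lower_approx_asymp_le_value_error: "asymp_le P (\<lambda>k \<omega>. lower_approx j (Z k \<omega>)) value_error"
proof (rule P.asymp_le_off_null_set[OF _ bad_event_negligible[of "1 / real (Suc j)"]])
  show "\<forall>\<^sub>F k in sequentially. \<forall>\<omega>\<in>space P. \<omega> \<notin> bad_event (1 / real (Suc j)) k
      \<longrightarrow> lower_approx j (Z k \<omega>) \<le> value_error k \<omega>"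
    using eventually_perturbed_ot
  proof eventually_elim
    case (elim k)
    show ?case
    proof (intro ballI impI)
      fix \<omega> assume \<omega>: "\<omega> \<in> space P" "\<omega> \<notin> bad_event (1 / real (Suc j)) k"
      interpret perturbed_ot c "c' k \<omega>" \<mu> "\<mu>' k \<omega>" \<nu> "\<nu>' k \<omega>" B W "r k"
        using elim \<omega>(1) by blast
      show "lower_approx j (Z k \<omega>) \<le> value_error k \<omega>"
        unfolding lower_approx_def by (rule perturbed_OT_ge[OF not_bad_eventD[OF \<omega> r_pos]])
    qed
  qed
qed simp

lemma value_error_asymp_le_upper_approx: "asymp_le P value_error (\<lambda>k \<omega>. upper_approx j (Z k \<omega>))"
proof (rule P.asymp_le_off_null_set[OF _ bad_event_negligible[of "1 / real (Suc j)"]])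
  have "\<forall>\<^sub>F k in sequentially. real j \<le> r k"
    using rate_at_top by (simp add: filterlim_at_top)
  with eventually_perturbed_ot
  show "\<forall>\<^sub>F k in sequentially. \<forall>\<omega>\<in>space P. \<omega> \<notin> bad_event (1 / real (Suc j)) k
      \<longrightarrow> value_error k \<omega> \<le> upper_approx j (Z k \<omega>)"
  proof eventually_elim
    case (elim k)
    show ?case
    proof (intro ballI impI)
      fix \<omega> assume \<omega>: "\<omega> \<in> space P" "\<omega> \<notin> bad_event (1 / real (Suc j)) k"
      interpret perturbed_ot c "c' k \<omega>" \<mu> "\<mu>' k \<omega>" \<nu> "\<nu>' k \<omega>" B W "r k"
        using elim(1) \<omega>(1) by blast
      show "value_error k \<omega> \<le> upper_approx j (Z k \<omega>)"
        unfolding upper_approx_def by (rule perturbed_OT_le[OF not_bad_eventD[OF \<omega> r_pos] elim(2)])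
    qed
  qed
qed simp

lemma AE_lower_approx_tendsto: "AE q in Q. (\<lambda>j. lower_approx j (L q)) \<longlonglongrightarrow> ot_derivative (L q)"
proof (rule AE_I2)
  fix q assume "q \<in> space Q"
  then show "(\<lambda>j. lower_approx j (L q)) \<longlonglongrightarrow> ot_derivative (L q)"
    by (intro lower_approx_tendsto HJ_conv_in(2)[OF error_limit])
qed

theorem OT_limit_unique_plan:
  assumes "opt = {\<pi>}"
  shows "HJ_conv P value_error dist UNIV Q (\<lambda>q. ot_derivative (L q))"
proof (rule HJ_conv_sandwich[OF prob_spaces error_limit pm_cont_ot_derivative pm_cont_upper_approx
      pm_cont_lower_approx _ AE_lower_approx_tendsto value_error_asymp_le_upper_approx
      lower_approx_asymp_le_value_error])
  show "AE q in Q. (\<lambda>j. upper_approx j (L q)) \<longlonglongrightarrow> ot_derivative (L q)"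
    using AE_continuous_errors by eventually_elim (rule upper_approx_tendsto[OF _ assms])
qed

end

locale concave_ot_limit = concave_ot_problem c \<mu> \<nu> w +
  ot_limit c \<mu> \<nu> "2 * (SUP p. \<bar>c p\<bar>) + 1" "\<lambda>t. 2 * w t" P Q \<mu>' \<nu>' c' r L
  for c :: "'x::metric_space \<times> 'y::metric_space \<Rightarrow> real" and \<mu> :: "'x measure" and \<nu> :: "'y measure"
    and w :: "real \<Rightarrow> real" and P :: "'o measure" and Q :: "'q measure" and \<mu>' \<nu>' c' r L
begin

lemma value_error_asymp_le_upper_approx_osc:
  assumes w_pos: "\<And>\<delta>. 0 < \<delta> \<Longrightarrow> 0 < w \<delta>"
    and dev: "asymp_le P (\<lambda>k \<omega>. SUP f\<in>F. r k * cc_deviation (\<mu>' k \<omega>) (c' k \<omega>) f) (\<lambda>_ _. 0)"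
      "asymp_le P (\<lambda>k \<omega>. SUP f\<in>F. r k * c_deviation (\<nu>' k \<omega>) (c' k \<omega>) f) (\<lambda>_ _. 0)"
  shows "asymp_le P value_error (\<lambda>k \<omega>. upper_approx_osc j (Z k \<omega>))"
proof -
  define \<delta> where "\<delta> = 1 / real (Suc j)"
  have \<delta>: "0 < \<delta>" "0 < w \<delta>"
    using w_pos by (auto simp: \<delta>_def)
  define S where "S k \<omega> = (SUP f\<in>F. r k * cc_deviation (\<mu>' k \<omega>) (c' k \<omega>) f)
      + (SUP f\<in>F. r k * c_deviation (\<nu>' k \<omega>) (c' k \<omega>) f)" for k \<omega>
  define large where "large k = {\<omega> \<in> space P. w \<delta> / 2 * r k < error_size (Z k \<omega>)}
      \<union> {\<omega> \<in> space P. r k < error_size (Z k \<omega>)}" for k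
  have "asymp_le P value_error (\<lambda>k \<omega>. upper_approx_osc j (Z k \<omega>) + S k \<omega>)"
  proof (rule P.asymp_le_off_null_set)
    show "(\<lambda>k. outer_prob P (large k)) \<longlonglongrightarrow> 0"
      unfolding large_def using \<delta>(2) error_size_negligible[of "w \<delta> / 2"] error_size_negligible[of 1]
      by (intro P.outer_prob_tendsto_0_Un) simp_all
    have "\<forall>\<^sub>F k in sequentially. real j \<le> r k"
      using rate_at_top by (simp add: filterlim_at_top)
    with eventually_perturbed_ot show "\<forall>\<^sub>F k in sequentially. \<forall>\<omega>\<in>space P. \<omega> \<notin> large k
        \<longrightarrow> value_error k \<omega> \<le> upper_approx_osc j (Z k \<omega>) + S k \<omega>"
    proof eventually_elim
      case (elim k)
      show ?case
      proof (intro ballI impI)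
        fix \<omega> assume \<omega>: "\<omega> \<in> space P" "\<omega> \<notin> large k"
        interpret perturbed_concave_ot c "c' k \<omega>" \<mu> "\<mu>' k \<omega>" \<nu> "\<nu>' k \<omega>" w "r k"
          using elim(1) \<omega>(1) concave_ot_problem_axioms by (blast intro: perturbed_concave_ot.intro)
        have size: "2 * error_size (Z k \<omega>) \<le> r k * w \<delta>" "error_size (Z k \<omega>) \<le> r k"
          using \<omega> by (auto simp: large_def algebra_simps)
        show "value_error k \<omega> \<le> upper_approx_osc j (Z k \<omega>) + S k \<omega>"
          using perturbed_OT_le_osc[OF \<delta>(1) size elim(2)] unfolding upper_approx_osc_def S_def \<delta>_def .
      qed
    qed
  qed
  moreover have "asymp_le P (\<lambda>k \<omega>. upper_approx_osc j (Z k \<omega>) + S k \<omega>) (\<lambda>k \<omega>. upper_approx_osc j (Z k \<omega>))"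
    using P.asymp_le_add[OF dev] by (simp add: asymp_le_def S_def algebra_simps)
  ultimately show ?thesis
    by (rule P.asymp_le_trans)
qed

theorem OT_limit_negligible_deviations:
  assumes w_pos: "\<And>\<delta>. 0 < \<delta> \<Longrightarrow> 0 < w \<delta>"
    and dev: "asymp_le P (\<lambda>k \<omega>. SUP f\<in>F. r k * cc_deviation (\<mu>' k \<omega>) (c' k \<omega>) f) (\<lambda>_ _. 0)"
      "asymp_le P (\<lambda>k \<omega>. SUP f\<in>F. r k * c_deviation (\<nu>' k \<omega>) (c' k \<omega>) f) (\<lambda>_ _. 0)"
  shows "HJ_conv P value_error dist UNIV Q (\<lambda>q. ot_derivative (L q))"
proof (rule HJ_conv_sandwich[OF prob_spaces error_limit pm_cont_ot_derivative pm_cont_upper_approx_osc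
      pm_cont_lower_approx _ AE_lower_approx_tendsto value_error_asymp_le_upper_approx_osc[OF w_pos dev]
      lower_approx_asymp_le_value_error])
  show "AE q in Q. (\<lambda>j. upper_approx_osc j (L q)) \<longlonglongrightarrow> ot_derivative (L q)"
    using AE_continuous_errors by eventually_elim (rule upper_approx_osc_tendsto)
qed

end

section \<open>Empirical measures\<close>

lemma rate_le_sqrt: "rate n m \<le> sqrt (real n)" "rate n m \<le> sqrt (real m)"
proof -
  have "real n * real m \<le> real n * (real n + real m)" "real n * real m \<le> real m * (real n + real m)"
    by (auto simp: algebra_simps)
  then have "real n * real m / (real n + real m) \<le> real n" "real n * real m / (real n + real m) \<le> real m"
    by (cases "real n + real m = 0"; simp add: divide_le_eq)+
  then show "rate n m \<le> sqrt (real n)" "rate n m \<le> sqrt (real m)"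
    unfolding rate_def by simp_all
qed

lemma admissible_rate_at_top:
  assumes "admissible N M lam" "0 < lam"
  shows "filterlim (\<lambda>k. rate (N k) (M k)) at_top sequentially"
proof -
  have N: "filterlim (\<lambda>k. real (N k)) at_top sequentially"
    using assms(1) by (auto simp: admissible_def intro: filterlim_compose[OF filterlim_real_sequentially])
  have "(\<lambda>k. real (M k) / (real (N k) + real (M k))) \<longlonglongrightarrow> lam"
    using assms(1) by (simp add: admissible_def)
  from filterlim_tendsto_pos_mult_at_top[OF this assms(2) N]
  have "filterlim (\<lambda>k. real (N k) * real (M k) / (real (N k) + real (M k))) at_top sequentially"
    by (simp add: mult.commute)
  then show ?thesis
    unfolding rate_def by (rule filterlim_compose[OF sqrt_at_top])
qed

lemma (in concave_ot_problem) concave_ot_limit_emp_meas: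
  assumes P: "prob_space P" and Q: "prob_space Q"
    and X: "\<And>i. X i \<in> borel_measurable P" "\<And>i. distr P borel (X i) = \<mu>"
      "prob_space.indep_vars P (\<lambda>_. borel) X UNIV"
    and Y: "\<And>j. Y j \<in> borel_measurable P" "\<And>j. distr P borel (Y j) = \<nu>"
      "prob_space.indep_vars P (\<lambda>_. borel) Y UNIV"
    and sizes: "filterlim N at_top sequentially" "filterlim M at_top sequentially"
    and c': "\<And>k \<omega>. \<omega> \<in> space P \<Longrightarrow> continuous_on UNIV (c' k \<omega>)" and r: "filterlim r at_top sequentially"
    and lim: "HJ_conv P (\<lambda>k \<omega>. scaled_error (r k) (emp_meas (N k) (\<lambda>i. X i \<omega>)) (emp_meas (M k) (\<lambda>j. Y j \<omega>))
        (c' k \<omega>)) dD D Q L"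
  shows "concave_ot_limit c \<mu> \<nu> w P Q (\<lambda>k \<omega>. emp_meas (N k) (\<lambda>i. X i \<omega>)) (\<lambda>k \<omega>. emp_meas (M k) (\<lambda>j. Y j \<omega>))
      c' r L"
proof (intro concave_ot_limit.intro ot_limit.intro ot_limit_axioms.intro concave_ot_problem_axioms
    ot_problem_axioms P Q c' r lim)
  interpret P: prob_space P by (rule P)
  show "\<forall>\<^sub>F k in sequentially. \<forall>\<omega>\<in>space P. borel_prob_space (emp_meas (N k) (\<lambda>i. X i \<omega>))
      \<and> borel_prob_space (emp_meas (M k) (\<lambda>j. Y j \<omega>))"
    using eventually_compose_filterlim[OF eventually_gt_at_top[of 0] sizes(1)]
      eventually_compose_filterlim[OF eventually_gt_at_top[of 0] sizes(2)]
    by eventually_elim (simp add: borel_prob_space_emp_meas)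
  show "(\<lambda>k. outer_prob P {\<omega> \<in> space P. \<not> BL_close e (emp_meas (N k) (\<lambda>i. X i \<omega>)) \<mu>}) \<longlonglongrightarrow> 0" if "0 < e" for e
    by (rule filterlim_compose[OF P.emp_meas_BL_consistent[OF X_compact X that] sizes(1)])
  show "(\<lambda>k. outer_prob P {\<omega> \<in> space P. \<not> BL_close e (emp_meas (M k) (\<lambda>j. Y j \<omega>)) \<nu>}) \<longlonglongrightarrow> 0" if "0 < e" for e
    by (rule filterlim_compose[OF P.emp_meas_BL_consistent[OF Y_compact Y that] sizes(2)])
qed

theorem mainTheorem4:
  fixes \<mu> :: "'x::metric_space measure" and \<nu> :: "'y::metric_space measure"
    and c :: "'x \<times> 'y \<Rightarrow> real" and w :: "real \<Rightarrow> real"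
    and P :: "'o measure" and X :: "nat \<Rightarrow> 'o \<Rightarrow> 'x" and Y :: "nat \<Rightarrow> 'o \<Rightarrow> 'y"
    and cnm :: "nat \<Rightarrow> nat \<Rightarrow> 'o \<Rightarrow> 'x \<times> 'y \<Rightarrow> real"
    and lam :: real
    and Q :: "'q measure"
    and Gmu :: "'q \<Rightarrow> ('x \<Rightarrow> real) \<Rightarrow> real" and Gnu :: "'q \<Rightarrow> ('y \<Rightarrow> real) \<Rightarrow> real"
    and Gc :: "'q \<Rightarrow> 'x \<times> 'y \<Rightarrow> real"
    and F :: "('x \<Rightarrow> real) set"
  defines "F \<equiv> Fclass (2 * (SUP p. \<bar>c p\<bar>) + 1) (\<lambda>t. 2 * w t)"
  assumes X_cpt: "compact (UNIV :: 'x set)" and Y_cpt: "compact (UNIV :: 'y set)"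
    and c_cont: "continuous_on UNIV c"
    and w_mod: "concave_modulus w" and w_pos: "\<forall>\<delta>>0. w \<delta> > 0"
    and c_w: "\<forall>x x' y. \<bar>c (x, y) - c (x', y)\<bar> \<le> w (dist x x')"
    and mu: "prob_space \<mu>" "sets \<mu> = sets borel"
    and nu: "prob_space \<nu>" "sets \<nu> = sets borel"
    and P: "prob_space P"
    and X_rv: "\<forall>i. X i \<in> borel_measurable P \<and> distr P borel (X i) = \<mu>"
    and Y_rv: "\<forall>j. Y j \<in> borel_measurable P \<and> distr P borel (Y j) = \<nu>"
    and X_iid: "prob_space.indep_vars P (\<lambda>_. borel) X UNIV"
    and Y_iid: "prob_space.indep_vars P (\<lambda>_. borel) Y UNIV"
    and XY_indep: "prob_space.indep_set P
         {(\<lambda>\<omega> i. X i \<omega>) -` A \<inter> space P | A. A \<in> sets (Pi\<^sub>M UNIV (\<lambda>_. borel))}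
         {(\<lambda>\<omega> j. Y j \<omega>) -` B \<inter> space P | B. B \<in> sets (Pi\<^sub>M UNIV (\<lambda>_. borel))}"
    and cnm_cont: "\<forall>n m. \<forall>\<omega>\<in>space P. continuous_on UNIV (cnm n m \<omega>)"
    and cnm_meas: "\<forall>n m p. (\<lambda>\<omega>. cnm n m \<omega> p) \<in> borel_measurable P"
    and lam: "0 < lam" "lam < 1"
    and Q: "prob_space Q"
    and A3: "\<forall>N M. admissible N M lam \<longrightarrow>
       HJ_conv P
         (\<lambda>k \<omega>. ((\<lambda>g. rate (N k) (M k) *
                      (integral\<^sup>L (emp_meas (N k) (\<lambda>i. X i \<omega>)) g - integral\<^sup>L \<mu> g)),
                  (\<lambda>h. rate (N k) (M k) *
                      (integral\<^sup>L (emp_meas (M k) (\<lambda>j. Y j \<omega>)) h - integral\<^sup>L \<nu> h)),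
                  (\<lambda>p. rate (N k) (M k) * (cnm (N k) (M k) \<omega> p - c p))))
         (dist3 (cctrans c ` F) (ctrans c ` F)) (D3 (cctrans c ` F) (ctrans c ` F))
         Q (\<lambda>q. ((\<lambda>g. sqrt lam * Gmu q g), (\<lambda>h. sqrt (1 - lam) * Gnu q h), Gc q))"
    and G_tight: "tight_into Q (dist3 (cctrans c ` F) (ctrans c ` F)) (D3 (cctrans c ` F) (ctrans c ` F))
         (\<lambda>q. (Gmu q, Gnu q, Gc q))"
    and G_cov: "bb_cov Q Gmu \<mu> (cctrans c ` F)" "bb_cov Q Gnu \<nu> (ctrans c ` F)"
    and B: "(\<exists>\<pi>. opt_plans \<mu> \<nu> c = {\<pi>}) \<or>
       (\<forall>N M. admissible N M lam \<longrightarrow>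
          (\<forall>\<epsilon>>0. (\<lambda>k. outer_prob P {\<omega> \<in> space P. \<bar>SUP f\<in>F. sqrt (real (N k)) *
              (integral\<^sup>L (emp_meas (N k) (\<lambda>i. X i \<omega>)) (\<lambda>x. cctrans (cnm (N k) (M k) \<omega>) f x - cctrans c f x)
               - integral\<^sup>L \<mu> (\<lambda>x. cctrans (cnm (N k) (M k) \<omega>) f x - cctrans c f x))\<bar> > \<epsilon>}) \<longlonglongrightarrow> 0) \<and>
          (\<forall>\<epsilon>>0. (\<lambda>k. outer_prob P {\<omega> \<in> space P. \<bar>SUP f\<in>F. sqrt (real (M k)) *
              (integral\<^sup>L (emp_meas (M k) (\<lambda>j. Y j \<omega>)) (\<lambda>y. ctrans (cnm (N k) (M k) \<omega>) f y - ctrans c f y)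
               - integral\<^sup>L \<nu> (\<lambda>y. ctrans (cnm (N k) (M k) \<omega>) f y - ctrans c f y))\<bar> > \<epsilon>}) \<longlonglongrightarrow> 0))"
  shows "\<forall>N M. admissible N M lam \<longrightarrow>
    HJ_conv P
      (\<lambda>k \<omega>. rate (N k) (M k) *
          (OT (emp_meas (N k) (\<lambda>i. X i \<omega>)) (emp_meas (M k) (\<lambda>j. Y j \<omega>)) (cnm (N k) (M k) \<omega>)
           - OT \<mu> \<nu> c))
      dist UNIV Q
      (\<lambda>q. (INF \<pi>\<in>opt_plans \<mu> \<nu> c. integral\<^sup>L \<pi> (Gc q)) +
           (SUP f\<in>Sc F \<mu> \<nu> c. sqrt lam * Gmu q (cctrans c f) + sqrt (1 - lam) * Gnu q (ctrans c f)))"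
proof (intro allI impI, goal_cases admissible)
  case (admissible N M)
  let ?\<mu>N = "\<lambda>k \<omega>. emp_meas (N k) (\<lambda>i. X i \<omega>)" and ?\<nu>M = "\<lambda>k \<omega>. emp_meas (M k) (\<lambda>j. Y j \<omega>)"
  let ?L = "\<lambda>q. (\<lambda>g. sqrt lam * Gmu q g, \<lambda>h. sqrt (1 - lam) * Gnu q h, Gc q)"
  interpret cost: compact_cost c
    using X_cpt Y_cpt c_cont by unfold_locales
  interpret ot: concave_ot_problem c \<mu> \<nu> w
    using mu nu w_mod c_w by (intro cost.concave_ot_problemI) (simp_all add: borel_prob_space_iff)
  interpret lim: concave_ot_limit c \<mu> \<nu> w P Q ?\<mu>N ?\<nu>M "\<lambda>k. cnm (N k) (M k)" "\<lambda>k. rate (N k) (M k)" ?L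
    using admissible A3 X_rv Y_rv X_iid Y_iid cnm_cont
    by (intro ot.concave_ot_limit_emp_meas P Q admissible_rate_at_top[OF admissible lam(1)])
      (auto simp: admissible_def F_def ot.scaled_error_def)
  have "HJ_conv P lim.value_error dist UNIV Q (\<lambda>q. ot.ot_derivative (?L q))"
  proof (cases "\<exists>\<pi>. opt_plans \<mu> \<nu> c = {\<pi>}")
    case True
    then show ?thesis
      using lim.OT_limit_unique_plan by blast
  next
    case False
    from B[unfolded disj_imp, rule_format, OF False admissible] w_pos show ?thesis
      unfolding F_def
      by (intro lim.OT_limit_negligible_deviations lim.asymp_le_deviations_rescale(1)[OF rate_le_sqrt(1)]
          lim.asymp_le_deviations_rescale(2)[OF rate_le_sqrt(2)])
        (auto simp: ot.cc_deviation_def ot.c_deviation_def)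
  qed
  then show ?case
    by (simp add: ot.ot_derivative_def ot.dual_sup_def ot.pairing_def plan_inf_def F_def)
qed

end
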